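(* Let $S$ be the complete hyperbolic affine sphere in $\mathbb{R}^3$ given by the immersion of $(0,\infty)\times(0,\infty)$ $$(x,y)\mapsto \Bigl(-y\bigl(\tfrac32\ln x+3\ln y+x\bigr),\; x^{-3/2}y^{-2}\sqrt{1+x},\; y\Bigr)^T .$$ For $t\in[0,\tfrac{2\pi}{3}]$ put $\lambda=e^{3it}$ and define, for $(x,y)\in(0,\infty)\times\mathbb{R}$, $$\vec r_\lambda(x,y)=A\,(DB)^{-1}\begin{pmatrix}-\bigl(\coth(\sqrt3x)+\frac{2}{\sqrt3}\cos t\bigr)e^{2(-x\cos t+y\sin t)}\\[2pt] -\bigl(\coth(\sqrt3x)-\frac{-\sqrt3\sin t+\cos t}{\sqrt3}\bigr)e^{(-\sqrt3\sin t+\cos t)x+(-\sin t-\sqrt3\cos t)y}\\[2pt] -\bigl(\coth(\sqrt3x)-\frac{\sqrt3\sin t+\cos t}{\sqrt3}\bigr)e^{(\sqrt3\sin t+\cos t)x+(-\sin t+\sqrt3\cos t)y}\end{pmatrix},$$ where $$A=\begin{pmatrix}\frac1{\sqrt3}&\sqrt2&\frac4{\sqrt3}\\ -\frac{\sqrt2}{\sqrt3}&1&\frac{2\sqrt2}{\sqrt3}\\ -\frac1{\sqrt3}&\sqrt2&-\frac1{\sqrt3}\end{pmatrix},$$ $$D=\mathrm{diag}\Bigl((1+\sqrt2)^{-\frac{2}{\sqrt3}\cos t},\;(1+\sqrt2)^{-\sin t+\frac{1}{\sqrt3}\cos t},\;(1+\sqrt2)^{\sin t+\frac1{\sqrt3}\cos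 t}\Bigr),$$ and, with $\beta_1=\sqrt2+\frac{2}{\sqrt3}\cos t$, $\beta_2=\sqrt2+\sin t-\frac{\cos t}{\sqrt3}$, $\beta_3=\sqrt2-\sin t-\frac{\cos t}{\sqrt3}$, $$B=\begin{pmatrix}-\beta_1&\sqrt3+2\beta_1\cos t&-2\beta_1\sin t\\ -\beta_2&\sqrt3+\beta_2(\sqrt3\sin t-\cos t)&\beta_2(\sin t+\sqrt3\cos t)\\ -\beta_3&\sqrt3-\beta_3(\sqrt3\sin t+\cos t)&\beta_3(\sin t-\sqrt3\cos t)\end{pmatrix}.$$ (For the values $t_0$ of $t$ at which $B$ is singular, $\vec r_\lambda(x,y)$ at $t=t_0$ is understood as the limit $\lim_{t\to t_0}\vec r_\lambda(x,y)$, taken over $t$ for which $B$ is nonsingular.) Then $\{\vec r_\lambda\}$ is the associated family of $S$, and $\vec r_\lambda$ has, with $z=x+iy$, affine metric, affine mean curvature and affine cubic form coefficient given by $$g=3\Bigl(\operatorname{csch}^2(\sqrt3x)+\tfrac23\Bigr)\,dz\,d\bar z,\qquad H=-1,\qquad U\,dz^3=e^{3it}\,dz^3 .$$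
   Context: Conventions. For a locally strictly convex immersed surface $r(x,y)$ in $\mathbb{R}^3$ put $L=\det(r_x,r_y,r_{xx})$, $M=\det(r_x,r_y,r_{xy})$, $N=\det(r_x,r_y,r_{yy})$. The affine (Blaschke) metric is $g=(L\,dx^2+2M\,dx\,dy+N\,dy^2)/|LN-M^2|^{1/4}$, with the overall sign chosen so that $g$ is positive definite, and the affine normal is $\xi=\frac12\Delta^g r$. The surface is a proper affine sphere with center at the origin and affine mean curvature $H$ if $\xi=-Hr$ with $H$ a nonzero constant; it is hyperbolic if $H<0$. If $z=x+iy$ is an isothermal coordinate, $g=2e^{\psi}dz\,d\bar z$ (where $dz\,d\bar z=dx^2+dy^2$), the coefficient $U$ of the affine cubic form $U\,dz^3+\bar U\,d\bar z^3$ is normalized by the structure equations $$r_{zz}=\psi_z r_z-Ue^{-\psi}r_{\bar z},\qquad r_{z\bar z}=-He^{\psi}r .$$ The compatibility conditions are $\psi_{z\bar z}+He^{\psi}+|U|^2e^{-2\psi}=0$ and $U_{\bar z}=0$; they are invariant under $U\mapsto\lambda U$ with $|\lambda|=1$. Associated family. The associated family of an affine sphere with invariants $(g,H,U)$ in an isothermal coordinate $z$ is the family of affine spheres with the same $g$ and $H$ and with cubic form coefficient $\lambda U$, $|\lambda|=1$ (each unique up to linear maps of determinant $\pm1$). Here $S$ is first rescaled by the homothety of $\mathbb{R}^3$ with factor $-\frac1{\sqrt3}$ and reparametrized by replacing $x$ by $\sinh^2(\sqrt3x)$ and $y$ by $e^{y}/\sinh(\sqrt3x)$, with new parameters $(x,y)\in(0,\infty)\times\mathbb{R}$.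 It then becomes $$\vec r\,'(x,y)=\frac1{\sqrt3}\Bigl(\frac{e^{y}(\sinh^2(\sqrt3x)+3y)}{\sinh(\sqrt3x)},\;-e^{-2y}\coth(\sqrt3x),\;-\frac{e^{y}}{\sinh(\sqrt3x)}\Bigr)^T,$$ for which $z=x+iy$ is isothermal and which has $H=-1$. *)

theory Defs
  imports "HOL-Analysis.Analysis"
begin

definition pdx :: "(real \<Rightarrow> real \<Rightarrow> 'a::real_normed_vector) \<Rightarrow> real \<Rightarrow> real \<Rightarrow> 'a" where
  "pdx f = (\<lambda>x y. vector_derivative (\<lambda>s. f s y) (at x))"

definition pdy :: "(real \<Rightarrow> real \<Rightarrow> 'a::real_normed_vector) \<Rightarrow> real \<Rightarrow> real \<Rightarrow> 'a" where
  "pdy f = (\<lambda>x y. vector_derivative (\<lambda>s. f x s) (at y))"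

text \<open>Class $C^k$ on an open set of the plane: all iterated partial derivatives up to order
  $k$ exist and are continuous.\<close>

primrec Ck_on :: "nat \<Rightarrow> (real \<times> real) set \<Rightarrow> (real \<Rightarrow> real \<Rightarrow> 'a::real_normed_vector) \<Rightarrow> bool" where
  "Ck_on 0 \<Omega> f \<longleftrightarrow> continuous_on \<Omega> (\<lambda>(x, y). f x y)"
| "Ck_on (Suc k) \<Omega> f \<longleftrightarrow>
     continuous_on \<Omega> (\<lambda>(x, y). f x y) \<and>
     (\<forall>(x, y)\<in>\<Omega>. (\<lambda>s. f s y) differentiable (at x) \<and> (\<lambda>s. f x s) differentiable (at y)) \<and>
     Ck_on k \<Omega> (pdx f) \<and> Ck_on k \<Omega> (pdy f)"

definition smooth_map :: "(real \<times> real) set \<Rightarrow> (real \<Rightarrow> real \<Rightarrow> 'a::real_normed_vector) \<Rightarrow> bool" where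
  "smooth_map \<Omega> f \<longleftrightarrow> (\<forall>k. Ck_on k \<Omega> f)"

definition pdz :: "(real \<Rightarrow> real \<Rightarrow> complex) \<Rightarrow> real \<Rightarrow> real \<Rightarrow> complex" where
  "pdz f = (\<lambda>x y. (pdx f x y - \<i> * pdy f x y) / 2)"

definition pdzbar :: "(real \<Rightarrow> real \<Rightarrow> complex) \<Rightarrow> real \<Rightarrow> real \<Rightarrow> complex" where
  "pdzbar f = (\<lambda>x y. (pdx f x y + \<i> * pdy f x y) / 2)"

text \<open>A Riemannian metric $E\,dx^2 + 2F\,dx\,dy + G\,dy^2$ is passed as its three coefficients.\<close>

definition laplace_beltrami ::
  "(real \<Rightarrow> real \<Rightarrow> real) \<Rightarrow> (real \<Rightarrow> real \<Rightarrow> real) \<Rightarrow> (real \<Rightarrow> real \<Rightarrow> real) \<Rightarrow>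
   (real \<Rightarrow> real \<Rightarrow> 'a::real_normed_vector) \<Rightarrow> real \<Rightarrow> real \<Rightarrow> 'a" where
  "laplace_beltrami E F G f =
     (let W = (\<lambda>x y. sqrt (E x y * G x y - (F x y)\<^sup>2));
          P = (\<lambda>x y. (1 / W x y) *\<^sub>R (G x y *\<^sub>R pdx f x y - F x y *\<^sub>R pdy f x y));
          Q = (\<lambda>x y. (1 / W x y) *\<^sub>R (E x y *\<^sub>R pdy f x y - F x y *\<^sub>R pdx f x y))
      in (\<lambda>x y. (1 / W x y) *\<^sub>R (pdx P x y + pdy Q x y)))"

definition curve_length ::
  "(real \<Rightarrow> real \<Rightarrow> real) \<Rightarrow> (real \<Rightarrow> real \<Rightarrow> real) \<Rightarrow> (real \<Rightarrow> real \<Rightarrow> real) \<Rightarrow>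
   (real \<Rightarrow> real \<times> real) \<Rightarrow> real" where
  "curve_length E F G \<gamma> =
     integral {0..1} (\<lambda>s.
       let (x, y) = \<gamma> s; (u, v) = vector_derivative \<gamma> (at s)
       in sqrt (E x y * u\<^sup>2 + 2 * F x y * u * v + G x y * v\<^sup>2))"

text \<open>The Riemannian distance; meaningful on connected domains. The curves need not be regular,
  so $C^1$ curves give the same infimum as piecewise $C^1$ ones.\<close>

definition riem_dist ::
  "(real \<times> real) set \<Rightarrow> (real \<Rightarrow> real \<Rightarrow> real) \<Rightarrow> (real \<Rightarrow> real \<Rightarrow> real) \<Rightarrow> (real \<Rightarrow> real \<Rightarrow> real) \<Rightarrow>
   real \<times> real \<Rightarrow> real \<times> real \<Rightarrow> real" where
  "riem_dist \<Omega> E F G p q =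
     Inf {curve_length E F G \<gamma> |\<gamma>.
       \<gamma> C1_differentiable_on {0..1} \<and> \<gamma> ` {0..1} \<subseteq> \<Omega> \<and> \<gamma> 0 = p \<and> \<gamma> 1 = q}"

definition complete_metric ::
  "(real \<times> real) set \<Rightarrow> (real \<Rightarrow> real \<Rightarrow> real) \<Rightarrow> (real \<Rightarrow> real \<Rightarrow> real) \<Rightarrow> (real \<Rightarrow> real \<Rightarrow> real) \<Rightarrow> bool" where
  "complete_metric \<Omega> E F G \<longleftrightarrow>
     (\<forall>\<sigma>::nat \<Rightarrow> real \<times> real.
        range \<sigma> \<subseteq> \<Omega> \<and>
        (\<forall>e>0. \<exists>N. \<forall>m\<ge>N. \<forall>n\<ge>N. riem_dist \<Omega> E F G (\<sigma> m) (\<sigma> n) < e) \<longrightarrow>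
        (\<exists>p\<in>\<Omega>. (\<lambda>n. riem_dist \<Omega> E F G (\<sigma> n) p) \<longlonglongrightarrow> 0))"

type_synonym surface = "real \<Rightarrow> real \<Rightarrow> real^3"

definition det_vec :: "real^3 \<Rightarrow> real^3 \<Rightarrow> real^3 \<Rightarrow> real" where
  "det_vec a b c = det (vector [a, b, c] :: real^3^3)"

definition coef_L :: "surface \<Rightarrow> real \<Rightarrow> real \<Rightarrow> real" where
  "coef_L r x y = det_vec (pdx r x y) (pdy r x y) (pdx (pdx r) x y)"

definition coef_M :: "surface \<Rightarrow> real \<Rightarrow> real \<Rightarrow> real" where
  "coef_M r x y = det_vec (pdx r x y) (pdy r x y) (pdy (pdx r) x y)"

definition coef_N :: "surface \<Rightarrow> real \<Rightarrow> real \<Rightarrow> real" where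
  "coef_N r x y = det_vec (pdx r x y) (pdy r x y) (pdy (pdy r) x y)"

text \<open>Nonvanishing of $LN - M^2$ already forces $r_x, r_y$ to be linearly independent.\<close>

definition locally_strictly_convex :: "(real \<times> real) set \<Rightarrow> surface \<Rightarrow> bool" where
  "locally_strictly_convex \<Omega> r \<longleftrightarrow>
     (\<forall>(x, y)\<in>\<Omega>. coef_L r x y * coef_N r x y - (coef_M r x y)\<^sup>2 > 0)"

text \<open>For $LN - M^2 > 0$ the form $L\,dx^2 + 2M\,dx\,dy + N\,dy^2$ is definite, with the sign of $L$;
  multiplication by that sign makes it positive definite.\<close>

definition metric_scale :: "surface \<Rightarrow> real \<Rightarrow> real \<Rightarrow> real" where
  "metric_scale r x y =
     sgn (coef_L r x y) / \<bar>coef_L r x y * coef_N r x y - (coef_M r x y)\<^sup>2\<bar> powr (1/4)"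

definition affine_E :: "surface \<Rightarrow> real \<Rightarrow> real \<Rightarrow> real" where
  "affine_E r x y = metric_scale r x y * coef_L r x y"

definition affine_F :: "surface \<Rightarrow> real \<Rightarrow> real \<Rightarrow> real" where
  "affine_F r x y = metric_scale r x y * coef_M r x y"

definition affine_G :: "surface \<Rightarrow> real \<Rightarrow> real \<Rightarrow> real" where
  "affine_G r x y = metric_scale r x y * coef_N r x y"

definition affine_normal :: "surface \<Rightarrow> surface" where
  "affine_normal r = (\<lambda>x y. (1/2) *\<^sub>R
     laplace_beltrami (affine_E r) (affine_F r) (affine_G r) r x y)"

definition proper_affine_sphere :: "(real \<times> real) set \<Rightarrow> surface \<Rightarrow> real \<Rightarrow> bool" where
  "proper_affine_sphere \<Omega> r H \<longleftrightarrow>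
     open \<Omega> \<and> smooth_map \<Omega> r \<and> locally_strictly_convex \<Omega> r \<and> H \<noteq> 0 \<and>
     (\<forall>(x, y)\<in>\<Omega>. affine_normal r x y = - H *\<^sub>R r x y)"

definition complete_hyperbolic_affine_sphere :: "(real \<times> real) set \<Rightarrow> surface \<Rightarrow> bool" where
  "complete_hyperbolic_affine_sphere \<Omega> r \<longleftrightarrow>
     (\<exists>H<0. proper_affine_sphere \<Omega> r H) \<and>
     complete_metric \<Omega> (affine_E r) (affine_F r) (affine_G r)"

text \<open>The structure equations in an isothermal coordinate, for each of the three components of
  $r$, with $g = 2e^\psi\,dz\,d\bar z$; they normalize the coefficient $U$ of the cubic form.\<close>

definition structure_equations ::
  "(real \<times> real) set \<Rightarrow> surface \<Rightarrow> (real \<Rightarrow> real \<Rightarrow> real) \<Rightarrow> real \<Rightarrow> (real \<Rightarrow> real \<Rightarrow> complex) \<Rightarrow> bool" where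
  "structure_equations \<Omega> r \<psi> H U \<longleftrightarrow>
     (\<forall>(x, y)\<in>\<Omega>. \<forall>i::3.
        (let R = (\<lambda>x y. complex_of_real (r x y $ i)); \<Psi> = (\<lambda>x y. complex_of_real (\<psi> x y))
         in pdz (pdz R) x y = pdz \<Psi> x y * pdz R x y - U x y * exp (- \<Psi> x y) * pdzbar R x y \<and>
            pdzbar (pdz R) x y = - complex_of_real H * exp (\<Psi> x y) * R x y))"

text \<open>On \<open>\<Omega>\<close>, with isothermal coordinate $z = x + iy$, the surface \<open>r\<close> is a proper affine sphere
  with affine metric $g = \rho\,dz\,d\bar z = \rho\,(dx^2 + dy^2)$, affine mean curvature \<open>H\<close> and
  cubic form coefficient \<open>U\<close>; thus $\rho = 2e^\psi$.\<close>

definition affine_invariants ::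
  "(real \<times> real) set \<Rightarrow> surface \<Rightarrow> (real \<Rightarrow> real \<Rightarrow> real) \<Rightarrow> real \<Rightarrow> (real \<Rightarrow> real \<Rightarrow> complex) \<Rightarrow> bool" where
  "affine_invariants \<Omega> r \<rho> H U \<longleftrightarrow>
     proper_affine_sphere \<Omega> r H \<and>
     (\<forall>(x, y)\<in>\<Omega>. affine_E r x y = \<rho> x y \<and> affine_F r x y = 0 \<and> affine_G r x y = \<rho> x y) \<and>
     structure_equations \<Omega> r (\<lambda>x y. ln (\<rho> x y / 2)) H U"

definition unimodular_equiv :: "(real \<times> real) set \<Rightarrow> surface \<Rightarrow> surface \<Rightarrow> bool" where
  "unimodular_equiv \<Omega> r s \<longleftrightarrow>
     (\<exists>T::real^3^3. \<bar>det T\<bar> = 1 \<and> (\<forall>(x, y)\<in>\<Omega>. s x y = T *v r x y))"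

text \<open>The set \<open>\<F>\<close> of surfaces is the associated family of \<open>r\<close>: its members have the metric and
  mean curvature of \<open>r\<close> and the cubic form coefficients $\mu U$, $|\mu| = 1$, every such $\mu$
  occurs, and up to linear maps of determinant $\pm1$ there are no other affine spheres with
  these invariants.\<close>

definition is_associated_family :: "(real \<times> real) set \<Rightarrow> surface \<Rightarrow> surface set \<Rightarrow> bool" where
  "is_associated_family \<Omega> r \<F> \<longleftrightarrow>
     (\<exists>\<rho> H U. affine_invariants \<Omega> r \<rho> H U \<and>
        (\<forall>s\<in>\<F>. \<exists>\<mu>. cmod \<mu> = 1 \<and> affine_invariants \<Omega> s \<rho> H (\<lambda>x y. \<mu> * U x y)) \<and>
        (\<forall>\<mu>. cmod \<mu> = 1 \<longrightarrow>
           (\<exists>s\<in>\<F>. affine_invariants \<Omega> s \<rho> H (\<lambda>x y. \<mu> * U x y)) \<and>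
           (\<forall>s. affine_invariants \<Omega> s \<rho> H (\<lambda>x y. \<mu> * U x y) \<longrightarrow>
              (\<exists>s'\<in>\<F>. unimodular_equiv \<Omega> s' s))))"

definition S_orig :: surface where
  "S_orig x y = vector
     [- y * (3/2 * ln x + 3 * ln y + x),
      x powr (-3/2) * y powr (-2) * sqrt (1 + x),
      y]"

text \<open>\<open>S_orig\<close> after the homothety with factor $-1/\sqrt3$ and the change of parameters, on
  \<open>half_plane\<close>.\<close>

definition S_iso :: surface where
  "S_iso x y = (- 1 / sqrt 3) *\<^sub>R S_orig ((sinh (sqrt 3 * x))\<^sup>2) (exp y / sinh (sqrt 3 * x))"

definition half_plane :: "(real \<times> real) set" where
  "half_plane = {0<..} \<times> UNIV"

definition coth :: "real \<Rightarrow> real" where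
  "coth u = cosh u / sinh u"

definition csch :: "real \<Rightarrow> real" where
  "csch u = 1 / sinh u"

definition mat_A :: "real^3^3" where
  "mat_A = vector
     [vector [1 / sqrt 3, sqrt 2, 4 / sqrt 3],
      vector [- sqrt 2 / sqrt 3, 1, 2 * sqrt 2 / sqrt 3],
      vector [- 1 / sqrt 3, sqrt 2, - 1 / sqrt 3]]"

definition mat_D :: "real \<Rightarrow> real^3^3" where
  "mat_D t = vector
     [vector [(1 + sqrt 2) powr (- 2 / sqrt 3 * cos t), 0, 0],
      vector [0, (1 + sqrt 2) powr (- sin t + 1 / sqrt 3 * cos t), 0],
      vector [0, 0, (1 + sqrt 2) powr (sin t + 1 / sqrt 3 * cos t)]]"

definition mat_B :: "real \<Rightarrow> real^3^3" where
  "mat_B t =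
     (let \<beta>1 = sqrt 2 + 2 / sqrt 3 * cos t;
          \<beta>2 = sqrt 2 + sin t - cos t / sqrt 3;
          \<beta>3 = sqrt 2 - sin t - cos t / sqrt 3
      in vector
       [vector [- \<beta>1, sqrt 3 + 2 * \<beta>1 * cos t, - 2 * \<beta>1 * sin t],
        vector [- \<beta>2, sqrt 3 + \<beta>2 * (sqrt 3 * sin t - cos t), \<beta>2 * (sin t + sqrt 3 * cos t)],
        vector [- \<beta>3, sqrt 3 - \<beta>3 * (sqrt 3 * sin t + cos t), \<beta>3 * (sin t - sqrt 3 * cos t)]])"

definition vec_v :: "real \<Rightarrow> surface" where
  "vec_v t x y = vector
     [- (coth (sqrt 3 * x) + 2 / sqrt 3 * cos t) * exp (2 * (- x * cos t + y * sin t)),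
      - (coth (sqrt 3 * x) - (- sqrt 3 * sin t + cos t) / sqrt 3) *
        exp ((- sqrt 3 * sin t + cos t) * x + (- sin t - sqrt 3 * cos t) * y),
      - (coth (sqrt 3 * x) - (sqrt 3 * sin t + cos t) / sqrt 3) *
        exp ((sqrt 3 * sin t + cos t) * x + (- sin t + sqrt 3 * cos t) * y)]"

definition r_formula :: "real \<Rightarrow> surface" where
  "r_formula t x y = mat_A *v (matrix_inv (mat_D t ** mat_B t) *v vec_v t x y)"

definition regular_params :: "real set" where
  "regular_params = {t \<in> {0..2 * pi / 3}. invertible (mat_B t)}"

definition r_fam :: "real \<Rightarrow> surface" where
  "r_fam t x y =
     (if t \<in> regular_params then r_formula t x y
      else Lim (at t within regular_params) (\<lambda>s. r_formula s x y))"

end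

theory Submission
  imports Defs
begin

text \<open>
For the metric \<open>rho (dx\<^sup>2 + dy\<^sup>2)\<close> with \<open>rho = 3 coth\<^sup>2(\<surd>3 x) - 1\<close>, mean curvature \<open>-1\<close> and constant
cubic coefficient \<open>U = a + ib\<close>, the structure equations say that each coordinate of the surface,
together with its two first derivatives, satisfies a linear first order system (\<open>frame_eqs\<close>)
whose solution space has dimension three. A surface whose coordinates solve the system has the
prescribed invariants as soon as \<open>\<bar>det(r, r\<^sub>x, r\<^sub>y)\<bar> = rho\<close>. By Liouville's formula this determinant
is a constant multiple of \<open>rho\<close>, so one point decides
(\<open>frame_eqs_imp_affine_invariants\<close>). The same formula, used for mixed Wronskians in Cramer's rule,
gives uniqueness up to unimodular maps (\<open>has_invariants_unique\<close>).

The system with \<open>U = e\<^sup>3\<^sup>i\<^sup>\<theta>\<close> is solved by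
\<open>phi \<theta> = -(coth(\<surd>3 x) + (2/\<surd>3) cos \<theta>) exp(2(-x cos \<theta> + y sin \<theta>))\<close>. Only \<open>3\<theta>\<close> enters \<open>U\<close>, so the
three angles \<open>t\<close>, \<open>t \<plusminus> 2\<pi>/3\<close> provide three solutions for the same \<open>U\<close>: the entries of the vector in
the formula for \<open>r\<^sub>\<lambda>\<close>. At the point where \<open>sinh(\<surd>3 x) = 1\<close> and \<open>y = 0\<close> the rows of \<open>D B\<close> are the
frames of these three functions, and the columns of \<open>A\<close> are the frame of the given sphere. Hence
\<open>A (D B)\<^sup>-\<^sup>1\<close> normalizes all members of the family to one and the same initial frame, of determinant
\<open>-5 = -rho\<close> (\<open>normalized_solution\<close>).

Since \<open>det B = -10 cos 3t\<close>, the construction breaks down exactly at \<open>t = \<pi>/6\<close> and \<open>t = \<pi>/2\<close>. There two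
of the three functions coincide. Replacing one of the two by the difference quotient of both with
respect to \<open>t\<close> makes the linear system for the coefficients regular in the limit; the derivative
that arises is \<open>chi\<close>, a solution with a factor linear in \<open>y\<close> (\<open>phi_collision\<close>, \<open>r_formula_limit\<close>).
The given sphere is spanned by this limit basis for \<open>U = i\<close>, which places it in the family.

The sphere in its original parameters is treated directly. Its metric is complete
because \<open>ln x / 3\<close> and \<open>ln y + ln x / 2\<close> do not increase distances and together control convergence
in the open quadrant (\<open>plane_metric.complete_metricI\<close>).
\<close>

section \<open>Partial derivatives and smoothness\<close>

definition has_partials ::
  "(real \<times> real) set \<Rightarrow> (real \<Rightarrow> real \<Rightarrow> 'a::real_normed_vector) \<Rightarrow>
   (real \<Rightarrow> real \<Rightarrow> 'a) \<Rightarrow> (real \<Rightarrow> real \<Rightarrow> 'a) \<Rightarrow> bool" where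
  "has_partials \<Omega> f g h \<longleftrightarrow>
     (\<forall>x y. (x, y) \<in> \<Omega> \<longrightarrow>
        ((\<lambda>s. f s y) has_vector_derivative g x y) (at x) \<and>
        ((\<lambda>s. f x s) has_vector_derivative h x y) (at y))"

lemma has_partialsI:
  assumes "\<And>x y. (x, y) \<in> \<Omega> \<Longrightarrow> ((\<lambda>s. f s y) has_vector_derivative g x y) (at x)"
    and "\<And>x y. (x, y) \<in> \<Omega> \<Longrightarrow> ((\<lambda>s. f x s) has_vector_derivative h x y) (at y)"
  shows "has_partials \<Omega> f g h"
  using assms by (simp add: has_partials_def)

lemma has_partialsD:
  assumes "has_partials \<Omega> f g h" "(x, y) \<in> \<Omega>"
  shows "((\<lambda>s. f s y) has_vector_derivative g x y) (at x)"
    and "((\<lambda>s. f x s) has_vector_derivative h x y) (at y)"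
  using assms by (auto simp: has_partials_def)

lemma has_partials_pd:
  assumes "has_partials \<Omega> f g h" "(x, y) \<in> \<Omega>"
  shows "pdx f x y = g x y" and "pdy f x y = h x y"
  using has_partialsD[OF assms] by (auto simp: pdx_def pdy_def vector_derivative_at)

lemma has_partials_differentiable:
  assumes "has_partials \<Omega> f g h" "(x, y) \<in> \<Omega>"
  shows "(\<lambda>s. f s y) differentiable (at x)" and "(\<lambda>s. f x s) differentiable (at y)"
  by (rule differentiableI_vector[OF has_partialsD(1)[OF assms]])
    (rule differentiableI_vector[OF has_partialsD(2)[OF assms]])

lemma open_sections:
  fixes \<Omega> :: "(real \<times> real) set"
  assumes "open \<Omega>"
  shows "open {s. (s, y) \<in> \<Omega>}" and "open {s. (x, s) \<in> \<Omega>}"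
proof -
  have "open ((\<lambda>s. (s, y)) -` \<Omega>)" "open ((\<lambda>s. (x, s)) -` \<Omega>)"
    using assms by (auto intro!: open_vimage continuous_intros)
  thus "open {s. (s, y) \<in> \<Omega>}" and "open {s. (x, s) \<in> \<Omega>}"
    by (simp_all add: vimage_def)
qed

lemma has_partials_cong:
  assumes "has_partials \<Omega> f g h" "open \<Omega>"
    and "\<And>x y. (x, y) \<in> \<Omega> \<Longrightarrow> f x y = f' x y"
    and "\<And>x y. (x, y) \<in> \<Omega> \<Longrightarrow> g x y = g' x y"
    and "\<And>x y. (x, y) \<in> \<Omega> \<Longrightarrow> h x y = h' x y"
  shows "has_partials \<Omega> f' g' h'"
proof (rule has_partialsI)
  fix x y assume xy: "(x, y) \<in> \<Omega>"
  note D = has_partialsD[OF assms(1) xy]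
  have "((\<lambda>s. f' s y) has_vector_derivative g x y) (at x)"
    by (rule has_vector_derivative_transform_within_open[OF D(1) open_sections(1)[OF assms(2), of y]])
       (use xy assms(3) in auto)
  thus "((\<lambda>s. f' s y) has_vector_derivative g' x y) (at x)"
    using assms(4)[OF xy] by simp
  have "((\<lambda>s. f' x s) has_vector_derivative h x y) (at y)"
    by (rule has_vector_derivative_transform_within_open[OF D(2) open_sections(2)[OF assms(2), of x]])
       (use xy assms(3) in auto)
  thus "((\<lambda>s. f' x s) has_vector_derivative h' x y) (at y)"
    using assms(5)[OF xy] by simp
qed

lemma has_partials_linear:
  assumes "bounded_linear T" "has_partials \<Omega> f g h"
  shows "has_partials \<Omega> (\<lambda>x y. T (f x y)) (\<lambda>x y. T (g x y)) (\<lambda>x y. T (h x y))"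
  using assms bounded_linear.has_vector_derivative[OF assms(1)]
  by (auto simp: has_partials_def)

lemma has_vector_derivative_vec:
  fixes f :: "real \<Rightarrow> real^'n"
  assumes "\<And>i. ((\<lambda>s. f s $ i) has_vector_derivative D $ i) (at x)"
  shows "(f has_vector_derivative D) (at x)"
  unfolding has_vector_derivative_def
proof (subst has_derivative_componentwise_within, intro ballI)
  fix b :: "real^'n" assume "b \<in> Basis"
  then obtain i where b: "b = axis i 1" by (auto simp: Basis_vec_def)
  show "((\<lambda>x. f x \<bullet> b) has_derivative (\<lambda>x. x *\<^sub>R D \<bullet> b)) (at x)"
    using assms[of i] unfolding b by (simp add: inner_axis has_vector_derivative_def)
qed

lemma has_partials_vec:
  fixes f g h :: "real \<Rightarrow> real \<Rightarrow> real^'n"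
  assumes "\<And>i. has_partials \<Omega> (\<lambda>x y. f x y $ i) (\<lambda>x y. g x y $ i) (\<lambda>x y. h x y $ i)"
  shows "has_partials \<Omega> f g h"
  using assms unfolding has_partials_def
  by (auto intro!: has_vector_derivative_vec)

lemma has_partials_add:
  assumes "has_partials \<Omega> f f1 f2" "has_partials \<Omega> g g1 g2"
  shows "has_partials \<Omega> (\<lambda>x y. f x y + g x y) (\<lambda>x y. f1 x y + g1 x y) (\<lambda>x y. f2 x y + g2 x y)"
  using assms by (auto simp: has_partials_def intro!: has_vector_derivative_add)

lemma has_partials_mult:
  fixes f g :: "real \<Rightarrow> real \<Rightarrow> 'a::real_normed_algebra"
  assumes "has_partials \<Omega> f f1 f2" "has_partials \<Omega> g g1 g2"
  shows "has_partials \<Omega> (\<lambda>x y. f x y * g x y)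
    (\<lambda>x y. f x y * g1 x y + f1 x y * g x y) (\<lambda>x y. f x y * g2 x y + f2 x y * g x y)"
  using assms by (auto simp: has_partials_def intro!: has_vector_derivative_mult)

lemma has_partials_zero_imp_constant:
  fixes f :: "real \<Rightarrow> real \<Rightarrow> 'a::real_normed_vector"
  assumes "has_partials \<Omega> f (\<lambda>_ _. 0) (\<lambda>_ _. 0)" "\<Omega> = {0<..} \<times> UNIV"
    and "(x, y) \<in> \<Omega>" "(u, v) \<in> \<Omega>"
  shows "f x y = f u v"
proof -
  have "0 < x" "0 < u" using assms(2-4) by auto
  have d1: "((\<lambda>s. f x s) has_vector_derivative 0) (at s within UNIV)" for s
    using has_partialsD(2)[OF assms(1), of x s] assms(2) \<open>0 < x\<close> by simp
  have d2: "((\<lambda>s. f s v) has_vector_derivative 0) (at s within {0<..})" if "s \<in> {0<..}" for s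
    using has_partialsD(1)[OF assms(1), of s v] assms(2) that has_vector_derivative_at_within
    by simp
  obtain c where "\<And>s. f x s = c"
    using has_vector_derivative_zero_constant[OF convex_UNIV d1] by auto
  hence "f x y = f x v" by simp
  moreover obtain d where "\<And>s. s \<in> {0<..} \<Longrightarrow> f s v = d"
    using has_vector_derivative_zero_constant[OF convex_real_interval(3) d2] by metis
  hence "f x v = f u v" using \<open>0 < x\<close> \<open>0 < u\<close> by simp
  ultimately show ?thesis by simp
qed

lemma Ck_on_cong:
  assumes "open \<Omega>" "Ck_on k \<Omega> f" "\<And>x y. (x, y) \<in> \<Omega> \<Longrightarrow> f x y = g x y"
  shows "Ck_on k \<Omega> g"
  using assms(2,3)
proof (induction k arbitrary: f g)
  case 0
  have "continuous_on \<Omega> (\<lambda>(x, y). g x y) \<longleftrightarrow> continuous_on \<Omega> (\<lambda>(x, y). f x y)"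
    by (rule continuous_on_cong) (use 0 in auto)
  thus ?case using 0 by simp
next
  case (Suc k)
  have "continuous_on \<Omega> (\<lambda>(x, y). g x y) \<longleftrightarrow> continuous_on \<Omega> (\<lambda>(x, y). f x y)"
    by (rule continuous_on_cong) (use Suc.prems in auto)
  hence cont: "continuous_on \<Omega> (\<lambda>(x, y). g x y)" using Suc.prems by simp
  have "has_partials \<Omega> f (pdx f) (pdy f)"
    using Suc.prems(1)
    by (auto simp: has_partials_def pdx_def pdy_def simp flip: vector_derivative_works)
  hence hp: "has_partials \<Omega> g (pdx f) (pdy f)"
    by (rule has_partials_cong) (use Suc.prems assms(1) in auto)
  have "Ck_on k \<Omega> (pdx g)" "Ck_on k \<Omega> (pdy g)"
    by (rule Suc.IH[of "pdx f"], use Suc.prems has_partials_pd[OF hp] in simp_all)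
       (rule Suc.IH[of "pdy f"], use Suc.prems has_partials_pd[OF hp] in simp_all)
  thus ?case using cont has_partials_differentiable[OF hp] by auto
qed

text \<open>Smoothness by coinduction: a class of continuous maps that is closed under taking both
  partial derivatives consists of smooth maps.\<close>

lemma smooth_map_coinduct:
  assumes "open \<Omega>" "P f"
    and cont: "\<And>f. P f \<Longrightarrow> continuous_on \<Omega> (\<lambda>(x, y). f x y)"
    and step: "\<And>f. P f \<Longrightarrow> \<exists>g h. P g \<and> P h \<and> has_partials \<Omega> f g h"
  shows "smooth_map \<Omega> f"
  unfolding smooth_map_def
proof
  fix k show "Ck_on k \<Omega> f"
    using assms(2)
  proof (induction k arbitrary: f)
    case 0 thus ?case using cont by simp
  next
    case (Suc k)
    from step[OF Suc.prems] obtain g h where gh: "P g" "P h" "has_partials \<Omega> f g h" by blast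
    have "Ck_on k \<Omega> (pdx f)" "Ck_on k \<Omega> (pdy f)"
      by (rule Ck_on_cong[OF assms(1) Suc.IH[OF gh(1)]], use has_partials_pd[OF gh(3)] in simp)
         (rule Ck_on_cong[OF assms(1) Suc.IH[OF gh(2)]], use has_partials_pd[OF gh(3)] in simp)
    thus ?case using cont[OF Suc.prems] has_partials_differentiable[OF gh(3)] by auto
  qed
qed

lemma smooth_map_cong:
  assumes "open \<Omega>" "smooth_map \<Omega> f" "\<And>x y. (x, y) \<in> \<Omega> \<Longrightarrow> f x y = g x y"
  shows "smooth_map \<Omega> g"
  using assms Ck_on_cong unfolding smooth_map_def by blast

text \<open>The algebra of functions that finitely many sums and products produce from constants and the
  functions in \<open>G\<close>. Membership concerns the functions on the whole plane; a map that
  agrees with such functions only on \<open>\<Omega>\<close> is handled by \<open>smooth_map_cong\<close>.\<close>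

inductive_set polys_in ::
  "(real \<Rightarrow> real \<Rightarrow> real) set \<Rightarrow> (real \<Rightarrow> real \<Rightarrow> real) set" for G where
  const: "(\<lambda>_ _. c) \<in> polys_in G"
| gen: "g \<in> G \<Longrightarrow> g \<in> polys_in G"
| add: "f \<in> polys_in G \<Longrightarrow> g \<in> polys_in G \<Longrightarrow> (\<lambda>x y. f x y + g x y) \<in> polys_in G"
| mult: "f \<in> polys_in G \<Longrightarrow> g \<in> polys_in G \<Longrightarrow> (\<lambda>x y. f x y * g x y) \<in> polys_in G"

lemma polys_in_uminus: "f \<in> polys_in G \<Longrightarrow> (\<lambda>x y. - f x y) \<in> polys_in G"
  using polys_in.mult[OF polys_in.const[of "-1"], of f G] by simp

text \<open>By the Leibniz rule, it suffices for the partial derivatives of the generators to be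
  polynomials in the generators: then the whole algebra is closed under differentiation and
  coinduction applies.\<close>

lemma smooth_map_polys:
  fixes r :: "real \<Rightarrow> real \<Rightarrow> real^'n"
  assumes "open \<Omega>"
    and cont: "\<And>g. g \<in> G \<Longrightarrow> continuous_on \<Omega> (\<lambda>(x, y). g x y)"
    and der: "\<And>g. g \<in> G \<Longrightarrow> \<exists>u\<in>polys_in G. \<exists>v\<in>polys_in G. has_partials \<Omega> g u v"
    and r: "\<And>i. (\<lambda>x y. r x y $ i) \<in> polys_in G"
  shows "smooth_map \<Omega> r"
proof (rule smooth_map_coinduct[where P = "\<lambda>r. \<forall>i. (\<lambda>x y. r x y $ i) \<in> polys_in G"])
  have cont': "continuous_on \<Omega> (\<lambda>z. f (fst z) (snd z))" if "f \<in> polys_in G" for f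
    using that
  proof induction
    case (gen g) thus ?case using cont by (simp add: case_prod_unfold)
  qed (auto intro: continuous_intros)
  have der': "\<exists>u\<in>polys_in G. \<exists>v\<in>polys_in G. has_partials \<Omega> f u v" if "f \<in> polys_in G" for f
    using that
  proof induction
    case (const c)
    have "has_partials \<Omega> (\<lambda>_ _. c) (\<lambda>_ _. 0) (\<lambda>_ _. 0)" by (simp add: has_partials_def)
    show ?case by (rule bexI, rule bexI, fact) (rule polys_in.const)+
  next
    case (gen g) thus ?case by (rule der)
  next
    case (add f g)
    then obtain f1 f2 g1 g2 where *: "f1 \<in> polys_in G" "f2 \<in> polys_in G" "g1 \<in> polys_in G"
      "g2 \<in> polys_in G" and hp: "has_partials \<Omega> f f1 f2" "has_partials \<Omega> g g1 g2" by blast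
    show ?case
      by (rule bexI, rule bexI, rule has_partials_add[OF hp]) (simp_all add: polys_in.add *)
  next
    case (mult f g)
    then obtain f1 f2 g1 g2 where *: "f1 \<in> polys_in G" "f2 \<in> polys_in G" "g1 \<in> polys_in G"
      "g2 \<in> polys_in G" and hp: "has_partials \<Omega> f f1 f2" "has_partials \<Omega> g g1 g2" by blast
    show ?case
      by (rule bexI, rule bexI, rule has_partials_mult[OF hp]) (simp_all add: polys_in.add polys_in.mult * mult.hyps)
  qed
  show "\<forall>i. (\<lambda>x y. r x y $ i) \<in> polys_in G" using r by blast
  fix f :: "real \<Rightarrow> real \<Rightarrow> real^'n" assume f: "\<forall>i. (\<lambda>x y. f x y $ i) \<in> polys_in G"
  have "continuous_on \<Omega> (\<lambda>z. \<chi> i. f (fst z) (snd z) $ i)"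
    by (rule continuous_on_vec_lambda) (rule cont'[OF f[rule_format]])
  thus "continuous_on \<Omega> (\<lambda>(x, y). f x y)"
    by (simp add: case_prod_unfold)
  have "\<forall>i. \<exists>u v. u \<in> polys_in G \<and> v \<in> polys_in G \<and> has_partials \<Omega> (\<lambda>x y. f x y $ i) u v"
    using der'[OF f[rule_format]] by (simp add: Bex_def)
  then obtain u v where uv: "\<And>i. u i \<in> polys_in G" "\<And>i. v i \<in> polys_in G"
    "\<And>i. has_partials \<Omega> (\<lambda>x y. f x y $ i) (u i) (v i)" by metis
  have "has_partials \<Omega> f (\<lambda>x y. \<chi> i. u i x y) (\<lambda>x y. \<chi> i. v i x y)"
    by (rule has_partials_vec) (simp add: uv(3))
  moreover have "\<forall>i. (\<lambda>x y. (\<chi> i. u i x y) $ i) \<in> polys_in G" "\<forall>i. (\<lambda>x y. (\<chi> i. v i x y) $ i) \<in> polys_in G"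
    using uv(1,2) by simp_all
  ultimately show "\<exists>g h. (\<forall>i. (\<lambda>x y. g x y $ i) \<in> polys_in G) \<and>
    (\<forall>i. (\<lambda>x y. h x y $ i) \<in> polys_in G) \<and> has_partials \<Omega> f g h"
    by (intro exI conjI)
qed (rule assms(1))

section \<open>The moving frame of an affine sphere with the given metric\<close>

definition rho :: "real \<Rightarrow> real" where
  "rho x = 3 * ((csch (sqrt 3 * x))\<^sup>2 + 2 / 3)"

definition drho :: "real \<Rightarrow> real" where
  "drho x = - 6 * sqrt 3 * (csch (sqrt 3 * x))\<^sup>2 * coth (sqrt 3 * x)"

lemma rho_pos: "rho x > 0"
  unfolding rho_def by (smt (verit) zero_le_power2 divide_pos_pos)

lemma half_plane_iff [simp]: "(x, y) \<in> half_plane \<longleftrightarrow> 0 < x"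
  by (simp add: half_plane_def)

lemma open_half_plane: "open half_plane"
  unfolding half_plane_def by (intro open_Times) auto

lemma coth_squared: "u \<noteq> 0 \<Longrightarrow> (coth u)\<^sup>2 = (csch u)\<^sup>2 + 1"
  using cosh_square_eq[of u] by (simp add: coth_def csch_def field_simps)

lemma rho_coth: "x > 0 \<Longrightarrow> rho x = 3 * (coth (sqrt 3 * x))\<^sup>2 - 1"
  by (simp add: rho_def coth_squared)

lemma coth_has_derivative:
  assumes "x > 0"
  shows "((\<lambda>s. coth (sqrt 3 * s)) has_real_derivative - sqrt 3 * (csch (sqrt 3 * x))\<^sup>2) (at x)"
proof -
  have "sinh (sqrt 3 * x) \<noteq> 0" using assms by simp
  thus ?thesis unfolding coth_def csch_def
    using cosh_square_eq[of "sqrt 3 * x"]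
    by (auto intro!: derivative_eq_intros simp: field_simps power2_eq_square)
qed

lemma csch_has_derivative:
  assumes "x > 0"
  shows "((\<lambda>s. csch (sqrt 3 * s)) has_real_derivative
    - sqrt 3 * csch (sqrt 3 * x) * coth (sqrt 3 * x)) (at x)"
proof -
  have "sinh (sqrt 3 * x) \<noteq> 0" using assms by simp
  thus ?thesis unfolding coth_def csch_def
    by (auto intro!: derivative_eq_intros simp: field_simps power2_eq_square)
qed

lemma rho_has_derivative:
  assumes "x > 0"
  shows "(rho has_real_derivative drho x) (at x)"
  unfolding rho_def[abs_def]
  by (rule derivative_eq_intros csch_has_derivative[OF assms] refl)+
     (simp add: drho_def power2_eq_square)

text \<open>The connection matrix of the frame \<open>(r, r\<^sub>x, r\<^sub>y)\<close> has the diagonal entries \<open>conn (- a)\<close> and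
  \<open>conn a\<close> in the \<open>x\<close>-direction: half the logarithmic derivative of the metric factor, shifted by the
  real part \<open>a\<close> of the cubic coefficient.\<close>

definition conn :: "real \<Rightarrow> real \<Rightarrow> real" where
  "conn a x = drho x / (2 * rho x) + 2 * a / rho x"

lemma conn_trace: "conn a x + conn (- a) x = drho x / rho x"
  using rho_pos[of x] by (simp add: conn_def field_simps)

text \<open>The structure equations for \<open>U = a + ib\<close> solved for the real second derivatives of \<open>r\<close>, with
  \<open>p = r\<^sub>x\<close> and \<open>q = r\<^sub>y\<close> as further unknowns, so that the system is linear and of first order. It applies
  to surfaces as well as to their single coordinates.\<close>

definition frame_eqs ::
  "real \<Rightarrow> real \<Rightarrow> (real \<Rightarrow> real \<Rightarrow> 'a::real_normed_vector) \<Rightarrow> (real \<Rightarrow> real \<Rightarrow> 'a) \<Rightarrow>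
   (real \<Rightarrow> real \<Rightarrow> 'a) \<Rightarrow> bool" where
  "frame_eqs a b r p q \<longleftrightarrow>
     has_partials half_plane r p q \<and>
     has_partials half_plane p
       (\<lambda>x y. rho x *\<^sub>R r x y + conn (- a) x *\<^sub>R p x y + (2 * b / rho x) *\<^sub>R q x y)
       (\<lambda>x y. (2 * b / rho x) *\<^sub>R p x y + conn a x *\<^sub>R q x y) \<and>
     has_partials half_plane q
       (\<lambda>x y. (2 * b / rho x) *\<^sub>R p x y + conn a x *\<^sub>R q x y)
       (\<lambda>x y. rho x *\<^sub>R r x y - conn (- a) x *\<^sub>R p x y
          - (2 * b / rho x) *\<^sub>R q x y)"

lemma frame_eqsD:
  assumes "frame_eqs a b r p q"
  shows "has_partials half_plane r p q"
    and "has_partials half_plane p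
       (\<lambda>x y. rho x *\<^sub>R r x y + conn (- a) x *\<^sub>R p x y + (2 * b / rho x) *\<^sub>R q x y)
       (\<lambda>x y. (2 * b / rho x) *\<^sub>R p x y + conn a x *\<^sub>R q x y)"
    and "has_partials half_plane q
       (\<lambda>x y. (2 * b / rho x) *\<^sub>R p x y + conn a x *\<^sub>R q x y)
       (\<lambda>x y. rho x *\<^sub>R r x y - conn (- a) x *\<^sub>R p x y - (2 * b / rho x) *\<^sub>R q x y)"
  using assms unfolding frame_eqs_def by blast+

lemma frame_eqs_linear:
  assumes "bounded_linear T" "frame_eqs a b r p q"
  shows "frame_eqs a b (\<lambda>x y. T (r x y)) (\<lambda>x y. T (p x y)) (\<lambda>x y. T (q x y))"
proof -
  interpret T: bounded_linear T by fact
  from frame_eqsD[OF assms(2), THEN has_partials_linear[OF assms(1)]] show ?thesis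
    unfolding frame_eqs_def by (simp add: T.add T.diff T.scaleR)
qed

lemma frame_eqs_vec:
  fixes r p q :: "real \<Rightarrow> real \<Rightarrow> real^'n"
  assumes "\<And>i. frame_eqs a b (\<lambda>x y. r x y $ i) (\<lambda>x y. p x y $ i) (\<lambda>x y. q x y $ i)"
  shows "frame_eqs a b r p q"
  using assms unfolding frame_eqs_def
  by (auto intro!: has_partials_vec)

lemma frame_eqs_nth:
  fixes r p q :: "real \<Rightarrow> real \<Rightarrow> real^'n"
  assumes "frame_eqs a b r p q"
  shows "frame_eqs a b (\<lambda>x y. r x y $ i) (\<lambda>x y. p x y $ i) (\<lambda>x y. q x y $ i)"
  using frame_eqs_linear[OF bounded_linear_vec_nth assms] .

lemma frame_eqs_cong:
  assumes "frame_eqs a b r p q"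
    and "\<And>x y. (x, y) \<in> half_plane \<Longrightarrow> r x y = r' x y"
    and "\<And>x y. (x, y) \<in> half_plane \<Longrightarrow> p x y = p' x y"
    and "\<And>x y. (x, y) \<in> half_plane \<Longrightarrow> q x y = q' x y"
  shows "frame_eqs a b r' p' q'"
  unfolding frame_eqs_def
  by (intro conjI has_partials_cong[OF frame_eqsD(1)[OF assms(1)] open_half_plane]
      has_partials_cong[OF frame_eqsD(2)[OF assms(1)] open_half_plane]
      has_partials_cong[OF frame_eqsD(3)[OF assms(1)] open_half_plane])
    (simp_all add: assms)

lemma det_vec_expand:
  "det_vec u v w = u$1 * v$2 * w$3 + u$2 * v$3 * w$1 + u$3 * v$1 * w$2
     - u$1 * v$3 * w$2 - u$2 * v$1 * w$3 - u$3 * v$2 * w$1"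
  unfolding det_vec_def by (simp add: det_3 vector_3)

text \<open>The trace of the connection matrix of the frame is \<open>drho / rho\<close> in the \<open>x\<close>-direction and
  \<open>0\<close> in the \<open>y\<close>-direction, so Liouville's formula makes every Wronskian of three solutions
  a constant multiple of \<open>rho\<close>.\<close>

lemma wronskian_constant:
  assumes fr: "frame_eqs a b r p q" and "x > 0" "u > 0"
  shows "det_vec (r x y) (p x y) (q x y) / rho x = det_vec (r u v) (p u v) (q u v) / rho u"
proof (rule has_partials_zero_imp_constant[where \<Omega> = half_plane
      and f = "\<lambda>x y. det_vec (r x y) (p x y) (q x y) / rho x"])
  show "has_partials half_plane (\<lambda>x y. det_vec (r x y) (p x y) (q x y) / rho x)
      (\<lambda>_ _. 0) (\<lambda>_ _. 0)"
  proof (rule has_partialsI)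
    fix x y assume xy: "(x, y) \<in> half_plane"
    hence x: "x > 0" by simp
    define m n k where "m = conn (- a) x" and "n = conn a x" and "k = 2 * b / rho x"
    have mn: "m + n = drho x / rho x"
      using conn_trace[of a x] by (simp add: m_def n_def add.commute)
    have rn: "rho x \<noteq> 0" using rho_pos[of x] by simp
    have d: "((\<lambda>s. r s y $ i) has_real_derivative p x y $ i) (at x)"
        "((\<lambda>s. r x s $ i) has_real_derivative q x y $ i) (at y)"
        "((\<lambda>s. p s y $ i) has_real_derivative rho x * r x y $ i + m * p x y $ i + k * q x y $ i) (at x)"
        "((\<lambda>s. p x s $ i) has_real_derivative k * p x y $ i + n * q x y $ i) (at y)"
        "((\<lambda>s. q s y $ i) has_real_derivative k * p x y $ i + n * q x y $ i) (at x)"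
        "((\<lambda>s. q x s $ i) has_real_derivative rho x * r x y $ i - m * p x y $ i - k * q x y $ i) (at y)"
      for i
      using frame_eqsD[OF frame_eqs_nth[OF fr, of i], THEN has_partialsD(1), OF xy]
        frame_eqsD[OF frame_eqs_nth[OF fr, of i], THEN has_partialsD(2), OF xy]
      unfolding m_def n_def k_def has_real_derivative_iff_has_vector_derivative
      by simp_all
    have "((\<lambda>s. det_vec (r s y) (p s y) (q s y)) has_real_derivative
        (m + n) * det_vec (r x y) (p x y) (q x y)) (at x)"
      unfolding det_vec_expand
      by (rule derivative_eq_intros d refl)+ (simp add: algebra_simps)
    hence "((\<lambda>s. det_vec (r s y) (p s y) (q s y) / rho s) has_real_derivative
        ((m + n) * det_vec (r x y) (p x y) (q x y) * rho x
          - det_vec (r x y) (p x y) (q x y) * drho x) / (rho x * rho x)) (at x)"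
      using rho_has_derivative[OF x] rn by (rule DERIV_divide)
    thus "((\<lambda>s. det_vec (r s y) (p s y) (q s y) / rho s) has_vector_derivative 0) (at x)"
      using rn by (simp add: mn has_real_derivative_iff_has_vector_derivative)
    have "((\<lambda>s. det_vec (r x s) (p x s) (q x s)) has_real_derivative 0) (at y)"
      unfolding det_vec_expand
      by (rule derivative_eq_intros d refl)+ (simp add: algebra_simps)
    from DERIV_cdivide[OF this, of "rho x"]
    show "((\<lambda>s. det_vec (r x s) (p x s) (q x s) / rho x) has_vector_derivative 0) (at y)"
      by (simp add: has_real_derivative_iff_has_vector_derivative)
  qed
qed (use assms in \<open>auto simp: half_plane_def\<close>)

lemma frame_eqs_pd:
  assumes fr: "frame_eqs a b r p q" and xy: "(x, y) \<in> half_plane"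
  shows "pdx r x y = p x y" "pdy r x y = q x y"
    "pdx (pdx r) x y = rho x *\<^sub>R r x y + conn (- a) x *\<^sub>R p x y
       + (2 * b / rho x) *\<^sub>R q x y"
    "pdy (pdx r) x y = (2 * b / rho x) *\<^sub>R p x y + conn a x *\<^sub>R q x y"
    "pdy (pdy r) x y = rho x *\<^sub>R r x y - conn (- a) x *\<^sub>R p x y
       - (2 * b / rho x) *\<^sub>R q x y"
proof -
  note pd = has_partials_pd[OF frame_eqsD(1)[OF fr]]
  show "pdx r x y = p x y" "pdy r x y = q x y" using pd xy by auto
  have "frame_eqs a b r (pdx r) (pdy r)"
    by (rule frame_eqs_cong[OF fr]) (use pd in auto)
  note D = frame_eqsD[OF this]
  from has_partials_pd[OF D(2) xy] has_partials_pd[OF D(3) xy] pd[OF xy]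
  show "pdx (pdx r) x y = rho x *\<^sub>R r x y + conn (- a) x *\<^sub>R p x y
       + (2 * b / rho x) *\<^sub>R q x y"
    "pdy (pdx r) x y = (2 * b / rho x) *\<^sub>R p x y + conn a x *\<^sub>R q x y"
    "pdy (pdy r) x y = rho x *\<^sub>R r x y - conn (- a) x *\<^sub>R p x y
       - (2 * b / rho x) *\<^sub>R q x y"
    by simp_all
qed

lemma frame_eqs_second_form:
  assumes fr: "frame_eqs a b r p q" and xy: "(x, y) \<in> half_plane"
  shows "coef_L r x y = rho x * det_vec (r x y) (p x y) (q x y)"
    "coef_M r x y = 0"
    "coef_N r x y = rho x * det_vec (r x y) (p x y) (q x y)"
  unfolding coef_L_def coef_M_def coef_N_def frame_eqs_pd[OF fr xy] det_vec_expand
  by (simp_all add: algebra_simps)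

text \<open>Both nonzero second order coefficients equal \<open>rho\<close> times the determinant of the frame, which makes the
  coordinates isothermal; the fourth root in the normalization leaves the square root of the product.\<close>

lemma frame_eqs_metric:
  assumes fr: "frame_eqs a b r p q" and xy: "(x, y) \<in> half_plane"
  shows "affine_E r x y = sqrt (rho x * \<bar>det_vec (r x y) (p x y) (q x y)\<bar>)"
    "affine_F r x y = 0"
    "affine_G r x y = sqrt (rho x * \<bar>det_vec (r x y) (p x y) (q x y)\<bar>)"
proof -
  define L where "L = rho x * det_vec (r x y) (p x y) (q x y)"
  have "\<bar>L * L\<bar> powr (1/4) = \<bar>L\<bar> powr (1/2)"
    unfolding abs_mult powr_mult powr_add[symmetric] by simp
  also have "\<dots> = sqrt \<bar>L\<bar>" by (simp add: powr_half_sqrt)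
  finally have "sgn L / \<bar>L * L\<bar> powr (1/4) * L = \<bar>L\<bar> / sqrt \<bar>L\<bar>"
    by (simp add: abs_sgn mult.commute)
  also have "\<dots> = sqrt \<bar>L\<bar>" by (simp add: real_div_sqrt)
  also have "\<bar>L\<bar> = rho x * \<bar>det_vec (r x y) (p x y) (q x y)\<bar>"
    using rho_pos[of x] by (simp add: L_def abs_mult)
  finally show "affine_E r x y = sqrt (rho x * \<bar>det_vec (r x y) (p x y) (q x y)\<bar>)"
    "affine_F r x y = 0"
    "affine_G r x y = sqrt (rho x * \<bar>det_vec (r x y) (p x y) (q x y)\<bar>)"
    unfolding affine_E_def affine_F_def affine_G_def metric_scale_def
      frame_eqs_second_form[OF fr xy] L_def[symmetric] by simp_all
qed

text \<open>Real and imaginary parts of the two structure equations. Both orders of the mixed second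
  derivative occur in \<open>\<partial>\<^sub>z\<^sub>b\<^sub>a\<^sub>r \<partial>\<^sub>z r\<close>, and their difference is its imaginary part, which must vanish; so
  the structure equations contain the symmetry \<open>q1 = p2\<close>.\<close>

lemma structure_equations_components:
  fixes r p q p1 p2 q1 q2 :: surface
  assumes hr: "has_partials half_plane r p q"
    and hp: "has_partials half_plane p p1 p2" and hq: "has_partials half_plane q q1 q2"
  shows "structure_equations half_plane r (\<lambda>x y. ln (rho x / 2)) (- 1) (\<lambda>_ _. Complex a b) \<longleftrightarrow>
    (\<forall>x>0. \<forall>y.
      p1 x y = rho x *\<^sub>R r x y + conn (- a) x *\<^sub>R p x y + (2 * b / rho x) *\<^sub>R q x y \<and>
      p2 x y = (2 * b / rho x) *\<^sub>R p x y + conn a x *\<^sub>R q x y \<and>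
      q1 x y = p2 x y \<and>
      q2 x y = rho x *\<^sub>R r x y - conn (- a) x *\<^sub>R p x y - (2 * b / rho x) *\<^sub>R q x y)"
proof -
  define R where "R = (\<lambda>i x y. complex_of_real (r x y $ i))"
  define \<Psi> where "\<Psi> = (\<lambda>(x::real) (y::real). complex_of_real (ln (rho x / 2)))"
  have nth: "has_partials half_plane (\<lambda>x y. f x y $ i) (\<lambda>x y. g x y $ i) (\<lambda>x y. h x y $ i)"
    if "has_partials half_plane f g h" for f g h :: surface and i
    by (rule has_partials_linear[OF bounded_linear_vec_nth that])
  have hR: "has_partials half_plane (R i) (\<lambda>x y. of_real (p x y $ i)) (\<lambda>x y. of_real (q x y $ i))" for i
    unfolding R_def by (rule has_partials_linear[OF bounded_linear_of_real nth[OF hr]])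
  have zR: "pdz (R i) x y = of_real (p x y $ i) / 2 + (- \<i> / 2) * of_real (q x y $ i)"
    and zbR: "pdzbar (R i) x y = of_real (p x y $ i) / 2 + (\<i> / 2) * of_real (q x y $ i)"
    if "(x, y) \<in> half_plane" for i x y
    unfolding pdz_def pdzbar_def has_partials_pd[OF hR that] by (simp_all add: field_simps)
  have lin: "bounded_linear (\<lambda>u::real. c * complex_of_real u)" for c
    by (rule bounded_linear_compose[OF bounded_linear_mult_right bounded_linear_of_real])
  have hZ: "has_partials half_plane (pdz (R i))
      (\<lambda>x y. (1/2) * of_real (p1 x y $ i) + (- \<i> / 2) * of_real (q1 x y $ i))
      (\<lambda>x y. (1/2) * of_real (p2 x y $ i) + (- \<i> / 2) * of_real (q2 x y $ i))" for i
    by (rule has_partials_cong[OF has_partials_add[OF has_partials_linear[OF lin[of "1/2"] nth[OF hp, of i]]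
        has_partials_linear[OF lin[of "- \<i> / 2"] nth[OF hq, of i]]] open_half_plane])
       (simp_all add: zR del: half_plane_iff)
  have z\<Psi>: "pdz \<Psi> x y = of_real (drho x / (2 * rho x))" if "(x, y) \<in> half_plane" for x y
  proof -
    have "((\<lambda>s. ln (rho s / 2)) has_real_derivative drho x / rho x) (at x)"
      using that rho_has_derivative[of x] rho_pos[of x]
      by (auto intro!: derivative_eq_intros simp: field_simps)
    hence "((\<lambda>s. \<Psi> s y) has_vector_derivative of_real (drho x / rho x)) (at x)"
      unfolding \<Psi>_def has_real_derivative_iff_has_vector_derivative
      by (rule bounded_linear.has_vector_derivative[OF bounded_linear_of_real])
    moreover have "((\<lambda>s. \<Psi> x s) has_vector_derivative 0) (at y)" by (simp add: \<Psi>_def)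
    ultimately show ?thesis
      by (simp add: pdz_def pdx_def pdy_def vector_derivative_at)
  qed
  have exps: "exp (\<Psi> x y) = of_real (rho x / 2)" "exp (- \<Psi> x y) = of_real (2 / rho x)" for x y
    using rho_pos[of x] unfolding \<Psi>_def of_real_minus[symmetric] exp_of_real exp_minus
    by (simp_all add: divide_simps)
  have eqs: "(pdz (pdz (R i)) x y = pdz \<Psi> x y * pdz (R i) x y
          - Complex a b * exp (- \<Psi> x y) * pdzbar (R i) x y \<and>
        pdzbar (pdz (R i)) x y = - complex_of_real (- 1) * exp (\<Psi> x y) * R i x y) \<longleftrightarrow>
      (p1 x y $ i = rho x * r x y $ i + conn (- a) x * p x y $ i + (2 * b / rho x) * q x y $ i \<and>
      p2 x y $ i = (2 * b / rho x) * p x y $ i + conn a x * q x y $ i \<and>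
      q1 x y $ i = p2 x y $ i \<and>
      q2 x y $ i = rho x * r x y $ i - conn (- a) x * p x y $ i - (2 * b / rho x) * q x y $ i)"
    (is "?A \<longleftrightarrow> ?B")
    if xy: "(x, y) \<in> half_plane" for x y i
  proof -
    define m k l where "m = drho x / (2 * rho x)" and "k = 2 * a / rho x" and "l = 2 * b / rho x"
    have kl: "Complex a b * of_real (2 / rho x) = Complex k l"
      using rho_pos[of x] by (simp add: complex_eq_iff k_def l_def)
    have "?A \<longleftrightarrow>
       ((p1 x y $ i - q2 x y $ i) / 4 = m * p x y $ i / 2 - k * p x y $ i / 2 + l * q x y $ i / 2 \<and>
        - (q1 x y $ i + p2 x y $ i) / 4 = - m * q x y $ i / 2 - k * q x y $ i / 2 - l * p x y $ i / 2 \<and>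
        (p1 x y $ i + q2 x y $ i) / 4 = rho x / 2 * r x y $ i \<and>
        (p2 x y $ i - q1 x y $ i) / 4 = 0)"
      unfolding pdz_def[of "pdz (R i)"] pdzbar_def[of "pdz (R i)"] has_partials_pd[OF hZ xy]
        zR[OF xy] zbR[OF xy] z\<Psi>[OF xy] exps kl m_def[symmetric]
      by (simp add: complex_eq_iff R_def field_simps) (safe; linarith)
    also have "\<dots> \<longleftrightarrow> ?B"
      unfolding conn_def m_def[symmetric] k_def[symmetric] l_def[symmetric]
      using k_def by (simp add: algebra_simps) argo
    finally show ?thesis .
  qed
  have "structure_equations half_plane r (\<lambda>x y. ln (rho x / 2)) (- 1) (\<lambda>_ _. Complex a b) \<longleftrightarrow>
    (\<forall>x y i. (x, y) \<in> half_plane \<longrightarrow>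
       pdz (pdz (R i)) x y = pdz \<Psi> x y * pdz (R i) x y
          - Complex a b * exp (- \<Psi> x y) * pdzbar (R i) x y \<and>
        pdzbar (pdz (R i)) x y = - complex_of_real (- 1) * exp (\<Psi> x y) * R i x y)"
    unfolding structure_equations_def Let_def R_def \<Psi>_def by blast
  also have "\<dots> \<longleftrightarrow> (\<forall>x y i. (x, y) \<in> half_plane \<longrightarrow>
      (p1 x y $ i = rho x * r x y $ i + conn (- a) x * p x y $ i + (2 * b / rho x) * q x y $ i \<and>
      p2 x y $ i = (2 * b / rho x) * p x y $ i + conn a x * q x y $ i \<and>
      q1 x y $ i = p2 x y $ i \<and>
      q2 x y $ i = rho x * r x y $ i - conn (- a) x * p x y $ i - (2 * b / rho x) * q x y $ i))"
    using eqs by meson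
  finally show ?thesis by (auto simp: vec_eq_iff)
qed

abbreviation has_invariants :: "surface \<Rightarrow> complex \<Rightarrow> bool" where
  "has_invariants r U \<equiv> affine_invariants half_plane r (\<lambda>x y. rho x) (- 1) (\<lambda>_ _. U)"

text \<open>The metric coefficient of a solution is the square root of \<open>rho\<close> times the absolute value of the
  frame determinant, so prescribing it to be \<open>rho\<close> fixes the determinant.\<close>

lemma affine_invariants_imp_frame_eqs:
  assumes "has_invariants r (Complex a b)"
  shows "frame_eqs a b r (pdx r) (pdy r)"
    and "x > 0 \<Longrightarrow> \<bar>det_vec (r x y) (pdx r x y) (pdy r x y)\<bar> = rho x"
proof -
  have sm: "smooth_map half_plane r"
    using assms by (simp add: affine_invariants_def proper_affine_sphere_def)
  have hp: "has_partials half_plane f (pdx f) (pdy f)" if "Ck_on (Suc 0) half_plane f"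
    for f :: surface
    using that by (auto simp: has_partials_def pdx_def pdy_def simp flip: vector_derivative_works)
  have "Ck_on (Suc (Suc 0)) half_plane r" using sm unfolding smooth_map_def by blast
  hence C: "Ck_on (Suc 0) half_plane r" "Ck_on (Suc 0) half_plane (pdx r)"
    "Ck_on (Suc 0) half_plane (pdy r)"
    by auto
  have *: "\<forall>x>0. \<forall>y.
      pdx (pdx r) x y = rho x *\<^sub>R r x y + conn (- a) x *\<^sub>R pdx r x y + (2 * b / rho x) *\<^sub>R pdy r x y \<and>
      pdy (pdx r) x y = (2 * b / rho x) *\<^sub>R pdx r x y + conn a x *\<^sub>R pdy r x y \<and>
      pdx (pdy r) x y = pdy (pdx r) x y \<and>
      pdy (pdy r) x y = rho x *\<^sub>R r x y - conn (- a) x *\<^sub>R pdx r x y - (2 * b / rho x) *\<^sub>R pdy r x y"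
    using assms structure_equations_components[OF C[THEN hp], of a b]
    by (simp add: affine_invariants_def)
  show fr: "frame_eqs a b r (pdx r) (pdy r)"
    unfolding frame_eqs_def
    by (intro conjI hp[OF C(1)] has_partials_cong[OF hp[OF C(2)] open_half_plane]
        has_partials_cong[OF hp[OF C(3)] open_half_plane]) (use * in simp_all)
  assume x: "x > 0"
  have "affine_E r x y = rho x"
    using assms x by (auto simp: affine_invariants_def)
  hence "rho x * \<bar>det_vec (r x y) (pdx r x y) (pdy r x y)\<bar> = rho x ^ 2"
    using frame_eqs_metric(1)[OF fr, of x y] x rho_pos[of x]
    by (metis half_plane_iff real_sqrt_pow2_iff abs_ge_zero less_eq_real_def mult_nonneg_nonneg)
  thus "\<bar>det_vec (r x y) (pdx r x y) (pdy r x y)\<bar> = rho x"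
    using rho_pos[of x] by (simp add: power2_eq_square)
qed

text \<open>One point suffices for the determinant condition, because the determinant is proportional
  to \<open>rho\<close>. The affine normal comes out as \<open>r\<close> because in isothermal coordinates the Laplacian of \<open>r\<close>
  is \<open>(r\<^sub>x\<^sub>x + r\<^sub>y\<^sub>y) / rho\<close>, and the frame equations add up to \<open>r\<^sub>x\<^sub>x + r\<^sub>y\<^sub>y = 2 rho r\<close>.\<close>

lemma frame_eqs_imp_affine_invariants:
  assumes fr: "frame_eqs a b r p q" and sm: "smooth_map half_plane r"
    and u: "u > 0" "\<bar>det_vec (r u v) (p u v) (q u v)\<bar> = rho u"
  shows "has_invariants r (Complex a b)"
proof -
  have det: "\<bar>det_vec (r x y) (p x y) (q x y)\<bar> = rho x" if "x > 0" for x y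
  proof -
    have "\<bar>det_vec (r x y) (p x y) (q x y)\<bar> / rho x = \<bar>det_vec (r u v) (p u v) (q u v)\<bar> / rho u"
      using wronskian_constant[OF fr that u(1), of y v] rho_pos[of x] rho_pos[of u]
      by (metis abs_divide abs_of_pos)
    thus ?thesis using u(2) rho_pos[of x] rho_pos[of u] by (simp add: field_simps)
  qed
  have metric: "affine_E r x y = rho x" "affine_F r x y = 0" "affine_G r x y = rho x"
    if "(x, y) \<in> half_plane" for x y
    using frame_eqs_metric[OF fr that] det[of x y] that rho_pos[of x] by simp_all
  have se: "structure_equations half_plane r (\<lambda>x y. ln (rho x / 2)) (- 1) (\<lambda>_ _. Complex a b)"
    by (subst structure_equations_components[OF frame_eqsD[OF fr]]) simp
  have convex: "locally_strictly_convex half_plane r"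
  proof -
    have "coef_L r x y * coef_N r x y - (coef_M r x y)\<^sup>2 > 0" if "(x, y) \<in> half_plane" for x y
    proof -
      have "det_vec (r x y) (p x y) (q x y) \<noteq> 0"
        using det[of x y] that rho_pos[of x] by auto
      thus ?thesis
        unfolding frame_eqs_second_form[OF fr that] using rho_pos[of x]
        by (simp flip: power2_eq_square)
    qed
    thus ?thesis unfolding locally_strictly_convex_def by blast
  qed
  have normal: "affine_normal r x y = r x y" if xy: "(x, y) \<in> half_plane" for x y
  proof -
    define W where "W = (\<lambda>x y. sqrt (affine_E r x y * affine_G r x y - (affine_F r x y)\<^sup>2))"
    define P where "P = (\<lambda>x y. (1 / W x y) *\<^sub>R (affine_G r x y *\<^sub>R pdx r x y - affine_F r x y *\<^sub>R pdy r x y))"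
    define Q where "Q = (\<lambda>x y. (1 / W x y) *\<^sub>R (affine_E r x y *\<^sub>R pdy r x y - affine_F r x y *\<^sub>R pdx r x y))"
    have W: "W x y = rho x" if "(x, y) \<in> half_plane" for x y
      using metric[OF that] rho_pos[of x] by (simp add: W_def)
    have P: "p x y = P x y" and Q: "q x y = Q x y" if "(x, y) \<in> half_plane" for x y
      using metric[OF that] rho_pos[of x] frame_eqs_pd(1,2)[OF fr that] W[OF that]
      by (simp_all add: P_def Q_def)
    have "pdx P x y = rho x *\<^sub>R r x y + conn (- a) x *\<^sub>R p x y + (2 * b / rho x) *\<^sub>R q x y"
      by (rule has_partials_pd(1)[OF has_partials_cong[OF frame_eqsD(2)[OF fr] open_half_plane P] xy])
         auto
    moreover have "pdy Q x y = rho x *\<^sub>R r x y - conn (- a) x *\<^sub>R p x y - (2 * b / rho x) *\<^sub>R q x y"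
      by (rule has_partials_pd(2)[OF has_partials_cong[OF frame_eqsD(3)[OF fr] open_half_plane Q] xy])
         auto
    ultimately have "pdx P x y + pdy Q x y = (2 * rho x) *\<^sub>R r x y"
      by (simp add: vec_eq_iff)
    moreover have "affine_normal r x y = (1/2) *\<^sub>R ((1 / W x y) *\<^sub>R (pdx P x y + pdy Q x y))"
      unfolding affine_normal_def laplace_beltrami_def Let_def P_def Q_def W_def ..
    ultimately show ?thesis using W[OF xy] rho_pos[of x] by simp
  qed
  have "proper_affine_sphere half_plane r (- 1)"
    using open_half_plane sm convex normal unfolding proper_affine_sphere_def by auto
  thus ?thesis unfolding affine_invariants_def using metric se by auto
qed

section \<open>Uniqueness up to unimodular maps\<close>

lemma det_vec_mult:
  "det_vec (T *v u) (T *v v) (T *v w) = det T * det_vec u v w"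
  unfolding det_vec_expand det_3 matrix_vector_mult_def by (simp add: sum_3 algebra_simps)

lemma cramer_det_vec:
  fixes r p q :: "real^3"
  defines "D1 \<equiv> \<lambda>s u v. det_vec (vector [s, r$2, r$3]) (vector [u, p$2, p$3]) (vector [v, q$2, q$3])"
    and "D2 \<equiv> \<lambda>s u v. det_vec (vector [r$1, s, r$3]) (vector [p$1, u, p$3]) (vector [q$1, v, q$3])"
    and "D3 \<equiv> \<lambda>s u v. det_vec (vector [r$1, r$2, s]) (vector [p$1, p$2, u]) (vector [q$1, q$2, v])"
  shows "D1 s u v * r$1 + D2 s u v * r$2 + D3 s u v * r$3 = det_vec r p q * s"
    and "D1 s u v * p$1 + D2 s u v * p$2 + D3 s u v * p$3 = det_vec r p q * u"
    and "D1 s u v * q$1 + D2 s u v * q$2 + D3 s u v * q$3 = det_vec r p q * v"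
  unfolding assms det_vec_expand by (simp_all add: algebra_simps)

text \<open>By Cramer's rule the coefficients that express a component of one sphere through the
  components of the other are quotients of Wronskians, hence constant. The linear map that they
  form carries one frame to the other, and both frames have determinant \<open>\<plusminus> rho\<close>.\<close>

lemma has_invariants_unique:
  assumes "has_invariants r (Complex a b)" "has_invariants s (Complex a b)"
  shows "unimodular_equiv half_plane r s"
proof -
  define p q u v where "p = pdx r" and "q = pdy r" and "u = pdx s" and "v = pdy s"
  have r: "frame_eqs a b r p q" and detr: "x > 0 \<Longrightarrow> \<bar>det_vec (r x y) (p x y) (q x y)\<bar> = rho x" for x y
    using affine_invariants_imp_frame_eqs[OF assms(1)] by (simp_all add: p_def q_def)
  have s: "frame_eqs a b s u v" and dets: "x > 0 \<Longrightarrow> \<bar>det_vec (s x y) (u x y) (v x y)\<bar> = rho x" for x y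
    using affine_invariants_imp_frame_eqs[OF assms(2)] by (simp_all add: u_def v_def)
  \<comment> \<open>the Wronskian in which the \<open>i\<close>-th coordinate of \<open>s\<close> replaces the \<open>j\<close>-th coordinate of \<open>r\<close>\<close>
  define D :: "3 \<Rightarrow> 3 \<Rightarrow> real \<Rightarrow> real \<Rightarrow> real" where "D = (\<lambda>i j x y.
    det_vec (\<chi> l. if l = j then s x y $ i else r x y $ l)
            (\<chi> l. if l = j then u x y $ i else p x y $ l)
            (\<chi> l. if l = j then v x y $ i else q x y $ l))"
  define W where "W = (\<lambda>x y. det_vec (r x y) (p x y) (q x y))"
  have mixed: "frame_eqs a b (\<lambda>x y. if l = j then s x y $ i else r x y $ l)
      (\<lambda>x y. if l = j then u x y $ i else p x y $ l)
      (\<lambda>x y. if l = j then v x y $ i else q x y $ l)" for l i j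
    by (cases "l = j") (simp_all add: frame_eqs_nth[OF r] frame_eqs_nth[OF s])
  have Dconst: "D i j x y / rho x = D i j 1 0 / rho 1" if "x > 0" for i j x y
    unfolding D_def
    by (rule wronskian_constant[of a b, OF frame_eqs_vec])
       (use that mixed in simp_all)
  have Wconst: "W x y / rho x = W 1 0 / rho 1" if "x > 0" for x y
    unfolding W_def by (rule wronskian_constant[OF r that]) simp
  have W0: "W x y \<noteq> 0" if "x > 0" for x y
    using detr[OF that, of y] rho_pos[of x] by (auto simp: W_def)
  define T :: "real^3^3" where "T = (\<chi> i j. D i j 1 0 / W 1 0)"
  have T: "T $ i $ j = D i j x y / W x y" if "x > 0" for i j x y
  proof -
    have "D i j x y * rho 1 = D i j 1 0 * rho x" "W x y * rho 1 = W 1 0 * rho x"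
      using Dconst[OF that, of i j y] Wconst[OF that, of y] rho_pos[of x] rho_pos[of 1]
      by (simp_all add: field_simps)
    hence "D i j 1 0 * W x y * rho x * rho 1 = D i j x y * W 1 0 * rho x * rho 1"
      by algebra
    thus ?thesis using rho_pos[of x] rho_pos[of 1] W0[OF that, of y] W0[of 1 0]
      by (simp add: T_def field_simps)
  qed
  have vec: "(\<chi> l::3. if l = j then c else z $ l) =
      (if j = 1 then vector [c, z$2, z$3] else if j = 2 then vector [z$1, c, z$3]
       else vector [z$1, z$2, c])" for j c and z :: "real^3"
    using exhaust_3[of j] by (auto simp: vec_eq_iff forall_3)
  have map: "s x y = T *v r x y" "u x y = T *v p x y" "v x y = T *v q x y" if "x > 0" for x y
  proof -
    have "s x y $ i = (T *v r x y) $ i \<and> u x y $ i = (T *v p x y) $ i \<and> v x y $ i = (T *v q x y) $ i"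
      for i
      using cramer_det_vec[of "s x y $ i" "r x y" "u x y $ i" "p x y" "v x y $ i" "q x y"] W0[OF that, of y]
      unfolding matrix_vector_mult_def sum_3 T[OF that, of _ _ y]
      by (simp add: D_def vec W_def field_simps)
    thus "s x y = T *v r x y" "u x y = T *v p x y" "v x y = T *v q x y"
      by (simp_all add: vec_eq_iff)
  qed
  have "\<bar>det_vec (s 1 0) (u 1 0) (v 1 0)\<bar> = \<bar>det T\<bar> * \<bar>W 1 0\<bar>"
    using map[of 1 0] by (simp add: det_vec_mult abs_mult W_def)
  hence "\<bar>det T\<bar> = 1"
    using dets[of 1 0] detr[of 1 0] rho_pos[of 1] by (simp add: W_def)
  thus ?thesis unfolding unimodular_equiv_def using map by auto
qed

section \<open>Explicit solutions of the frame equations\<close>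

text \<open>An exponential of a linear function, transformed so that it fits the metric \<open>rho\<close>. The cubic
  coefficient that belongs to it depends only on \<open>3 \<theta>\<close>.\<close>

definition phi :: "real \<Rightarrow> real \<Rightarrow> real \<Rightarrow> real" where
  "phi \<theta> x y = - (coth (sqrt 3 * x) + 2 / sqrt 3 * cos \<theta>) * exp (2 * (- x * cos \<theta> + y * sin \<theta>))"

definition phi_x :: "real \<Rightarrow> real \<Rightarrow> real \<Rightarrow> real" where
  "phi_x \<theta> x y = (sqrt 3 * (csch (sqrt 3 * x))\<^sup>2
     + 2 * cos \<theta> * (coth (sqrt 3 * x) + 2 / sqrt 3 * cos \<theta>)) * exp (2 * (- x * cos \<theta> + y * sin \<theta>))"

definition phi_y :: "real \<Rightarrow> real \<Rightarrow> real \<Rightarrow> real" where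
  "phi_y \<theta> x y = - 2 * sin \<theta> * (coth (sqrt 3 * x) + 2 / sqrt 3 * cos \<theta>)
     * exp (2 * (- x * cos \<theta> + y * sin \<theta>))"

lemma sin_treble_sin: "sin (3 * x) = 3 * sin x - 4 * sin x ^ 3" for x :: real
proof -
  have "sin (3 * x) = sin (2 * x + x)" by simp
  also have "\<dots> = 2 * sin x * cos x * cos x + (1 - 2 * (sin x)\<^sup>2) * sin x"
    unfolding sin_add by (simp add: sin_double cos_double_sin)
  also have "\<dots> = 2 * sin x * (1 - (sin x)\<^sup>2) + (1 - 2 * (sin x)\<^sup>2) * sin x"
    using cos_squared_eq[of x] by (simp add: power2_eq_square)
  finally show ?thesis by (simp add: power2_eq_square power3_eq_cube algebra_simps)
qed

text \<open>With \<open>2 * rho\<close> cleared, the frame equations have no quotients left.\<close>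

lemma frame_eqs_realI:
  fixes r p q :: "real \<Rightarrow> real \<Rightarrow> real"
  assumes "\<And>x y. x > 0 \<Longrightarrow> ((\<lambda>s. r s y) has_real_derivative p x y) (at x)"
    "\<And>x y. x > 0 \<Longrightarrow> ((\<lambda>s. r x s) has_real_derivative q x y) (at y)"
    "\<And>x y. x > 0 \<Longrightarrow> ((\<lambda>s. p s y) has_real_derivative pp x y) (at x)"
    "\<And>x y. x > 0 \<Longrightarrow> ((\<lambda>s. p x s) has_real_derivative pq x y) (at y)"
    "\<And>x y. x > 0 \<Longrightarrow> ((\<lambda>s. q s y) has_real_derivative pq x y) (at x)"
    "\<And>x y. x > 0 \<Longrightarrow> ((\<lambda>s. q x s) has_real_derivative qq x y) (at y)"
    and "\<And>x y. x > 0 \<Longrightarrow> 2 * rho x * pp x y =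
        2 * (rho x)\<^sup>2 * r x y + (drho x - 4 * a) * p x y + 4 * b * q x y"
    "\<And>x y. x > 0 \<Longrightarrow> 2 * rho x * pq x y = 4 * b * p x y + (drho x + 4 * a) * q x y"
    "\<And>x y. x > 0 \<Longrightarrow> 2 * rho x * qq x y =
        2 * (rho x)\<^sup>2 * r x y - (drho x - 4 * a) * p x y - 4 * b * q x y"
  shows "frame_eqs a b r p q"
proof -
  have eq: "pp x y = rho x * r x y + conn (- a) x * p x y + 2 * b / rho x * q x y"
    "pq x y = 2 * b / rho x * p x y + conn a x * q x y"
    "qq x y = rho x * r x y - conn (- a) x * p x y - 2 * b / rho x * q x y" if "x > 0" for x y
  proof -
    have quot: "pp x y = (2 * (rho x)\<^sup>2 * r x y + (drho x - 4 * a) * p x y + 4 * b * q x y) / (2 * rho x)"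
      "pq x y = (4 * b * p x y + (drho x + 4 * a) * q x y) / (2 * rho x)"
      "qq x y = (2 * (rho x)\<^sup>2 * r x y - (drho x - 4 * a) * p x y - 4 * b * q x y) / (2 * rho x)"
      using assms(7-9)[OF that, of y] rho_pos[of x] by (simp_all add: eq_divide_eq mult.commute)
    show "pp x y = rho x * r x y + conn (- a) x * p x y + 2 * b / rho x * q x y"
      "pq x y = 2 * b / rho x * p x y + conn a x * q x y"
      "qq x y = rho x * r x y - conn (- a) x * p x y - 2 * b / rho x * q x y"
      unfolding quot using rho_pos[of x]
      by (simp_all add: conn_def field_simps power2_eq_square)
  qed
  show ?thesis unfolding frame_eqs_def
    by (intro conjI has_partialsI)
       (use assms(1-6) in \<open>simp_all add: eq has_real_derivative_iff_has_vector_derivative\<close>)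
qed

lemma phi_solution: "frame_eqs (cos (3 * \<theta>)) (sin (3 * \<theta>)) (phi \<theta>) (phi_x \<theta>) (phi_y \<theta>)"
proof -
  define c s w z where "c = cos \<theta>" and "s = sin \<theta>" and "w = sqrt (3::real)"
    and "z = 1 / sqrt (3::real)"
  have w: "w = 3 * z" "3 * z ^ 2 = 1" by (simp_all add: w_def z_def power_divide real_div_sqrt)
  have tw: "2 / sqrt 3 = 2 * z" by (simp add: z_def)
  have sc: "s ^ 2 + c ^ 2 = 1" by (simp add: c_def s_def)
  have c3: "cos (3 * \<theta>) = 4 * c ^ 3 - 3 * c" "sin (3 * \<theta>) = 3 * s - 4 * s ^ 3"
    by (simp_all add: c_def s_def cos_treble_cos sin_treble_sin)
  define k where "k = (\<lambda>x. coth (w * x))"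
  define e where "e = (\<lambda>x y. exp (2 * (- x * c + y * s)))"
  have f: "phi \<theta> x y = - (k x + 2 * z * c) * e x y"
    "phi_y \<theta> x y = - 2 * s * (k x + 2 * z * c) * e x y" for x y
    unfolding phi_def phi_y_def k_def e_def tw c_def s_def w_def by simp_all
  have fx: "phi_x \<theta> x y = (w * ((k x)\<^sup>2 - 1) + 2 * c * (k x + 2 * z * c)) * e x y"
    if "x > 0" for x y
    using that unfolding phi_x_def k_def e_def tw c_def s_def w_def by (simp add: coth_squared)
  have dk: "(k has_real_derivative - w * ((k x)\<^sup>2 - 1)) (at x)" if "x > 0" for x
    using coth_has_derivative[OF that] that by (simp add: k_def[abs_def] w_def coth_squared)
  have de: "((\<lambda>s. e s y) has_real_derivative - 2 * c * e x y) (at x)"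
    "(e x has_real_derivative 2 * s * e x y) (at y)" for x y
    unfolding e_def[abs_def] by (auto intro!: derivative_eq_intros)
  have rho: "rho x = 3 * (k x)\<^sup>2 - 1" "drho x = - 6 * w * ((k x)\<^sup>2 - 1) * k x" if "x > 0" for x
    using that by (simp_all add: rho_coth drho_def k_def w_def coth_squared)
  define fx' where "fx' = (\<lambda>x y. (w * ((k x)\<^sup>2 - 1) + 2 * c * (k x + 2 * z * c)) * e x y)"
  have "frame_eqs (cos (3 * \<theta>)) (sin (3 * \<theta>)) (phi \<theta>) fx' (phi_y \<theta>)"
    unfolding f[abs_def] fx'_def c3
  proof (rule frame_eqs_realI)
    fix x y :: real assume x: "x > 0"
    show "((\<lambda>s. - (k s + 2 * z * c) * e s y) has_real_derivative
        (w * ((k x)\<^sup>2 - 1) + 2 * c * (k x + 2 * z * c)) * e x y) (at x)"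
      by (rule derivative_eq_intros dk[OF x] de refl)+ (simp add: algebra_simps)
    show "((\<lambda>s. - (k x + 2 * z * c) * e x s) has_real_derivative
        - 2 * s * (k x + 2 * z * c) * e x y) (at y)"
      by (rule derivative_eq_intros de refl)+ (simp add: algebra_simps)
    let ?P = "w * ((k x)\<^sup>2 - 1) + 2 * c * (k x + 2 * z * c)"
    let ?P' = "- w * ((k x)\<^sup>2 - 1) * (2 * w * k x + 2 * c)"
    show "((\<lambda>s. (w * ((k s)\<^sup>2 - 1) + 2 * c * (k s + 2 * z * c)) * e s y) has_real_derivative
        (?P' - 2 * c * ?P) * e x y) (at x)"
      by (rule derivative_eq_intros dk[OF x] de refl)+ (simp add: algebra_simps power2_eq_square)
    show "((\<lambda>s. (w * ((k x)\<^sup>2 - 1) + 2 * c * (k x + 2 * z * c)) * e x s) has_real_derivative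
        2 * s * ?P * e x y) (at y)"
      by (rule derivative_eq_intros de refl)+ (simp add: algebra_simps)
    show "((\<lambda>t. - 2 * s * (k t + 2 * z * c) * e t y) has_real_derivative
        2 * s * ?P * e x y) (at x)"
      by (rule derivative_eq_intros dk[OF x] de refl)+ (simp add: algebra_simps)
    show "((\<lambda>t. - 2 * s * (k x + 2 * z * c) * e x t) has_real_derivative
        - 4 * s\<^sup>2 * (k x + 2 * z * c) * e x y) (at y)"
      by (rule derivative_eq_intros de refl)+ (simp add: algebra_simps power2_eq_square)
    let ?g = "k x" and ?e = "e x y"
    show "2 * rho x * ((?P' - 2 * c * ?P) * ?e) =
        2 * (rho x)\<^sup>2 * (- (?g + 2 * z * c) * ?e)
        + (drho x - 4 * (4 * c ^ 3 - 3 * c)) * (?P * ?e)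
        + 4 * (3 * s - 4 * s ^ 3) * (- 2 * s * (?g + 2 * z * c) * ?e)"
      unfolding rho[OF x] using w sc by algebra
    show "2 * rho x * (2 * s * ?P * ?e) = 4 * (3 * s - 4 * s ^ 3) * (?P * ?e)
        + (drho x + 4 * (4 * c ^ 3 - 3 * c)) * (- 2 * s * (?g + 2 * z * c) * ?e)"
      unfolding rho[OF x] using w sc by algebra
    show "2 * rho x * (- 4 * s\<^sup>2 * (?g + 2 * z * c) * ?e) =
        2 * (rho x)\<^sup>2 * (- (?g + 2 * z * c) * ?e)
        - (drho x - 4 * (4 * c ^ 3 - 3 * c)) * (?P * ?e)
        - 4 * (3 * s - 4 * s ^ 3) * (- 2 * s * (?g + 2 * z * c) * ?e)"
      unfolding rho[OF x] using w sc by algebra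
  qed
  thus ?thesis
    by (rule frame_eqs_cong) (simp_all add: fx fx'_def)
qed

text \<open>The solution that takes the place of a lost exponential when two of them coincide; the
  factor \<open>y\<close> is the mark of such a confluence. Here \<open>\<sigma>\<close> is \<open>1\<close> or \<open>-1\<close>, and \<open>U = i\<sigma>\<close>.\<close>

definition chi :: "real \<Rightarrow> real \<Rightarrow> real \<Rightarrow> real" where
  "chi \<sigma> x y = exp (\<sigma> * y) * (sinh (sqrt 3 * x) + 3 * \<sigma> * y * csch (sqrt 3 * x))"

definition chi_x :: "real \<Rightarrow> real \<Rightarrow> real \<Rightarrow> real" where
  "chi_x \<sigma> x y = sqrt 3 * exp (\<sigma> * y) *
     (cosh (sqrt 3 * x) - 3 * \<sigma> * y * csch (sqrt 3 * x) * coth (sqrt 3 * x))"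

definition chi_y :: "real \<Rightarrow> real \<Rightarrow> real \<Rightarrow> real" where
  "chi_y \<sigma> x y = \<sigma> * exp (\<sigma> * y) *
     (sinh (sqrt 3 * x) + (3 + 3 * \<sigma> * y) * csch (sqrt 3 * x))"

lemma chi_solution:
  assumes "\<sigma>\<^sup>2 = 1"
  shows "frame_eqs 0 \<sigma> (chi \<sigma>) (chi_x \<sigma>) (chi_y \<sigma>)"
proof -
  define w where "w = sqrt (3::real)"
  have w: "w ^ 2 = 3" "w > 0" by (simp_all add: w_def)
  define k h S C where "k = (\<lambda>x. coth (w * x))" and "h = (\<lambda>x. csch (w * x))"
    and "S = (\<lambda>x. sinh (w * x))" and "C = (\<lambda>x. cosh (w * x))"
  define e where "e = (\<lambda>y. exp (\<sigma> * y))"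
  have f: "chi \<sigma> x y = e y * (S x + 3 * \<sigma> * y * h x)"
    "chi_x \<sigma> x y = w * e y * (C x - 3 * \<sigma> * y * h x * k x)"
    "chi_y \<sigma> x y = \<sigma> * e y * (S x + (3 + 3 * \<sigma> * y) * h x)" for x y
    unfolding chi_def chi_x_def chi_y_def k_def h_def S_def C_def e_def w_def by simp_all
  have dk: "(k has_real_derivative - w * (h x)\<^sup>2) (at x)" if "x > 0" for x
    using coth_has_derivative[OF that] by (simp add: k_def h_def w_def)
  have dh: "(h has_real_derivative - w * h x * k x) (at x)" if "x > 0" for x
    using csch_has_derivative[OF that] by (simp add: k_def h_def w_def)
  have dS: "(S has_real_derivative w * C x) (at x)" "(C has_real_derivative w * S x) (at x)" for x
    unfolding S_def C_def by (auto intro!: derivative_eq_intros)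
  have de: "(e has_real_derivative \<sigma> * e y) (at y)" for y
    unfolding e_def by (auto intro!: derivative_eq_intros)
  have rel: "S x * h x = 1" "C x = k x * S x" "(k x)\<^sup>2 = (h x)\<^sup>2 + 1" if "x > 0" for x
  proof -
    have "S x \<noteq> 0" using that w(2) by (simp add: S_def)
    thus "S x * h x = 1" "C x = k x * S x"
      by (simp_all add: S_def h_def C_def k_def csch_def coth_def)
    show "(k x)\<^sup>2 = (h x)\<^sup>2 + 1" using that w(2) by (simp add: k_def h_def coth_squared)
  qed
  have rho: "rho x = 3 * (h x)\<^sup>2 + 2" "drho x = - 6 * w * (h x)\<^sup>2 * k x" for x
    by (simp_all add: rho_def drho_def h_def k_def w_def)
  show ?thesis
    unfolding f[abs_def]
  proof (rule frame_eqs_realI)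
    fix x y :: real assume x: "x > 0"
    let ?g = "k x" and ?h = "h x" and ?S = "S x" and ?C = "C x" and ?e = "e y"
    show "((\<lambda>s. e y * (S s + 3 * \<sigma> * y * h s)) has_real_derivative
        w * ?e * (?C - 3 * \<sigma> * y * ?h * ?g)) (at x)"
      by (rule derivative_eq_intros dh[OF x] dS refl)+ (simp add: algebra_simps)
    show "((\<lambda>s. e s * (S x + 3 * \<sigma> * s * h x)) has_real_derivative
        \<sigma> * ?e * (?S + (3 + 3 * \<sigma> * y) * ?h)) (at y)"
      by (rule derivative_eq_intros de refl)+ (simp add: algebra_simps)
    show "((\<lambda>s. w * e y * (C s - 3 * \<sigma> * y * h s * k s)) has_real_derivative
        w * ?e * (w * ?S + 3 * \<sigma> * y * (w * ?h * ?g\<^sup>2 + w * ?h * ?h\<^sup>2))) (at x)"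
      by (rule derivative_eq_intros dh[OF x] dk[OF x] dS refl)+ (simp add: algebra_simps power2_eq_square)
    show "((\<lambda>s. w * e s * (C x - 3 * \<sigma> * s * h x * k x)) has_real_derivative
        w * \<sigma> * ?e * (?C - (3 + 3 * \<sigma> * y) * ?h * ?g)) (at y)"
      by (rule derivative_eq_intros de refl)+ (simp add: algebra_simps power2_eq_square)
    show "((\<lambda>s. \<sigma> * e y * (S s + (3 + 3 * \<sigma> * y) * h s)) has_real_derivative
        w * \<sigma> * ?e * (?C - (3 + 3 * \<sigma> * y) * ?h * ?g)) (at x)"
      by (rule derivative_eq_intros dh[OF x] dS refl)+ (simp add: algebra_simps)
    show "((\<lambda>s. \<sigma> * e s * (S x + (3 + 3 * \<sigma> * s) * h x)) has_real_derivative
        \<sigma>\<^sup>2 * ?e * (?S + (6 + 3 * \<sigma> * y) * ?h)) (at y)"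
      by (rule derivative_eq_intros de refl)+ (simp add: algebra_simps power2_eq_square)
    note R = rel[OF x] w(1) assms
    show "2 * rho x * (w * ?e * (w * ?S + 3 * \<sigma> * y * (w * ?h * ?g\<^sup>2 + w * ?h * ?h\<^sup>2))) =
       2 * (rho x)\<^sup>2 * (?e * (?S + 3 * \<sigma> * y * ?h))
       + (drho x - 4 * 0) * (w * ?e * (?C - 3 * \<sigma> * y * ?h * ?g))
       + 4 * \<sigma> * (\<sigma> * ?e * (?S + (3 + 3 * \<sigma> * y) * ?h))"
      unfolding rho using R by algebra
    show "2 * rho x * (w * \<sigma> * ?e * (?C - (3 + 3 * \<sigma> * y) * ?h * ?g)) =
       4 * \<sigma> * (w * ?e * (?C - 3 * \<sigma> * y * ?h * ?g))
       + (drho x + 4 * 0) * (\<sigma> * ?e * (?S + (3 + 3 * \<sigma> * y) * ?h))"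
      unfolding rho using R by algebra
    show "2 * rho x * (\<sigma>\<^sup>2 * ?e * (?S + (6 + 3 * \<sigma> * y) * ?h)) =
       2 * (rho x)\<^sup>2 * (?e * (?S + 3 * \<sigma> * y * ?h))
       - (drho x - 4 * 0) * (w * ?e * (?C - 3 * \<sigma> * y * ?h * ?g))
       - 4 * \<sigma> * (\<sigma> * ?e * (?S + (3 + 3 * \<sigma> * y) * ?h))"
      unfolding rho using R by algebra
  qed
qed

section \<open>Smoothness of the explicit surfaces\<close>

text \<open>Closed under differentiation up to polynomial expressions, and rich enough to express all the
  surfaces below; this is where their smoothness comes from.\<close>

definition sphere_gens :: "(real \<Rightarrow> real \<Rightarrow> real) set" where
  "sphere_gens = {\<lambda>x y. coth (sqrt 3 * x), \<lambda>x y. csch (sqrt 3 * x), \<lambda>x y. y}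
     \<union> {\<lambda>x y. exp (c * x + d * y) | c d. True}"

lemma sphere_gens_closed:
  assumes "g \<in> sphere_gens"
  shows "continuous_on half_plane (\<lambda>(x, y). g x y)"
    and "\<exists>u\<in>polys_in sphere_gens. \<exists>v\<in>polys_in sphere_gens. has_partials half_plane g u v"
proof -
  let ?k = "\<lambda>(x::real) (y::real). coth (sqrt 3 * x)" and ?h = "\<lambda>(x::real) (y::real). csch (sqrt 3 * x)"
  have k: "?k \<in> polys_in sphere_gens" and h: "?h \<in> polys_in sphere_gens"
    by (rule polys_in.gen, simp add: sphere_gens_def)+
  have e: "(\<lambda>x y. exp (c * x + d * y)) \<in> polys_in sphere_gens" for c d
    by (rule polys_in.gen) (auto simp: sphere_gens_def)
  consider "g = ?k" | "g = ?h" | "g = (\<lambda>x y. y)" | c d where "g = (\<lambda>x y. exp (c * x + d * y))"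
    using assms by (auto simp: sphere_gens_def)
  note cs = this
  from cs show "continuous_on half_plane (\<lambda>(x, y). g x y)"
    by cases (auto simp: case_prod_unfold coth_def csch_def half_plane_def intro!: continuous_intros)
  from cs show "\<exists>u\<in>polys_in sphere_gens. \<exists>v\<in>polys_in sphere_gens. has_partials half_plane g u v"
  proof cases
    case 1
    have "has_partials half_plane g (\<lambda>x y. - sqrt 3 * (?h x y * ?h x y)) (\<lambda>_ _. 0)"
      unfolding 1 by (rule has_partialsI)
        (use coth_has_derivative in \<open>auto simp: power2_eq_square has_real_derivative_iff_has_vector_derivative\<close>)
    moreover have "(\<lambda>x y. - sqrt 3 * (?h x y * ?h x y)) \<in> polys_in sphere_gens"
      using polys_in.mult[OF polys_in.const[of "- sqrt 3"] polys_in.mult[OF h h]] by simp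
    ultimately show ?thesis using polys_in.const by (intro bexI)
  next
    case 2
    have "has_partials half_plane g (\<lambda>x y. - sqrt 3 * (?h x y * ?k x y)) (\<lambda>_ _. 0)"
      unfolding 2 by (rule has_partialsI)
        (use csch_has_derivative in \<open>auto simp: mult.assoc has_real_derivative_iff_has_vector_derivative\<close>)
    moreover have "(\<lambda>x y. - sqrt 3 * (?h x y * ?k x y)) \<in> polys_in sphere_gens"
      using polys_in.mult[OF polys_in.const[of "- sqrt 3"] polys_in.mult[OF h k]] by simp
    ultimately show ?thesis using polys_in.const by (intro bexI)
  next
    case 3
    have "has_partials half_plane g (\<lambda>_ _. 0) (\<lambda>_ _. 1)"
      unfolding 3 by (rule has_partialsI) auto
    thus ?thesis using polys_in.const by (intro bexI)
  next
    case (4 c d)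
    have "has_partials half_plane g (\<lambda>x y. c * exp (c * x + d * y)) (\<lambda>x y. d * exp (c * x + d * y))"
      unfolding 4 by (rule has_partialsI)
        (auto simp flip: has_real_derivative_iff_has_vector_derivative intro!: derivative_eq_intros)
    thus ?thesis using polys_in.mult[OF polys_in.const e] by (intro bexI)
  qed
qed

lemma smooth_map_sphere_gens:
  fixes r :: surface
  assumes "\<And>i. (\<lambda>x y. r x y $ i) \<in> polys_in sphere_gens"
  shows "smooth_map half_plane r"
  by (rule smooth_map_polys[OF open_half_plane _ _ assms])
     (use sphere_gens_closed in blast)+

lemma coth_in_polys: "(\<lambda>x y. coth (sqrt 3 * x)) \<in> polys_in sphere_gens"
  and csch_in_polys: "(\<lambda>x y. csch (sqrt 3 * x)) \<in> polys_in sphere_gens"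
  and y_in_polys: "(\<lambda>x y. y) \<in> polys_in sphere_gens"
  and exp_in_polys: "(\<lambda>x y. exp (c * x + d * y)) \<in> polys_in sphere_gens"
  by (rule polys_in.gen, force simp: sphere_gens_def)+

lemma phi_in_polys: "phi \<theta> \<in> polys_in sphere_gens"
proof -
  have eq: "phi \<theta> = (\<lambda>x y. (- 1) * ((coth (sqrt 3 * x) + 2 / sqrt 3 * cos \<theta>)
      * exp (- 2 * cos \<theta> * x + 2 * sin \<theta> * y)))"
    by (intro ext) (simp add: phi_def algebra_simps)
  show ?thesis unfolding eq
    by (intro polys_in.mult[OF polys_in.const] polys_in.mult[OF polys_in.add]
        coth_in_polys exp_in_polys polys_in.const)
qed

lemma chi_in_polys: "chi \<sigma> \<in> polys_in sphere_gens"
proof -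
  have eq: "chi \<sigma> = (\<lambda>x y. exp (0 * x + \<sigma> * y)
      * (((1/2) * exp (sqrt 3 * x + 0 * y) + (- 1/2) * exp (- sqrt 3 * x + 0 * y))
         + (3 * \<sigma>) * (y * csch (sqrt 3 * x))))"
    by (intro ext) (simp add: chi_def sinh_def algebra_simps)
  show ?thesis unfolding eq
    by (rule polys_in.mult[OF exp_in_polys polys_in.add[OF polys_in.add[OF
        polys_in.mult[OF polys_in.const exp_in_polys] polys_in.mult[OF polys_in.const exp_in_polys]]
        polys_in.mult[OF polys_in.const polys_in.mult[OF y_in_polys csch_in_polys]]]])
qed

section \<open>Spheres with a prescribed frame at the base point\<close>

text \<open>At \<open>(base, 0)\<close> the functions \<open>sinh\<close>, \<open>csch\<close> of \<open>\<surd>3 x\<close> equal \<open>1\<close>, and \<open>cosh\<close>, \<open>coth\<close> equal \<open>\<surd>2\<close>. The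
  frames recorded in \<open>mat_A\<close> and in \<open>mat_D ** mat_B\<close> are taken at this point.\<close>

definition base :: real where
  "base = ln (1 + sqrt 2) / sqrt 3"

lemma base_pos: "base > 0"
  unfolding base_def by (intro divide_pos_pos ln_gt_zero) auto

lemma base_values:
  "exp (sqrt 3 * base) = 1 + sqrt 2" "exp (- (sqrt 3 * base)) = sqrt 2 - 1"
  "sinh (sqrt 3 * base) = 1" "cosh (sqrt 3 * base) = sqrt 2"
  "coth (sqrt 3 * base) = sqrt 2" "csch (sqrt 3 * base) = 1" "rho base = 5"
proof -
  have w: "sqrt 3 * base = ln (1 + sqrt 2)" by (simp add: base_def)
  have p: "1 + sqrt 2 > (0::real)" by (simp add: add_pos_pos)
  show e: "exp (sqrt 3 * base) = 1 + sqrt 2" using p by (simp add: w)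
  have "(sqrt 2 - 1) * (1 + sqrt 2) = (1::real)" by (simp add: algebra_simps)
  hence "inverse (1 + sqrt 2) = sqrt 2 - (1::real)" using p by (simp add: field_simps)
  thus e': "exp (- (sqrt 3 * base)) = sqrt 2 - 1" by (simp add: exp_minus e)
  show sc: "sinh (sqrt 3 * base) = 1" "cosh (sqrt 3 * base) = sqrt 2"
    by (simp_all add: sinh_def cosh_def e e')
  show "coth (sqrt 3 * base) = sqrt 2" and c: "csch (sqrt 3 * base) = 1"
    by (simp_all add: coth_def csch_def sc)
  show "rho base = 5" by (simp add: rho_def c)
qed

definition frame_matrix :: "surface \<Rightarrow> surface \<Rightarrow> surface \<Rightarrow> real^3^3" where
  "frame_matrix V P Q = (\<chi> i. vector [V base 0 $ i, P base 0 $ i, Q base 0 $ i])"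

lemma det_frame_matrix: "det (frame_matrix V P Q) = det_vec (V base 0) (P base 0) (Q base 0)"
  unfolding det_vec_expand det_3 frame_matrix_def by (simp add: algebra_simps)

lemma det_mat_A: "det mat_A = - 5"
proof -
  define z w where "z = 1 / sqrt (3::real)" and "w = sqrt (2::real)"
  have zw: "z ^ 2 = 1 / 3" "w ^ 2 = 2" by (simp_all add: z_def w_def power_divide)
  have A: "mat_A = vector [vector [z, w, 4 * z], vector [- w * z, 1, 2 * w * z], vector [- z, w, - z]]"
    unfolding mat_A_def z_def w_def by simp
  have "det mat_A = - z\<^sup>2 - 2 * w\<^sup>2 * z\<^sup>2 - 4 * w\<^sup>2 * z\<^sup>2 - w\<^sup>2 * z\<^sup>2 + 4 * z\<^sup>2 - 2 * w\<^sup>2 * z\<^sup>2"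
    unfolding det_3 A by (simp add: algebra_simps power2_eq_square)
  thus ?thesis by (simp add: zw)
qed

lemma matrix_inv_right:
  fixes K :: "real^'n^'n"
  assumes "det K \<noteq> 0"
  shows "K ** matrix_inv K = mat 1"
proof -
  have "\<exists>K'. K ** K' = mat 1 \<and> K' ** K = mat 1"
    using assms invertible_det_nz[of K] by (simp add: invertible_def)
  thus ?thesis unfolding matrix_inv_def by (rule someI2_ex) blast
qed

text \<open>The combination of the three basis solutions has the columns of \<open>mat_A\<close> as its frame at the base
  point. The determinant \<open>-5\<close> of that matrix is \<open>- rho base\<close>, which is the required normalization.\<close>

lemma normalized_solution:
  assumes fr: "frame_eqs a b V P Q" and V: "\<And>i. (\<lambda>x y. V x y $ i) \<in> polys_in sphere_gens"
    and K: "det (frame_matrix V P Q) \<noteq> 0"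
    and r: "\<And>x y. x > 0 \<Longrightarrow> r x y = mat_A *v (matrix_inv (frame_matrix V P Q) *v V x y)"
  shows "has_invariants r (Complex a b)"
proof -
  define C where "C = mat_A ** matrix_inv (frame_matrix V P Q)"
  have r': "r x y = C *v V x y" if "(x, y) \<in> half_plane" for x y
    using r that by (simp add: C_def matrix_vector_mul_assoc)
  have "det (frame_matrix V P Q ** matrix_inv (frame_matrix V P Q)) = 1"
    using matrix_inv_right[OF K] by simp
  hence det: "det C * det (frame_matrix V P Q) = - 5"
    by (simp add: C_def det_mul det_mat_A mult.commute)
  have bl: "bounded_linear (\<lambda>v. C *v v)"
    by (rule matrix_vector_mul_bounded_linear)
  show ?thesis
  proof (rule frame_eqs_imp_affine_invariants)
    show "frame_eqs a b r (\<lambda>x y. C *v P x y) (\<lambda>x y. C *v Q x y)"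
      by (rule frame_eqs_cong[OF frame_eqs_linear[OF bl fr]]) (simp_all add: r')
    have "smooth_map half_plane (\<lambda>x y. C *v V x y)"
      by (rule smooth_map_sphere_gens)
         (simp only: matrix_vector_mult_def sum_3 vec_lambda_beta,
           intro polys_in.add polys_in.mult[OF polys_in.const] V)
    thus "smooth_map half_plane r"
      by (rule smooth_map_cong[OF open_half_plane]) (simp add: r')
    show "base > 0" by (rule base_pos)
    show "\<bar>det_vec (r base 0) (C *v P base 0) (C *v Q base 0)\<bar> = rho base"
      using det base_pos by (simp add: r' det_vec_mult base_values flip: det_frame_matrix)
  qed
qed

section \<open>The family away from the singular parameters\<close>

text \<open>Angles that differ by \<open>2\<pi>/3\<close> have the same cubic coefficient. The order of the three offsets is
  dictated by the entries of \<open>vec_v\<close>.\<close>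

definition offset :: "3 \<Rightarrow> real" where
  "offset i = (if i = 1 then 0 else if i = 2 then - (2 * pi / 3) else 2 * pi / 3)"

lemma offset_simps [simp]: "offset 1 = 0" "offset 2 = - (2 * pi / 3)" "offset 3 = 2 * pi / 3"
  by (simp_all add: offset_def)

lemma trig_offset:
  "cos (t + offset 2) = (sqrt 3 * sin t - cos t) / 2" "sin (t + offset 2) = - (sin t + sqrt 3 * cos t) / 2"
  "cos (t + offset 3) = - (sqrt 3 * sin t + cos t) / 2" "sin (t + offset 3) = (sqrt 3 * cos t - sin t) / 2"
  unfolding offset_simps cos_add sin_add cos_minus sin_minus cos_120 sin_120
  by (simp_all add: field_simps)

lemma trig_triple_offset:
  "cos (3 * (t + offset i)) = cos (3 * t)" "sin (3 * (t + offset i)) = sin (3 * t)"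
proof -
  have "3 * (t + offset i) = 3 * t \<or> 3 * (t + offset i) = 3 * t - 2 * pi \<or>
      3 * (t + offset i) = 3 * t + 2 * pi"
    using exhaust_3[of i] by (auto simp: algebra_simps)
  thus "cos (3 * (t + offset i)) = cos (3 * t)" "sin (3 * (t + offset i)) = sin (3 * t)"
    by (auto simp: cos_diff sin_diff cos_add sin_add)
qed

definition phi_surf :: "real \<Rightarrow> surface" where
  "phi_surf t x y = (\<chi> i. phi (t + offset i) x y)"

definition phi_surf_x :: "real \<Rightarrow> surface" where
  "phi_surf_x t x y = (\<chi> i. phi_x (t + offset i) x y)"

definition phi_surf_y :: "real \<Rightarrow> surface" where
  "phi_surf_y t x y = (\<chi> i. phi_y (t + offset i) x y)"

lemma vec_v_eq: "vec_v t = phi_surf t"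
proof (intro ext)
  fix x y
  have 1: "vec_v t x y $ 1 = phi (t + offset 1) x y"
    by (simp add: vec_v_def phi_def)
  have "2 * (- x * ((sqrt 3 * sin t - cos t) / 2) + y * (- (sin t + sqrt 3 * cos t) / 2)) =
      (- sqrt 3 * sin t + cos t) * x + (- sin t - sqrt 3 * cos t) * y"
    "2 / sqrt 3 * ((sqrt 3 * sin t - cos t) / 2) = - ((- sqrt 3 * sin t + cos t) / sqrt 3)"
    by (simp_all add: field_simps)
  hence 2: "vec_v t x y $ 2 = phi (t + offset 2) x y"
    unfolding phi_def trig_offset by (simp only: vec_v_def vector_3 diff_conv_add_uminus)
  have "2 * (- x * (- (sqrt 3 * sin t + cos t) / 2) + y * ((sqrt 3 * cos t - sin t) / 2)) =
      (sqrt 3 * sin t + cos t) * x + (- sin t + sqrt 3 * cos t) * y"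
    "2 / sqrt 3 * (- (sqrt 3 * sin t + cos t) / 2) = - ((sqrt 3 * sin t + cos t) / sqrt 3)"
    by (simp_all add: field_simps)
  hence 3: "vec_v t x y $ 3 = phi (t + offset 3) x y"
    unfolding phi_def trig_offset by (simp only: vec_v_def vector_3 diff_conv_add_uminus)
  show "vec_v t x y = phi_surf t x y"
    unfolding vec_eq_iff forall_3 phi_surf_def vec_lambda_beta using 1 2 3 by simp
qed

lemma phi_base:
  "phi \<theta> base 0 = - (sqrt 2 + 2 / sqrt 3 * cos \<theta>) * exp (- 2 * base * cos \<theta>)"
  "phi_x \<theta> base 0 = (sqrt 3 + 2 * (sqrt 2 + 2 / sqrt 3 * cos \<theta>) * cos \<theta>) * exp (- 2 * base * cos \<theta>)"
  "phi_y \<theta> base 0 = - 2 * (sqrt 2 + 2 / sqrt 3 * cos \<theta>) * sin \<theta> * exp (- 2 * base * cos \<theta>)"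
  unfolding phi_def phi_x_def phi_y_def base_values by (simp_all add: algebra_simps)

text \<open>The factor \<open>(1 + \<surd>2)\<^sup>z\<close> is an exponential of the base point, because \<open>e\<close> to the power \<open>\<surd>3 base\<close> is \<open>1 + \<surd>2\<close>;
  so \<open>mat_D\<close> collects the exponential factors of the frames and \<open>mat_B\<close> the remaining factors.\<close>

lemma DB_eq: "mat_D t ** mat_B t = frame_matrix (phi_surf t) (phi_surf_x t) (phi_surf_y t)"
proof -
  have pw: "(1 + sqrt 2) powr z = exp (sqrt 3 * z * base)" for z
    by (simp add: powr_def base_def add_nonneg_eq_0_iff)
  have w: "sqrt 3 * (sqrt 3 * x) = 3 * x" for x by (simp flip: mult.assoc)
  have b2: "sqrt 2 + 2 / sqrt 3 * cos (t + offset 2) = sqrt 2 + sin t - cos t / sqrt 3"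
    and b3: "sqrt 2 + 2 / sqrt 3 * cos (t + offset 3) = sqrt 2 - sin t - cos t / sqrt 3"
    unfolding trig_offset by (simp_all add: field_simps)
  have D: "mat_D t $ i $ j = (if i = j then exp (- 2 * base * cos (t + offset i)) else 0)" for i j
  proof -
    have e: "(1 + sqrt 2) powr (- 2 / sqrt 3 * cos t) = exp (- 2 * base * cos (t + offset 1))"
      "(1 + sqrt 2) powr (- sin t + 1 / sqrt 3 * cos t) = exp (- 2 * base * cos (t + offset 2))"
      "(1 + sqrt 2) powr (sin t + 1 / sqrt 3 * cos t) = exp (- 2 * base * cos (t + offset 3))"
      unfolding pw trig_offset by (simp_all add: field_simps)
    have "\<forall>i j. mat_D t $ i $ j = (if i = j then exp (- 2 * base * cos (t + offset i)) else 0)"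
      unfolding forall_3 mat_D_def e by simp
    thus ?thesis by blast
  qed
  have B: "mat_B t $ i = (let \<beta> = sqrt 2 + 2 / sqrt 3 * cos (t + offset i) in
      vector [- \<beta>, sqrt 3 + 2 * \<beta> * cos (t + offset i), - 2 * \<beta> * sin (t + offset i)])" for i
  proof -
    have "\<forall>i. mat_B t $ i = (let \<beta> = sqrt 2 + 2 / sqrt 3 * cos (t + offset i) in
      vector [- \<beta>, sqrt 3 + 2 * \<beta> * cos (t + offset i), - 2 * \<beta> * sin (t + offset i)])"
      unfolding forall_3 b2 b3 mat_B_def Let_def vector_3 trig_offset
      by (simp add: vec_eq_iff forall_3 field_simps w)
    thus ?thesis by blast
  qed
  have "(mat_D t ** mat_B t) $ i $ j = exp (- 2 * base * cos (t + offset i)) * mat_B t $ i $ j" for i j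
    unfolding matrix_matrix_mult_def by (simp add: D if_distrib[of "\<lambda>z. z * _"] cong: if_cong)
  moreover have "frame_matrix (phi_surf t) (phi_surf_x t) (phi_surf_y t) $ i $ j
      = exp (- 2 * base * cos (t + offset i)) * mat_B t $ i $ j" for i j
    using exhaust_3[of j]
    by (auto simp: frame_matrix_def phi_surf_def phi_surf_x_def phi_surf_y_def phi_base B Let_def algebra_simps)
  ultimately show ?thesis by (simp add: vec_eq_iff)
qed

lemma det_mat_B: "det (mat_B t) = - 10 * cos (3 * t)"
proof -
  define c s z w where "c = cos t" and "s = sin t" and "z = 1 / sqrt (3::real)" and "w = sqrt (2::real)"
  have rel: "3 * z ^ 2 = 1" "w ^ 2 = 2" "s ^ 2 + c ^ 2 = 1"
    by (simp_all add: z_def w_def c_def s_def power_divide)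
  have q: "sqrt 3 = 3 * z" by (simp add: z_def real_div_sqrt)
  have dz: "x / sqrt 3 = x * z" for x by (simp add: z_def)
  have c3: "cos (3 * t) = 4 * c ^ 3 - 3 * c" by (simp add: c_def cos_treble_cos)
  have B: "mat_B t = (let b1 = w + 2 * z * c; b2 = w + s - c * z; b3 = w - s - c * z in
     vector [vector [- b1, 3 * z + 2 * b1 * c, - 2 * b1 * s],
       vector [- b2, 3 * z + b2 * (3 * z * s - c), b2 * (s + 3 * z * c)],
       vector [- b3, 3 * z - b3 * (3 * z * s + c), b3 * (s - 3 * z * c)]])"
    unfolding mat_B_def Let_def q[symmetric] c_def s_def w_def dz by simp
  show ?thesis
    unfolding det_3 B Let_def vector_3 c3 using rel by algebra
qed

lemma det_DB: "det (mat_D t ** mat_B t) = 0 \<longleftrightarrow> cos (3 * t) = 0"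
proof -
  have "det (mat_D t) \<noteq> 0"
    unfolding det_3 mat_D_def by (simp add: add_nonneg_eq_0_iff)
  thus ?thesis by (simp add: det_mul det_mat_B)
qed

lemma regular_params_iff: "t \<in> regular_params \<longleftrightarrow> t \<in> {0..2 * pi / 3} \<and> cos (3 * t) \<noteq> 0"
  by (simp add: regular_params_def invertible_det_nz det_mat_B)

lemma phi_surf_solution:
  "frame_eqs (cos (3 * t)) (sin (3 * t)) (phi_surf t) (phi_surf_x t) (phi_surf_y t)"
proof (rule frame_eqs_vec)
  fix i
  show "frame_eqs (cos (3 * t)) (sin (3 * t)) (\<lambda>x y. phi_surf t x y $ i)
      (\<lambda>x y. phi_surf_x t x y $ i) (\<lambda>x y. phi_surf_y t x y $ i)"
    using phi_solution[of "t + offset i"]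
    unfolding phi_surf_def phi_surf_x_def phi_surf_y_def trig_triple_offset by simp
qed

lemma r_fam_regular:
  assumes "t \<in> regular_params"
  shows "has_invariants (r_fam t) (Complex (cos (3 * t)) (sin (3 * t)))"
proof (rule normalized_solution[OF phi_surf_solution])
  show "(\<lambda>x y. phi_surf t x y $ i) \<in> polys_in sphere_gens" for i
    using phi_in_polys[of "t + offset i"] by (simp add: phi_surf_def)
  show "det (frame_matrix (phi_surf t) (phi_surf_x t) (phi_surf_y t)) \<noteq> 0"
    using assms det_DB[of t] by (simp add: DB_eq regular_params_iff)
  show "r_fam t x y = mat_A *v (matrix_inv (frame_matrix (phi_surf t) (phi_surf_x t) (phi_surf_y t))
      *v phi_surf t x y)" for x y
    using assms by (simp add: r_fam_def r_formula_def DB_eq vec_v_eq)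
qed

section \<open>The singular parameters\<close>

text \<open>The basis of solutions at a singular parameter. The first entry comes from the angle that stays
  isolated, the second from the two angles whose solutions coincide, and the third from their
  difference quotient. The value \<open>\<sigma> = 1\<close> belongs to \<open>t = \<pi>/6\<close>, and \<open>\<sigma> = -1\<close> to \<open>t = \<pi>/2\<close>.\<close>

definition lim_surf :: "real \<Rightarrow> surface" where
  "lim_surf \<sigma> x y = vector [- phi (- \<sigma> * (pi / 2)) x y, - phi (\<sigma> * (pi / 6)) x y, chi \<sigma> x y]"

definition lim_surf_x :: "real \<Rightarrow> surface" where
  "lim_surf_x \<sigma> x y = vector [- phi_x (- \<sigma> * (pi / 2)) x y, - phi_x (\<sigma> * (pi / 6)) x y, chi_x \<sigma> x y]"

definition lim_surf_y :: "real \<Rightarrow> surface" where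
  "lim_surf_y \<sigma> x y = vector [- phi_y (- \<sigma> * (pi / 2)) x y, - phi_y (\<sigma> * (pi / 6)) x y, chi_y \<sigma> x y]"

lemma sign_cases: "\<sigma>\<^sup>2 = 1 \<longleftrightarrow> \<sigma> = 1 \<or> \<sigma> = - 1" for \<sigma> :: real
  by (rule power2_eq_1_iff)

lemma trig_lim_surf:
  fixes \<sigma> :: real
  assumes "\<sigma>\<^sup>2 = 1"
  shows "cos (- \<sigma> * (pi / 2)) = 0" "sin (- \<sigma> * (pi / 2)) = - \<sigma>"
    "cos (\<sigma> * (pi / 6)) = sqrt 3 / 2" "sin (\<sigma> * (pi / 6)) = \<sigma> / 2"
  using assms unfolding sign_cases by (auto simp: cos_30 sin_30)

lemma lim_surf_solution:
  assumes "\<sigma>\<^sup>2 = 1"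
  shows "frame_eqs 0 \<sigma> (lim_surf \<sigma>) (lim_surf_x \<sigma>) (lim_surf_y \<sigma>)"
proof (rule frame_eqs_vec)
  have neg: "frame_eqs 0 \<sigma> (\<lambda>x y. - phi \<theta> x y) (\<lambda>x y. - phi_x \<theta> x y) (\<lambda>x y. - phi_y \<theta> x y)"
    if "cos (3 * \<theta>) = 0" "sin (3 * \<theta>) = \<sigma>" for \<theta>
    using frame_eqs_linear[OF bounded_linear_minus[OF bounded_linear_ident] phi_solution[of \<theta>]] that
    by simp
  have "cos (3 * (- \<sigma> * (pi / 2))) = 0" "sin (3 * (- \<sigma> * (pi / 2))) = \<sigma>"
    "cos (3 * (\<sigma> * (pi / 6))) = 0" "sin (3 * (\<sigma> * (pi / 6))) = \<sigma>"
    unfolding cos_treble_cos sin_treble_sin trig_lim_surf[OF assms]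
    using assms by (simp_all add: power3_eq_cube power2_eq_square field_simps)
  hence "\<forall>i. frame_eqs 0 \<sigma> (\<lambda>x y. lim_surf \<sigma> x y $ i) (\<lambda>x y. lim_surf_x \<sigma> x y $ i) (\<lambda>x y. lim_surf_y \<sigma> x y $ i)"
    unfolding forall_3 lim_surf_def lim_surf_x_def lim_surf_y_def vector_3
    using neg chi_solution[OF assms] by simp
  thus "frame_eqs 0 \<sigma> (\<lambda>x y. lim_surf \<sigma> x y $ i) (\<lambda>x y. lim_surf_x \<sigma> x y $ i) (\<lambda>x y. lim_surf_y \<sigma> x y $ i)" for i
    by blast
qed

lemma lim_surf_in_polys: "(\<lambda>x y. lim_surf \<sigma> x y $ i) \<in> polys_in sphere_gens"
proof -
  have "\<forall>i. (\<lambda>x y. lim_surf \<sigma> x y $ i) \<in> polys_in sphere_gens"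
    unfolding forall_3 lim_surf_def vector_3
    using polys_in_uminus[OF phi_in_polys] chi_in_polys by simp
  thus ?thesis by blast
qed

lemma frame_matrix_lim_surf:
  assumes "\<sigma>\<^sup>2 = 1"
  shows "frame_matrix (lim_surf \<sigma>) (lim_surf_x \<sigma>) (lim_surf_y \<sigma>) =
    vector [vector [sqrt 2, - sqrt 3, - 2 * sqrt 2 * \<sigma>], vector [1, - sqrt 6, \<sigma>], vector [1, sqrt 6, 4 * \<sigma>]]"
proof -
  have "exp (- 2 * base * (sqrt 3 / 2)) = sqrt 2 - 1"
    using base_values(2) by (simp add: mult.commute)
  note e = this
  have s12: "sqrt 12 = 2 * sqrt (3::real)" using real_sqrt_mult[of 4 3] by simp
  have "2 / sqrt 3 * (sqrt 3 / 2) = (1::real)" by simp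
  hence p: "phi (\<sigma> * (pi / 6)) base 0 = - 1" "phi_x (\<sigma> * (pi / 6)) base 0 = sqrt 6"
    "phi_y (\<sigma> * (pi / 6)) base 0 = - \<sigma>"
    unfolding phi_base trig_lim_surf[OF assms] e
    by (simp_all add: algebra_simps s12 flip: real_sqrt_mult)
  have q: "phi (- \<sigma> * (pi / 2)) base 0 = - sqrt 2" "phi_x (- \<sigma> * (pi / 2)) base 0 = sqrt 3"
    "phi_y (- \<sigma> * (pi / 2)) base 0 = 2 * sqrt 2 * \<sigma>"
    unfolding phi_base trig_lim_surf[OF assms] by simp_all
  have c: "chi \<sigma> base 0 = 1" "chi_x \<sigma> base 0 = sqrt 6" "chi_y \<sigma> base 0 = 4 * \<sigma>"
    unfolding chi_def chi_x_def chi_y_def base_values by (simp_all flip: real_sqrt_mult)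
  show ?thesis
    unfolding frame_matrix_def lim_surf_def lim_surf_x_def lim_surf_y_def vec_eq_iff forall_3
      vec_lambda_beta vector_3 p q c by simp
qed

lemma det_lim_surf:
  assumes "\<sigma>\<^sup>2 = 1"
  shows "det (frame_matrix (lim_surf \<sigma>) (lim_surf_x \<sigma>) (lim_surf_y \<sigma>)) \<noteq> 0"
proof -
  have "sqrt 6 = sqrt 2 * sqrt (3::real)" by (simp flip: real_sqrt_mult)
  hence "det (frame_matrix (lim_surf \<sigma>) (lim_surf_x \<sigma>) (lim_surf_y \<sigma>)) = - 15 * sqrt 3 * \<sigma>"
    unfolding frame_matrix_lim_surf[OF assms] det_3 vector_3 by (simp add: algebra_simps)
  thus ?thesis using assms by auto
qed

text \<open>Derivatives with respect to the angle; those of \<open>phi_x\<close> and \<open>phi_y\<close> are taken at the base point.\<close>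

definition dphi :: "real \<Rightarrow> real \<Rightarrow> real \<Rightarrow> real" where
  "dphi \<theta> x y = (2 / sqrt 3 * sin \<theta> - (coth (sqrt 3 * x) + 2 / sqrt 3 * cos \<theta>)
     * (2 * (x * sin \<theta> + y * cos \<theta>))) * exp (2 * (- x * cos \<theta> + y * sin \<theta>))"

lemma dphi: "((\<lambda>\<theta>. phi \<theta> x y) has_real_derivative dphi \<theta> x y) (at \<theta>)"
  unfolding phi_def dphi_def
  by (rule derivative_eq_intros refl)+ (simp add: algebra_simps)

definition dphi_x :: "real \<Rightarrow> real" where
  "dphi_x \<theta> = (- 2 * sin \<theta> * (sqrt 2 + 4 / sqrt 3 * cos \<theta>)
     + (sqrt 3 + 2 * (sqrt 2 + 2 / sqrt 3 * cos \<theta>) * cos \<theta>) * (2 * base * sin \<theta>)) * exp (- 2 * base * cos \<theta>)"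

lemma dphi_x: "((\<lambda>\<theta>. phi_x \<theta> base 0) has_real_derivative dphi_x \<theta>) (at \<theta>)"
  unfolding phi_base dphi_x_def
  by (rule derivative_eq_intros refl)+ (simp add: algebra_simps)

definition dphi_y :: "real \<Rightarrow> real" where
  "dphi_y \<theta> = (4 / sqrt 3 * (sin \<theta>)\<^sup>2 - 2 * (sqrt 2 + 2 / sqrt 3 * cos \<theta>) * cos \<theta>
     - 2 * (sqrt 2 + 2 / sqrt 3 * cos \<theta>) * sin \<theta> * (2 * base * sin \<theta>)) * exp (- 2 * base * cos \<theta>)"

lemma dphi_y: "((\<lambda>\<theta>. phi_y \<theta> base 0) has_real_derivative dphi_y \<theta>) (at \<theta>)"
  unfolding phi_base dphi_y_def
  by (rule derivative_eq_intros refl)+ (simp add: algebra_simps power2_eq_square)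

text \<open>For the angles \<open>\<sigma>\<pi>/6\<close> and \<open>5\<sigma>\<pi>/6\<close> the factor \<open>coth \<plusminus> 1\<close> absorbs the exponential in \<open>x\<close>: both
  solutions equal \<open>- csch(\<surd>3 x) e\<^sup>\<sigma>\<^sup>y\<close>. The speeds with which they depart from this common value as the angle
  moves differ by a multiple of \<open>chi\<close>.\<close>

lemma phi_collision:
  assumes \<sigma>: "\<sigma>\<^sup>2 = 1" and a: "cos \<alpha> = sqrt 3 / 2" "sin \<alpha> = \<sigma> / 2"
    and b: "cos \<beta> = - sqrt 3 / 2" "sin \<beta> = \<sigma> / 2" and x: "x > 0"
  shows "phi \<alpha> x y = phi \<beta> x y" and "- \<sigma> * (sqrt 3 / 2) * (dphi \<alpha> x y - dphi \<beta> x y) = chi \<sigma> x y"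
proof -
  define z C S h E where "z = 1 / sqrt (3::real)" and "C = cosh (sqrt 3 * x)" and "S = sinh (sqrt 3 * x)"
    and "h = csch (sqrt 3 * x)" and "E = exp (\<sigma> * y)"
  have q: "sqrt 3 = 3 * z" "3 * z ^ 2 = 1" by (simp_all add: z_def real_div_sqrt power_divide)
  have one: "2 / sqrt 3 * (sqrt 3 / 2) = (1::real)" "2 / sqrt 3 * (- sqrt 3 / 2) = (- 1::real)"
    "2 / sqrt 3 * (\<sigma> / 2) = z * \<sigma>" by (simp_all add: z_def)
  have "S \<noteq> 0" using x by (simp add: S_def)
  hence k: "coth (sqrt 3 * x) = C * h" and Sh: "S * h = 1" and CS: "C\<^sup>2 = S\<^sup>2 + 1"
    by (simp_all add: coth_def h_def csch_def C_def S_def cosh_square_eq)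
  have ea: "exp (2 * (- x * (sqrt 3 / 2) + y * (\<sigma> / 2))) = (C - S) * E"
    unfolding C_def S_def E_def cosh_minus_sinh by (simp add: algebra_simps flip: exp_add)
  have eb: "exp (2 * (- x * (- sqrt 3 / 2) + y * (\<sigma> / 2))) = (C + S) * E"
    unfolding C_def S_def E_def cosh_plus_sinh by (simp add: algebra_simps flip: exp_add)
  show "phi \<alpha> x y = phi \<beta> x y"
    unfolding phi_def a b ea eb one k using Sh CS by algebra
  have da: "dphi \<alpha> x y = (z * \<sigma> - (C * h + 1) * (x * \<sigma> + y * sqrt 3)) * ((C - S) * E)"
    unfolding dphi_def a b ea eb one k by simp
  have db: "dphi \<beta> x y = (z * \<sigma> - (C * h - 1) * (x * \<sigma> - y * sqrt 3)) * ((C + S) * E)"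
    unfolding dphi_def a b ea eb one k by simp
  have ch: "chi \<sigma> x y = E * (S + 3 * \<sigma> * y * h)" unfolding chi_def E_def S_def h_def by simp
  have "- \<sigma> * sqrt 3 * (dphi \<alpha> x y - dphi \<beta> x y) = 2 * chi \<sigma> x y"
    unfolding da db ch q(1) using Sh CS q(2) \<sigma> by algebra
  thus "- \<sigma> * (sqrt 3 / 2) * (dphi \<alpha> x y - dphi \<beta> x y) = chi \<sigma> x y" by simp
qed

text \<open>The same confluence for the first derivatives. They are needed at the base point only, where they
  form the rows of the limit frame.\<close>

lemma phi_collision_base:
  assumes \<sigma>: "\<sigma>\<^sup>2 = 1" and a: "cos \<alpha> = sqrt 3 / 2" "sin \<alpha> = \<sigma> / 2"
    and b: "cos \<beta> = - sqrt 3 / 2" "sin \<beta> = \<sigma> / 2"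
  shows "phi_x \<alpha> base 0 = phi_x \<beta> base 0" "phi_y \<alpha> base 0 = phi_y \<beta> base 0"
    and "- \<sigma> * (sqrt 3 / 2) * (dphi_x \<alpha> - dphi_x \<beta>) = chi_x \<sigma> base 0"
    "- \<sigma> * (sqrt 3 / 2) * (dphi_y \<alpha> - dphi_y \<beta>) = chi_y \<sigma> base 0"
proof -
  define z w where "z = 1 / sqrt (3::real)" and "w = sqrt (2::real)"
  have q: "sqrt 3 = 3 * z" "3 * z ^ 2 = 1" "w ^ 2 = 2"
    by (simp_all add: z_def w_def real_div_sqrt power_divide)
  have ww: "w * w = 2" "w * (w * u) = 2 * u" for u
    using q(3) by (simp_all add: power2_eq_square flip: mult.assoc)
  have one: "2 / sqrt 3 * (sqrt 3 / 2) = (1::real)" "2 / sqrt 3 * (- sqrt 3 / 2) = (- 1::real)"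
    "4 / sqrt 3 * (sqrt 3 / 2) = (2::real)" "4 / sqrt 3 * (- sqrt 3 / 2) = (- 2::real)"
    "4 / sqrt 3 * (\<sigma> / 2)\<^sup>2 = z * \<sigma>\<^sup>2"
    by (simp_all add: z_def power2_eq_square)
  have e: "exp (- 2 * base * (sqrt 3 / 2)) = w - 1" "exp (- 2 * base * (- sqrt 3 / 2)) = w + 1"
    using base_values(1,2) by (simp_all add: mult.commute w_def)
  have xa: "phi_x \<alpha> base 0 = (sqrt 3 + (w + 1) * sqrt 3) * (w - 1)"
    "phi_y \<alpha> base 0 = - (w + 1) * \<sigma> * (w - 1)"
    "dphi_x \<alpha> = (- \<sigma> * (w + 2) + (sqrt 3 + (w + 1) * sqrt 3) * (base * \<sigma>)) * (w - 1)"
    "dphi_y \<alpha> = (z * \<sigma>\<^sup>2 - (w + 1) * sqrt 3 - (w + 1) * \<sigma> * (base * \<sigma>)) * (w - 1)"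
    unfolding phi_base dphi_x_def dphi_y_def a e one
    by (simp_all add: w_def algebra_simps add_divide_distrib diff_divide_distrib)
  have xb: "phi_x \<beta> base 0 = (sqrt 3 - (w - 1) * sqrt 3) * (w + 1)"
    "phi_y \<beta> base 0 = - (w - 1) * \<sigma> * (w + 1)"
    "dphi_x \<beta> = (- \<sigma> * (w - 2) + (sqrt 3 - (w - 1) * sqrt 3) * (base * \<sigma>)) * (w + 1)"
    "dphi_y \<beta> = (z * \<sigma>\<^sup>2 + (w - 1) * sqrt 3 - (w - 1) * \<sigma> * (base * \<sigma>)) * (w + 1)"
    unfolding phi_base dphi_x_def dphi_y_def b e one
    by (simp_all add: w_def algebra_simps add_divide_distrib diff_divide_distrib)
  show "phi_x \<alpha> base 0 = phi_x \<beta> base 0"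
    unfolding xa xb by (simp add: algebra_simps ww)
  show "phi_y \<alpha> base 0 = phi_y \<beta> base 0"
    unfolding xa xb by (simp add: algebra_simps ww)
  have c: "chi_x \<sigma> base 0 = sqrt 3 * w" "chi_y \<sigma> base 0 = 4 * \<sigma>"
    unfolding chi_x_def chi_y_def base_values by (simp_all add: w_def)
  have "- \<sigma> * sqrt 3 * (dphi_x \<alpha> - dphi_x \<beta>) = 2 * (sqrt 3 * w)"
    unfolding xa xb q(1) using q(2,3) \<sigma> by algebra
  moreover have "- \<sigma> * sqrt 3 * (dphi_y \<alpha> - dphi_y \<beta>) = 2 * (4 * \<sigma>)"
    unfolding xa xb q(1) using q(2,3) \<sigma> by algebra
  ultimately show "- \<sigma> * (sqrt 3 / 2) * (dphi_x \<alpha> - dphi_x \<beta>) = chi_x \<sigma> base 0"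
    "- \<sigma> * (sqrt 3 / 2) * (dphi_y \<alpha> - dphi_y \<beta>) = chi_y \<sigma> base 0"
    unfolding c by simp_all
qed

text \<open>By Cramer's rule the solution of a linear system depends continuously on the data as long as
  the determinant of the limit system does not vanish.\<close>

lemma tendsto_matrix_solution:
  fixes K :: "'a \<Rightarrow> real^3^3"
  assumes K: "\<And>i j. ((\<lambda>s. K s $ i $ j) \<longlongrightarrow> L $ i $ j) F" and L: "det L \<noteq> 0"
    and v: "\<And>i. ((\<lambda>s. v s $ i) \<longlongrightarrow> u $ i) F"
    and w: "\<forall>\<^sub>F s in F. K s *v w s = v s"
  shows "(w \<longlongrightarrow> matrix_inv L *v u) F"
proof -
  have det: "((\<lambda>s. det (M s)) \<longlongrightarrow> det N) F"
    if "\<And>i j. ((\<lambda>s. M s $ i $ j) \<longlongrightarrow> N $ i $ j) F" for M :: "'a \<Rightarrow> real^3^3" and N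
    unfolding det_3 by (intro tendsto_intros that)
  have K0: "\<forall>\<^sub>F s in F. det (K s) \<noteq> 0"
    using tendsto_imp_eventually_ne[OF det[OF K] L] .
  have "L *v (matrix_inv L *v u) = u"
    using matrix_inv_right[OF L] by (simp add: matrix_vector_mul_assoc)
  hence lim: "matrix_inv L *v u = (\<chi> k. det (\<chi> i j. if j = k then u $ i else L $ i $ j) / det L)"
    using cramer[OF L] by blast
  have ent: "((\<lambda>s. (\<chi> i j. if j = k then v s $ i else K s $ i $ j) $ i $ j)
      \<longlongrightarrow> (\<chi> i j. if j = k then u $ i else L $ i $ j) $ i $ j) F" for i j k
    using K v by (cases "j = k") simp_all
  have "((\<lambda>s. \<chi> k. det (\<chi> i j. if j = k then v s $ i else K s $ i $ j) / det (K s))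
      \<longlongrightarrow> matrix_inv L *v u) F"
    unfolding lim by (intro tendsto_vec_lambda tendsto_divide det ent K L)
  moreover have "\<forall>\<^sub>F s in F. (\<chi> k. det (\<chi> i j. if j = k then v s $ i else K s $ i $ j) / det (K s)) = w s"
    using K0 w
  proof eventually_elim
    case (elim s)
    show ?case using iffD1[OF cramer[OF elim(1)] elim(2)] by (rule sym)
  qed
  ultimately show ?thesis by (rule Lim_transform_eventually)
qed

lemma difference_quotient_limit:
  assumes "(f has_real_derivative a) (at (t + p))" "(f has_real_derivative b) (at (t + q))"
    and "f (t + p) = f (t + q)"
  shows "((\<lambda>s. (f (s + p) - f (s + q)) / (s - t)) \<longlongrightarrow> a - b) (at t within X)"
proof -
  have "((\<lambda>s. f (s + p) - f (s + q)) has_real_derivative a - b) (at t)"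
    using assms(1,2) by (auto intro!: derivative_intros simp: DERIV_shift)
  hence "((\<lambda>s. f (s + p) - f (s + q)) has_real_derivative a - b) (at t within X)"
    by (rule has_field_derivative_at_within)
  thus ?thesis unfolding has_field_derivative_iff using assms(3) by simp
qed

text \<open>The coefficient vector \<open>w = (D B)\<^sup>-\<^sup>1 v\<close> solves a system with one equation for each angle. Two
  of the equations become equal in the limit; subtracting them and dividing by the distance of \<open>s\<close>
  from \<open>t\<close> gives an equivalent system whose limit is the regular system of the basis \<open>lim_surf\<close>.
  The indices \<open>i2\<close> and \<open>i3\<close> name the two colliding angles.\<close>

lemma r_formula_limit:
  assumes \<sigma>: "\<sigma>\<^sup>2 = 1"
    and i1: "cos (t + offset i1) = 0" "sin (t + offset i1) = - \<sigma>"
    and i2: "cos (t + offset i2) = sqrt 3 / 2" "sin (t + offset i2) = \<sigma> / 2"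
    and i3: "cos (t + offset i3) = - sqrt 3 / 2" "sin (t + offset i3) = \<sigma> / 2"
    and x: "x > 0"
  shows "((\<lambda>s. r_formula s x y) \<longlongrightarrow>
     mat_A *v (matrix_inv (frame_matrix (lim_surf \<sigma>) (lim_surf_x \<sigma>) (lim_surf_y \<sigma>)) *v lim_surf \<sigma> x y))
     (at t within regular_params)"
proof -
  let ?F = "at t within regular_params"
  define w where "w = (\<lambda>s. matrix_inv (mat_D s ** mat_B s) *v vec_v s x y)"
  define m :: "(real \<Rightarrow> real) \<Rightarrow> real \<Rightarrow> real^3" where "m = (\<lambda>f s. vector [- f (s + offset i1), - f (s + offset i2),
      - \<sigma> * (sqrt 3 / 2) * ((f (s + offset i2) - f (s + offset i3)) / (s - t))])"
  \<comment> \<open>\<open>m f s\<close> applies the row operations (change of sign, difference quotient) to the values of \<open>f\<close> at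
    the three angles; \<open>K\<close> is the transformed matrix \<open>D B\<close>\<close>
  define K :: "real \<Rightarrow> real^3^3" where "K = (\<lambda>s. \<chi> i. vector [m (\<lambda>\<theta>. phi \<theta> base 0) s $ i,
      m (\<lambda>\<theta>. phi_x \<theta> base 0) s $ i, m (\<lambda>\<theta>. phi_y \<theta> base 0) s $ i])"
  have m_lim: "((\<lambda>s. m f s $ i) \<longlongrightarrow> vector [- f \<theta>1, - f \<theta>2, g] $ i) ?F"
    if f: "\<And>\<theta>. (f has_real_derivative f' \<theta>) (at \<theta>)" and eq: "f (t + offset i2) = f (t + offset i3)"
      and g: "- \<sigma> * (sqrt 3 / 2) * (f' (t + offset i2) - f' (t + offset i3)) = g"
      and \<theta>: "f (t + offset i1) = f \<theta>1" "f (t + offset i2) = f \<theta>2" for f f' g i \<theta>1 \<theta>2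
  proof -
    have cont: "((\<lambda>s. - f (s + offset j)) \<longlongrightarrow> - f (t + offset j)) ?F" for j
    proof -
      have "isCont f (t + offset j)" by (rule DERIV_isCont[OF f])
      thus ?thesis by (intro tendsto_intros isCont_tendsto_compose[of _ f])
    qed
    have "\<forall>i. ((\<lambda>s. m f s $ i) \<longlongrightarrow> vector [- f \<theta>1, - f \<theta>2, g] $ i) ?F"
      unfolding forall_3 m_def vector_3 \<theta>[symmetric] g[symmetric]
      using cont difference_quotient_limit[OF f f eq] by (intro conjI tendsto_mult_left)
    thus ?thesis by blast
  qed
  have same: "phi (t + offset i1) = phi (- \<sigma> * (pi / 2))" "phi_x (t + offset i1) = phi_x (- \<sigma> * (pi / 2))"
    "phi_y (t + offset i1) = phi_y (- \<sigma> * (pi / 2))"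
    "phi (t + offset i2) = phi (\<sigma> * (pi / 6))" "phi_x (t + offset i2) = phi_x (\<sigma> * (pi / 6))"
    "phi_y (t + offset i2) = phi_y (\<sigma> * (pi / 6))"
    unfolding phi_def[abs_def] phi_x_def[abs_def] phi_y_def[abs_def] i1 i2 trig_lim_surf[OF \<sigma>] by simp_all
  have "(w \<longlongrightarrow> matrix_inv (frame_matrix (lim_surf \<sigma>) (lim_surf_x \<sigma>) (lim_surf_y \<sigma>)) *v lim_surf \<sigma> x y) ?F"
  proof (rule tendsto_matrix_solution[where K = K and v = "m (\<lambda>\<theta>. phi \<theta> x y)"])
    show "det (frame_matrix (lim_surf \<sigma>) (lim_surf_x \<sigma>) (lim_surf_y \<sigma>)) \<noteq> 0"
      by (rule det_lim_surf[OF \<sigma>])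
    show "((\<lambda>s. m (\<lambda>\<theta>. phi \<theta> x y) s $ i) \<longlongrightarrow> lim_surf \<sigma> x y $ i) ?F" for i
      unfolding lim_surf_def
      by (rule m_lim[where f = "\<lambda>\<theta>. phi \<theta> x y", OF dphi phi_collision[OF \<sigma> i2 i3 x]]) (simp_all add: same)
    have 1: "((\<lambda>s. K s $ i $ 1) \<longlongrightarrow> lim_surf \<sigma> base 0 $ i) ?F" for i
      unfolding lim_surf_def K_def vec_lambda_beta vector_3
      by (rule m_lim[where f = "\<lambda>\<theta>. phi \<theta> base 0", OF dphi phi_collision[OF \<sigma> i2 i3 base_pos]])
         (simp_all add: same)
    have 2: "((\<lambda>s. K s $ i $ 2) \<longlongrightarrow> lim_surf_x \<sigma> base 0 $ i) ?F" for i
      unfolding lim_surf_x_def K_def vec_lambda_beta vector_3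
      by (rule m_lim[where f = "\<lambda>\<theta>. phi_x \<theta> base 0", OF dphi_x phi_collision_base(1,3)[OF \<sigma> i2 i3]])
         (simp_all add: same)
    have 3: "((\<lambda>s. K s $ i $ 3) \<longlongrightarrow> lim_surf_y \<sigma> base 0 $ i) ?F" for i
      unfolding lim_surf_y_def K_def vec_lambda_beta vector_3
      by (rule m_lim[where f = "\<lambda>\<theta>. phi_y \<theta> base 0", OF dphi_y phi_collision_base(2,4)[OF \<sigma> i2 i3]])
         (simp_all add: same)
    show "((\<lambda>s. K s $ i $ j) \<longlongrightarrow> frame_matrix (lim_surf \<sigma>) (lim_surf_x \<sigma>) (lim_surf_y \<sigma>) $ i $ j) ?F" for i j
      using exhaust_3[of j] 1[of i] 2[of i] 3[of i] by (elim disjE) (simp_all add: frame_matrix_def)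
    have "K s *v w s = m (\<lambda>\<theta>. phi \<theta> x y) s" if s: "s \<in> regular_params" for s
    proof -
      have "(mat_D s ** mat_B s) *v w s = vec_v s x y"
        using matrix_inv_right[of "mat_D s ** mat_B s"] s
        by (simp add: w_def matrix_vector_mul_assoc det_DB regular_params_iff)
      hence "((mat_D s ** mat_B s) *v w s) $ i = phi (s + offset i) x y" for i
        by (simp add: vec_v_eq phi_surf_def)
      hence row: "phi (s + offset i) base 0 * w s $ 1 + phi_x (s + offset i) base 0 * w s $ 2
          + phi_y (s + offset i) base 0 * w s $ 3 = phi (s + offset i) x y" for i
        unfolding DB_eq frame_matrix_def matrix_vector_mult_def
        by (simp add: sum_3 phi_surf_def phi_surf_x_def phi_surf_y_def)
      show ?thesis
        unfolding vec_eq_iff forall_3 K_def matrix_vector_mult_def sum_3 m_def vec_lambda_beta vector_3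
          row[symmetric]
        by (simp add: algebra_simps add_divide_distrib diff_divide_distrib)
    qed
    thus "\<forall>\<^sub>F s in ?F. K s *v w s = m (\<lambda>\<theta>. phi \<theta> x y) s"
      by (auto simp: eventually_at_filter)
  qed
  hence "((\<lambda>s. mat_A *v w s) \<longlongrightarrow>
     mat_A *v (matrix_inv (frame_matrix (lim_surf \<sigma>) (lim_surf_x \<sigma>) (lim_surf_y \<sigma>)) *v lim_surf \<sigma> x y)) ?F"
    by (rule bounded_linear.tendsto[OF matrix_vector_mul_bounded_linear])
  thus ?thesis by (simp add: r_formula_def w_def)
qed

lemma cos_zero_cases:
  assumes "0 \<le> u" "u \<le> 2 * pi" "cos u = 0"
  shows "u = pi / 2 \<or> u = 3 * pi / 2"
proof (cases "u \<le> pi")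
  case True
  thus ?thesis using assms cos_inj_pi[of u "pi / 2"] by simp
next
  case False
  have "cos (2 * pi - u) = cos (pi / 2)" using assms(3) by (simp add: cos_diff)
  thus ?thesis using False assms cos_inj_pi[of "2 * pi - u" "pi / 2"] by simp
qed

lemma singular_params:
  assumes "t \<in> {0..2 * pi / 3} - regular_params"
  shows "t = pi / 6 \<or> t = pi / 2"
  using assms cos_zero_cases[of "3 * t"] by (auto simp: regular_params_iff)

lemma r_formula_limit_singular:
  assumes t: "t \<in> {0..2 * pi / 3} - regular_params"
  obtains \<sigma> :: real where "\<sigma>\<^sup>2 = 1" "cos (3 * t) = 0" "sin (3 * t) = \<sigma>"
    "\<And>x y. x > 0 \<Longrightarrow> ((\<lambda>s. r_formula s x y) \<longlongrightarrow>
       mat_A *v (matrix_inv (frame_matrix (lim_surf \<sigma>) (lim_surf_x \<sigma>) (lim_surf_y \<sigma>)) *v lim_surf \<sigma> x y))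
       (at t within regular_params)"
  using singular_params[OF t]
proof
  assume t: "t = pi / 6"
  show thesis
  proof (rule that[of 1])
    \<comment> \<open>the angles \<open>\<pi>/6\<close> and \<open>5\<pi>/6\<close> collide, and \<open>-\<pi>/2\<close> stays isolated\<close>
    show "cos (3 * t) = 0" "sin (3 * t) = 1" by (simp_all add: t)
    show "((\<lambda>s. r_formula s x y) \<longlongrightarrow>
       mat_A *v (matrix_inv (frame_matrix (lim_surf 1) (lim_surf_x 1) (lim_surf_y 1)) *v lim_surf 1 x y))
       (at t within regular_params)" if "x > 0" for x y
      by (rule r_formula_limit[of 1 _ 2 1 3])
         (simp_all only: trig_offset, use that in \<open>simp_all add: t cos_30 sin_30\<close>)
  qed simp
next
  assume t: "t = pi / 2"
  show thesis
  proof (rule that[of "- 1"])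
    \<comment> \<open>the angles \<open>-\<pi>/6\<close> and \<open>7\<pi>/6\<close> collide, and \<open>\<pi>/2\<close> stays isolated\<close>
    show "cos (3 * t) = 0" "sin (3 * t) = - 1"
      using cos_treble_cos[of t] sin_treble_sin[of t] by (simp_all add: t)
    show "((\<lambda>s. r_formula s x y) \<longlongrightarrow>
       mat_A *v (matrix_inv (frame_matrix (lim_surf (- 1)) (lim_surf_x (- 1)) (lim_surf_y (- 1)))
         *v lim_surf (- 1) x y)) (at t within regular_params)" if "x > 0" for x y
      by (rule r_formula_limit[of "- 1" _ 1 2 3])
         (simp_all only: trig_offset, use that in \<open>simp_all add: t\<close>)
  qed simp
qed

lemma singular_param_nontrivial:
  assumes "t \<in> {0..2 * pi / 3} - regular_params"
  shows "at t within regular_params \<noteq> bot"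
proof -
  have "{0..2 * pi / 3} = ({0..2 * pi / 3} - regular_params) \<union> regular_params"
    by (auto simp: regular_params_def)
  moreover have "finite ({0..2 * pi / 3} - regular_params)"
    by (rule finite_subset[of _ "{pi / 6, pi / 2}"]) (use singular_params in blast, simp)
  moreover have "t islimpt {0..2 * pi / 3}" using assms by (subst islimpt_Icc) auto
  ultimately show ?thesis using islimpt_Un_finite trivial_limit_within by metis
qed

lemma r_fam_singular:
  assumes t: "t \<in> {0..2 * pi / 3} - regular_params"
  shows "has_invariants (r_fam t) (Complex (cos (3 * t)) (sin (3 * t)))"
proof (rule r_formula_limit_singular[OF t])
  fix \<sigma> :: real
  assume \<sigma>: "\<sigma>\<^sup>2 = 1" and cs: "cos (3 * t) = 0" "sin (3 * t) = \<sigma>"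
    and lim: "\<And>x y. x > 0 \<Longrightarrow> ((\<lambda>s. r_formula s x y) \<longlongrightarrow>
       mat_A *v (matrix_inv (frame_matrix (lim_surf \<sigma>) (lim_surf_x \<sigma>) (lim_surf_y \<sigma>)) *v lim_surf \<sigma> x y))
       (at t within regular_params)"
  have "r_fam t x y =
      mat_A *v (matrix_inv (frame_matrix (lim_surf \<sigma>) (lim_surf_x \<sigma>) (lim_surf_y \<sigma>)) *v lim_surf \<sigma> x y)"
    if "x > 0" for x y
    using tendsto_Lim[OF singular_param_nontrivial[OF t] lim[OF that]] t by (simp add: r_fam_def)
  thus ?thesis unfolding cs
    by (rule normalized_solution[OF lim_surf_solution[OF \<sigma>] lim_surf_in_polys det_lim_surf[OF \<sigma>]])
qed

lemma r_fam_invariants: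
  assumes "t \<in> {0..2 * pi / 3}"
  shows "has_invariants (r_fam t) (Complex (cos (3 * t)) (sin (3 * t)))"
  using assms r_fam_regular r_fam_singular by blast

section \<open>The initial sphere as a member of the family\<close>

lemma lim_surf_one:
  assumes "x > 0"
  shows "lim_surf 1 x y = vector [coth (sqrt 3 * x) * exp (- 2 * y), exp y * csch (sqrt 3 * x), chi 1 x y]"
proof -
  have "sinh (sqrt 3 * x) \<noteq> 0" using assms by simp
  hence k: "(coth (sqrt 3 * x) + 1) * exp (- (sqrt 3 * x)) = csch (sqrt 3 * x)"
    using cosh_square_eq[of "sqrt 3 * x"] unfolding cosh_minus_sinh[symmetric]
    by (simp add: coth_def csch_def field_simps power2_eq_square)
  have e: "exp (2 * (- x * (sqrt 3 / 2) + y * (1 / 2))) = exp (- (sqrt 3 * x)) * exp y"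
    by (simp add: algebra_simps flip: exp_add)
  have one: "2 / sqrt 3 * (sqrt 3 / 2) = (1::real)" by simp
  have "- phi (1 * (pi / 6)) x y = (coth (sqrt 3 * x) + 1) * exp (- (sqrt 3 * x)) * exp y"
    unfolding phi_def trig_lim_surf[OF one_power2] e one by (simp add: algebra_simps)
  hence "- phi (1 * (pi / 6)) x y = exp y * csch (sqrt 3 * x)" unfolding k by simp
  moreover have "- phi (- 1 * (pi / 2)) x y = coth (sqrt 3 * x) * exp (- 2 * y)"
    unfolding phi_def trig_lim_surf[OF one_power2] by simp
  ultimately show ?thesis unfolding lim_surf_def by simp
qed

lemma S_iso_eq:
  assumes x: "x > 0"
  shows "S_iso x y = (1 / sqrt 3) *\<^sub>R vector [chi 1 x y,
    - (coth (sqrt 3 * x) * exp (- 2 * y)), - (exp y * csch (sqrt 3 * x))]"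
proof -
  define S where "S = sinh (sqrt 3 * x)"
  have S: "S > 0" using x by (simp add: S_def)
  have lnX: "ln (S\<^sup>2) = 2 * ln S" using S by (simp add: ln_realpow)
  have lnY: "ln (exp y / S) = y - ln S" using S by (simp add: ln_div)
  have c: "sqrt (1 + S\<^sup>2) = cosh (sqrt 3 * x)"
    unfolding S_def using cosh_square_eq[of "sqrt 3 * x"] by (metis add.commute cosh_real_nonneg real_sqrt_unique)
  have pX: "(S\<^sup>2) powr (- 3 / 2) = 1 / S ^ 3"
  proof -
    have "(S\<^sup>2) powr (- 3 / 2) = (S powr 2) powr (- 3 / 2)" using S by simp
    also have "\<dots> = S powr (- 3)" unfolding powr_powr by simp
    finally show ?thesis using S by (simp add: powr_minus_divide)
  qed
  have "exp (- 2 * y) = 1 / (exp y)\<^sup>2"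
    using exp_double[of y] by (simp add: exp_minus inverse_eq_divide)
  hence pY: "(exp y / S) powr (- 2) = S\<^sup>2 * exp (- 2 * y)"
    using S by (simp add: powr_minus_divide power_divide)
  have ch: "chi 1 x y = exp y * (S + 3 * y / S)"
    by (simp add: chi_def csch_def S_def)
  have "3 / 2 * ln (S\<^sup>2) + 3 * ln (exp y / S) + S\<^sup>2 = S\<^sup>2 + 3 * y"
    unfolding lnX lnY by (simp add: algebra_simps)
  hence 1: "- (exp y / S) * (3 / 2 * ln (S\<^sup>2) + 3 * ln (exp y / S) + S\<^sup>2) = - chi 1 x y"
    using S unfolding ch by (simp add: field_simps power2_eq_square)
  have 2: "(S\<^sup>2) powr (- 3 / 2) * (exp y / S) powr (- 2) * sqrt (1 + S\<^sup>2)
      = coth (sqrt 3 * x) * exp (- 2 * y)"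
    unfolding pX pY c coth_def S_def[symmetric]
    using S by (simp add: field_simps power2_eq_square power3_eq_cube)
  have 3: "exp y / S = exp y * csch (sqrt 3 * x)"
    by (simp add: csch_def S_def)
  show ?thesis
    unfolding S_iso_def S_orig_def S_def[symmetric] 1 2 unfolding 3
    by (simp add: vec_eq_iff forall_3)
qed

text \<open>Each coordinate of the sphere is a basis function of \<open>lim_surf 1\<close> up to a factor, and \<open>mat_A\<close> is its frame
  at the base point. So normalizing the limit basis by \<open>mat_A\<close> returns the sphere itself.\<close>

lemma S_iso_invariants: "has_invariants S_iso (Complex 0 1)"
proof (rule normalized_solution[OF lim_surf_solution lim_surf_in_polys det_lim_surf])
  fix x y :: real assume x: "x > 0"
  let ?K = "frame_matrix (lim_surf 1) (lim_surf_x 1) (lim_surf_y 1)"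
  \<comment> \<open>the coordinates of the sphere in terms of the limit basis\<close>
  define C :: "real^3^3" where
    "C = vector [vector [0, 0, 1 / sqrt 3], vector [- 1 / sqrt 3, 0, 0], vector [0, - 1 / sqrt 3, 0]]"
  have "sqrt 6 = sqrt 2 * sqrt (3::real)" by (simp flip: real_sqrt_mult)
  hence A: "mat_A = C ** ?K"
    unfolding frame_matrix_lim_surf[OF one_power2] mat_A_def C_def vec_eq_iff forall_3 matrix_matrix_mult_def
    by (simp add: sum_3)
  have "mat_A *v (matrix_inv ?K *v lim_surf 1 x y) = C *v ((?K ** matrix_inv ?K) *v lim_surf 1 x y)"
    unfolding A by (simp add: matrix_vector_mul_assoc matrix_mul_assoc)
  also have "\<dots> = C *v lim_surf 1 x y"
    using matrix_inv_right[OF det_lim_surf[OF one_power2]] by simp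
  also have "\<dots> = S_iso x y"
    unfolding lim_surf_one[OF x] S_iso_eq[OF x] vec_eq_iff forall_3 matrix_vector_mult_def sum_3 C_def
    by simp
  finally show "S_iso x y = mat_A *v (matrix_inv ?K *v lim_surf 1 x y)" ..
qed simp_all

text \<open>As \<open>t\<close> runs through \<open>[0, 2\<pi>/3]\<close> the coefficient \<open>e\<^sup>3\<^sup>i\<^sup>t\<close> runs through the whole unit circle. The
  coefficient of the given sphere itself is \<open>i\<close>, not \<open>1\<close>.\<close>

lemma S_iso_associated_family:
  "is_associated_family half_plane S_iso (r_fam ` {0..2 * pi / 3})"
proof -
  have *: "\<exists>t\<in>{0..2 * pi / 3}. u = Complex (cos (3 * t)) (sin (3 * t))" if "cmod u = 1" for u
  proof -
    note polar = complex_unimodular_polar[OF that]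
    obtain \<theta> where "0 \<le> \<theta>" "\<theta> < 2 * pi" "u = Complex (cos \<theta>) (sin \<theta>)"
      using polar by blast
    thus ?thesis by (intro bexI[of _ "\<theta> / 3"]) auto
  qed
  have i: "Complex 0 1 = \<i>" by (simp add: complex_eq_iff)
  show ?thesis unfolding is_associated_family_def
  proof (rule exI[of _ "\<lambda>x y. rho x"], rule exI[of _ "- 1"], rule exI[of _ "\<lambda>_ _. Complex 0 1"],
      intro conjI ballI allI impI)
    show "has_invariants S_iso (Complex 0 1)" by (rule S_iso_invariants)
  next
    fix s assume "s \<in> r_fam ` {0..2 * pi / 3}"
    then obtain t where t: "t \<in> {0..2 * pi / 3}" "s = r_fam t" by blast
    let ?\<mu> = "- \<i> * Complex (cos (3 * t)) (sin (3 * t))"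
    have "cmod ?\<mu> = 1" by (simp add: norm_mult cmod_def)
    moreover have "?\<mu> * Complex 0 1 = Complex (cos (3 * t)) (sin (3 * t))"
      by (simp add: complex_eq_iff)
    hence "has_invariants s (?\<mu> * Complex 0 1)"
      using r_fam_invariants[OF t(1)] t(2) by simp
    ultimately show "\<exists>\<mu>. cmod \<mu> = 1 \<and> has_invariants s (\<mu> * Complex 0 1)" by blast
  next
    fix \<mu> assume "cmod \<mu> = 1"
    hence "cmod (\<mu> * Complex 0 1) = 1" by (simp add: norm_mult i)
    from *[OF this] obtain t where t: "t \<in> {0..2 * pi / 3}"
      "\<mu> * Complex 0 1 = Complex (cos (3 * t)) (sin (3 * t))" by blast
    show "\<exists>s\<in>r_fam ` {0..2 * pi / 3}. has_invariants s (\<mu> * Complex 0 1)"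
      using r_fam_invariants[OF t(1)] t by auto
    fix s assume "has_invariants s (\<mu> * Complex 0 1)"
    hence "unimodular_equiv half_plane (r_fam t) s"
      using has_invariants_unique[OF r_fam_invariants[OF t(1)]] t(2) by simp
    thus "\<exists>s'\<in>r_fam ` {0..2 * pi / 3}. unimodular_equiv half_plane s' s"
      using t(1) by blast
  qed
qed

lemma exp_eq_Complex: "exp (3 * \<i> * complex_of_real t) = Complex (cos (3 * t)) (sin (3 * t))"
proof -
  have "3 * \<i> * complex_of_real t = \<i> * complex_of_real (3 * t)" by simp
  thus ?thesis by (metis cis_conv_exp cis.ctr)
qed

section \<open>The initial sphere in its original parameters\<close>

definition quadrant :: "(real \<times> real) set" where
  "quadrant = {0<..} \<times> {0<..}"

lemma quadrant_iff [simp]: "(x, y) \<in> quadrant \<longleftrightarrow> 0 < x \<and> 0 < y"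
  by (simp add: quadrant_def)

lemma open_quadrant: "open quadrant"
  unfolding quadrant_def by (intro open_Times) auto

text \<open>The part of the second coordinate that depends on \<open>x\<close> alone. Its square is rational, and it is an
  eigenfunction of differentiation over the rational functions, which keeps all second order
  quantities rational in \<open>x\<close>, \<open>y\<close> and \<open>profile x\<close>.\<close>

definition profile :: "real \<Rightarrow> real" where
  "profile x = x powr (- 3 / 2) * sqrt (1 + x)"

lemma profile_pos: "x > 0 \<Longrightarrow> profile x > 0"
  by (simp add: profile_def)

lemma profile_squared: 
  assumes "x > 0"
  shows "(profile x)\<^sup>2 = (1 + x) / x ^ 3"
proof -
  have "(x powr (- 3 / 2))\<^sup>2 = x powr (- 3)"
    using assms by (simp add: power2_eq_square flip: powr_add)
  also have "\<dots> = 1 / x ^ 3" using assms by (simp add: powr_minus_divide)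
  finally have "(x powr (- 3 / 2))\<^sup>2 = 1 / x ^ 3" .
  thus ?thesis using assms unfolding profile_def power_mult_distrib by simp
qed

lemma profile_has_derivative:
  assumes "x > 0"
  shows "(profile has_real_derivative - (3 + 2 * x) / (2 * x * (1 + x)) * profile x) (at x)"
proof -
  have r: "sqrt (1 + x) * sqrt (1 + x) = 1 + x" using assms by simp
  have p: "x powr (- 3 / 2 - 1) = x powr (- 3 / 2) / x"
    using powr_diff[of x "- 3 / 2" 1] assms by simp
  have "((\<lambda>x. x powr (- 3 / 2) * sqrt (1 + x)) has_real_derivative
      (- 3 / 2) * x powr (- 3 / 2 - 1) * sqrt (1 + x) + x powr (- 3 / 2) * (inverse (sqrt (1 + x)) / 2)) (at x)"
    using assms by (auto intro!: derivative_eq_intros)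
  also have "inverse (sqrt (1 + x)) = sqrt (1 + x) / (1 + x)"
    using assms by (simp add: field_simps)
  also have "(- 3 / 2) * x powr (- 3 / 2 - 1) * sqrt (1 + x) + x powr (- 3 / 2) * (sqrt (1 + x) / (1 + x) / 2)
     = - (3 + 2 * x) / (2 * x * (1 + x)) * profile x"
  proof -
    have "x \<noteq> 0" "1 + x \<noteq> 0" using assms by auto
    thus ?thesis unfolding p profile_def by (simp add: divide_simps) (simp add: algebra_simps)
  qed
  finally show ?thesis by (simp add: profile_def[abs_def])
qed

definition S_log :: "real \<Rightarrow> real \<Rightarrow> real" where
  "S_log x y = 3 / 2 * ln x + 3 * ln y + x"

lemma S_log_has_derivative:
  assumes "x > 0" "y > 0"
  shows "((\<lambda>s. S_log s y) has_real_derivative (3 + 2 * x) / (2 * x)) (at x)"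
    and "(S_log x has_real_derivative 3 / y) (at y)"
  unfolding S_log_def[abs_def] using assms by (auto intro!: derivative_eq_intros simp: field_simps)

lemma S_orig_eq:
  assumes "x > 0" "y > 0"
  shows "S_orig x y = vector [- y * S_log x y, profile x / y\<^sup>2, y]"
proof -
  have "y powr (- 2) = 1 / y\<^sup>2" using assms by (simp add: powr_minus_divide)
  thus ?thesis by (simp add: S_orig_def S_log_def profile_def)
qed

lemma has_partials_vector3:
  assumes "\<And>x y. (x, y) \<in> \<Omega> \<Longrightarrow> ((\<lambda>s. f1 s y) has_real_derivative g1 x y) (at x)"
    "\<And>x y. (x, y) \<in> \<Omega> \<Longrightarrow> ((\<lambda>s. f1 x s) has_real_derivative h1 x y) (at y)"
    "\<And>x y. (x, y) \<in> \<Omega> \<Longrightarrow> ((\<lambda>s. f2 s y) has_real_derivative g2 x y) (at x)"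
    "\<And>x y. (x, y) \<in> \<Omega> \<Longrightarrow> ((\<lambda>s. f2 x s) has_real_derivative h2 x y) (at y)"
    "\<And>x y. (x, y) \<in> \<Omega> \<Longrightarrow> ((\<lambda>s. f3 s y) has_real_derivative g3 x y) (at x)"
    "\<And>x y. (x, y) \<in> \<Omega> \<Longrightarrow> ((\<lambda>s. f3 x s) has_real_derivative h3 x y) (at y)"
  shows "has_partials \<Omega> (\<lambda>x y. vector [f1 x y, f2 x y, f3 x y] :: real^3)
    (\<lambda>x y. vector [g1 x y, g2 x y, g3 x y]) (\<lambda>x y. vector [h1 x y, h2 x y, h3 x y])"
proof (rule has_partials_vec)
  have "\<forall>i::3. has_partials \<Omega> (\<lambda>x y. vector [f1 x y, f2 x y, f3 x y] $ i)
      (\<lambda>x y. vector [g1 x y, g2 x y, g3 x y] $ i) (\<lambda>x y. vector [h1 x y, h2 x y, h3 x y] $ i)"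
    unfolding forall_3 vector_3 has_partials_def
    using assms by (simp add: has_real_derivative_iff_has_vector_derivative)
  thus "has_partials \<Omega> (\<lambda>x y. vector [f1 x y, f2 x y, f3 x y] $ i)
      (\<lambda>x y. vector [g1 x y, g2 x y, g3 x y] $ i) (\<lambda>x y. vector [h1 x y, h2 x y, h3 x y] $ i)" for i :: 3
    by blast
qed

definition S_x :: surface where
  "S_x x y = vector [- y * ((3 + 2 * x) / (2 * x)), - (3 + 2 * x) / (2 * x * (1 + x)) * profile x / y\<^sup>2, 0]"

definition S_y :: surface where
  "S_y x y = vector [- S_log x y - 3, - 2 * profile x / y ^ 3, 1]"

definition S_xx :: surface where
  "S_xx x y = vector [3 * y / (2 * x\<^sup>2),
     (8 * x\<^sup>2 + 24 * x + 15) / (4 * x\<^sup>2 * (1 + x)\<^sup>2) * profile x / y\<^sup>2, 0]"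

definition S_xy :: surface where
  "S_xy x y = vector [- (3 + 2 * x) / (2 * x), (3 + 2 * x) / (x * (1 + x)) * profile x / y ^ 3, 0]"

definition S_yy :: surface where
  "S_yy x y = vector [- 3 / y, 6 * profile x / y ^ 4, 0]"

lemma S_partials:
  "has_partials quadrant S_orig S_x S_y"
  "has_partials quadrant S_x S_xx S_xy"
  "has_partials quadrant S_y S_xy S_yy"
proof -
  have "has_partials quadrant (\<lambda>x y. vector [- y * S_log x y, profile x / y\<^sup>2, y] :: real^3) S_x S_y"
    unfolding S_x_def[abs_def] S_y_def[abs_def]
    by (rule has_partials_vector3;
        (auto intro!: derivative_eq_intros S_log_has_derivative profile_has_derivative)?;
        (simp add: divide_simps)?; (auto simp: algebra_simps eval_nat_numeral)?)
  thus "has_partials quadrant S_orig S_x S_y"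
    by (rule has_partials_cong[OF _ open_quadrant]) (simp_all add: S_orig_eq)
  show "has_partials quadrant S_x S_xx S_xy"
    unfolding S_x_def[abs_def] S_xx_def[abs_def] S_xy_def[abs_def]
    by (rule has_partials_vector3;
        (auto intro!: derivative_eq_intros S_log_has_derivative profile_has_derivative)?;
        (simp add: divide_simps)?; (auto simp: algebra_simps eval_nat_numeral)?)
  show "has_partials quadrant S_y S_xy S_yy"
    unfolding S_y_def[abs_def] S_xy_def[abs_def] S_yy_def[abs_def]
    by (rule has_partials_vector3;
        (auto intro!: derivative_eq_intros S_log_has_derivative profile_has_derivative)?;
        (simp add: divide_simps)?; (auto simp: algebra_simps eval_nat_numeral)?)
qed


lemma smooth_S_orig: "smooth_map quadrant S_orig"
proof -
  define G :: "(real \<Rightarrow> real \<Rightarrow> real) set" where "G = {\<lambda>x y. y, S_log, \<lambda>x y. profile x, \<lambda>x y. inverse x, \<lambda>x y. inverse y, \<lambda>x y. inverse (1 + x)}"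
  have gen: "(\<lambda>x y. y) \<in> polys_in G" "S_log \<in> polys_in G" "(\<lambda>x y. profile x) \<in> polys_in G"
    "(\<lambda>x y. inverse x) \<in> polys_in G" "(\<lambda>x y. inverse y) \<in> polys_in G" "(\<lambda>x y. inverse (1 + x)) \<in> polys_in G"
    by (rule polys_in.gen, simp add: G_def)+
  note poly = polys_in.const polys_in.add polys_in.mult gen
  have der: "\<exists>u\<in>polys_in G. \<exists>v\<in>polys_in G. has_partials quadrant g u v" if "g \<in> G" for g
  proof -
    have real: "\<exists>u\<in>polys_in G. \<exists>v\<in>polys_in G. has_partials quadrant g u v"
      if "u \<in> polys_in G" "v \<in> polys_in G"
        "\<And>x y. x > 0 \<Longrightarrow> y > 0 \<Longrightarrow> ((\<lambda>s. g s y) has_real_derivative u x y) (at x)"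
        "\<And>x y. x > 0 \<Longrightarrow> y > 0 \<Longrightarrow> ((\<lambda>s. g x s) has_real_derivative v x y) (at y)" for u v
      using that by (intro bexI[of _ u] bexI[of _ v] has_partialsI)
        (simp_all add: has_real_derivative_iff_has_vector_derivative)
    from that consider "g = (\<lambda>x y. y)" | "g = S_log" | "g = (\<lambda>x y. profile x)" | "g = (\<lambda>x y. inverse x)"
      | "g = (\<lambda>x y. inverse y)" | "g = (\<lambda>x y. inverse (1 + x))"
      unfolding G_def by blast
    thus ?thesis
    proof cases
      case 1
      show ?thesis
        by (rule real[of "\<lambda>_ _. 0" "\<lambda>_ _. 1"]) (simp_all add: 1 polys_in.const)
    next
      case 2
      show ?thesis
        by (rule real[of "\<lambda>x y. (3 / 2) * inverse x + 1" "\<lambda>x y. 3 * inverse y"], (intro poly)[1], (intro poly)[1])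
           (use S_log_has_derivative in \<open>auto simp: 2 field_simps\<close>)
    next
      case 3
      have "- (3 + 2 * x) / (2 * x * (1 + x)) = (- 3 / 2) * inverse x + (1 / 2) * inverse (1 + x)"
        if "x > 0" for x :: real
      proof -
        have "x \<noteq> 0" "1 + x \<noteq> 0" using that by auto
        thus ?thesis by (simp add: divide_simps) (simp add: algebra_simps)
      qed
      hence d: "(profile has_real_derivative ((- 3 / 2) * inverse x + (1 / 2) * inverse (1 + x)) * profile x) (at x)"
        if "x > 0" for x using profile_has_derivative[OF that] that by simp
      show ?thesis
        by (rule real[of "\<lambda>x y. ((- 3 / 2) * inverse x + (1 / 2) * inverse (1 + x)) * profile x" "\<lambda>_ _. 0"], (intro poly)[1], (intro poly)[1])
           (use d in \<open>simp_all add: 3\<close>)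
    next
      case 4
      show ?thesis
        by (rule real[of "\<lambda>x y. (- 1) * (inverse x * inverse x)" "\<lambda>_ _. 0"], (intro poly)[1], (intro poly)[1])
           (auto simp: 4 power2_eq_square intro!: derivative_eq_intros)
    next
      case 5
      show ?thesis
        by (rule real[of "\<lambda>_ _. 0" "\<lambda>x y. (- 1) * (inverse y * inverse y)"], (intro poly)[1], (intro poly)[1])
           (auto simp: 5 power2_eq_square intro!: derivative_eq_intros)
    next
      case 6
      show ?thesis
        by (rule real[of "\<lambda>x y. (- 1) * (inverse (1 + x) * inverse (1 + x))" "\<lambda>_ _. 0"], (intro poly)[1], (intro poly)[1])
           (auto simp: 6 power2_eq_square intro!: derivative_eq_intros)
    qed
  qed
  have cont: "continuous_on quadrant (\<lambda>(x, y). g x y)" if "g \<in> G" for g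
    using that unfolding G_def S_log_def[abs_def] profile_def[abs_def]
    by (auto simp: case_prod_unfold quadrant_def intro!: continuous_intros)
  have "smooth_map quadrant (\<lambda>x y. vector [(- 1) * (y * S_log x y), profile x * (inverse y * inverse y), y] :: real^3)"
  proof (rule smooth_map_polys[OF open_quadrant cont der])
    have "\<forall>i::3. (\<lambda>x y. vector [(- 1) * (y * S_log x y), profile x * (inverse y * inverse y), y] $ i) \<in> polys_in G"
      unfolding forall_3 vector_3 by (intro conjI poly)
    thus "(\<lambda>x y. vector [(- 1) * (y * S_log x y), profile x * (inverse y * inverse y), y] $ i) \<in> polys_in G" for i :: 3
      by blast
  qed
  thus ?thesis
    by (rule smooth_map_cong[OF open_quadrant])
       (simp add: S_orig_eq power2_eq_square divide_inverse)
qed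

lemma S_orig_pd:
  assumes "(x, y) \<in> quadrant"
  shows "pdx S_orig x y = S_x x y" "pdy S_orig x y = S_y x y"
    "pdx (pdx S_orig) x y = S_xx x y" "pdy (pdx S_orig) x y = S_xy x y" "pdy (pdy S_orig) x y = S_yy x y"
proof -
  note pd = has_partials_pd[OF S_partials(1)]
  show "pdx S_orig x y = S_x x y" "pdy S_orig x y = S_y x y" using pd assms by auto
  have "has_partials quadrant (pdx S_orig) S_xx S_xy" "has_partials quadrant (pdy S_orig) S_xy S_yy"
    by (rule has_partials_cong[OF S_partials(2) open_quadrant], simp_all add: pd)
       (rule has_partials_cong[OF S_partials(3) open_quadrant], simp_all add: pd)
  thus "pdx (pdx S_orig) x y = S_xx x y" "pdy (pdx S_orig) x y = S_xy x y" "pdy (pdy S_orig) x y = S_yy x y"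
    using has_partials_pd assms by blast+
qed

lemma S_orig_second_form:
  assumes "(x, y) \<in> quadrant"
  shows "coef_L S_orig x y = profile x * (3 + 2 * x)\<^sup>2 * (4 * x + 3) / (8 * y * x ^ 3 * (1 + x)\<^sup>2)"
    "coef_M S_orig x y = 3 * profile x * (3 + 2 * x)\<^sup>2 / (4 * x\<^sup>2 * (1 + x) * y\<^sup>2)"
    "coef_N S_orig x y = 3 * profile x * (3 + 2 * x)\<^sup>2 / (2 * x * y ^ 3 * (1 + x))"
proof -
  have n: "x \<noteq> 0" "y \<noteq> 0" "1 + x \<noteq> 0" using assms by auto
  show "coef_L S_orig x y = profile x * (3 + 2 * x)\<^sup>2 * (4 * x + 3) / (8 * y * x ^ 3 * (1 + x)\<^sup>2)"
    "coef_M S_orig x y = 3 * profile x * (3 + 2 * x)\<^sup>2 / (4 * x\<^sup>2 * (1 + x) * y\<^sup>2)"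
    "coef_N S_orig x y = 3 * profile x * (3 + 2 * x)\<^sup>2 / (2 * x * y ^ 3 * (1 + x))"
    unfolding coef_L_def coef_M_def coef_N_def S_orig_pd[OF assms] det_vec_expand
      S_x_def S_y_def S_xx_def S_xy_def S_yy_def vector_3
    using n by (simp_all add: divide_simps) (simp_all add: algebra_simps eval_nat_numeral)
qed

text \<open>The homothety with factor \<open>-\<surd>3\<close>, which leads from the isothermal form of the sphere back to the
  original one, multiplies the affine metric by this constant and divides the affine mean
  curvature \<open>-1\<close> by it.\<close>

definition metric_const :: real where
  "metric_const = 3 powr (3 / 4)"

lemma metric_const: "metric_const > 1" "metric_const ^ 4 = 27"
proof -
  show "metric_const > 1" unfolding metric_const_def by (rule gr_one_powr) auto
  have "metric_const ^ 4 = metric_const powr 4" by (simp add: metric_const_def)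
  also have "\<dots> = 3 powr 3" unfolding metric_const_def powr_powr by simp
  finally show "metric_const ^ 4 = 27" by simp
qed

text \<open>The area density of the affine metric. The affine normalization makes it the fourth root of
  \<open>L N - M\<^sup>2\<close>.\<close>

definition S_area :: "real \<Rightarrow> real \<Rightarrow> real" where
  "S_area x y = 3 * profile x * (3 + 2 * x) / (2 * metric_const * (1 + x) * y)"

lemma S_area_pos: "(x, y) \<in> quadrant \<Longrightarrow> S_area x y > 0"
  unfolding S_area_def using profile_pos[of x] metric_const(1)
  by (intro divide_pos_pos mult_pos_pos) auto

lemma S_orig_discriminant:
  assumes "(x, y) \<in> quadrant"
  shows "coef_L S_orig x y * coef_N S_orig x y - (coef_M S_orig x y)\<^sup>2 = S_area x y ^ 4"
proof -
  have n: "x \<noteq> 0" "y \<noteq> 0" "1 + x \<noteq> 0" using assms by auto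
  have v: "(profile x)\<^sup>2 = (1 + x) / x ^ 3" using profile_squared assms by simp
  have "coef_L S_orig x y * coef_N S_orig x y - (coef_M S_orig x y)\<^sup>2
      = (profile x)\<^sup>2 * (3 * (3 + 2 * x) ^ 4 / (16 * x ^ 3 * (1 + x) ^ 3 * y ^ 4))"
    unfolding S_orig_second_form[OF assms] using n
    by (simp add: divide_simps) (simp add: algebra_simps eval_nat_numeral)
  also have "\<dots> = 81 * ((profile x)\<^sup>2)\<^sup>2 * (3 + 2 * x) ^ 4 / (16 * 27 * (1 + x) ^ 4 * y ^ 4)"
    unfolding v using n by (simp add: divide_simps) (simp add: algebra_simps eval_nat_numeral)
  also have "\<dots> = S_area x y ^ 4"
    unfolding S_area_def power_divide power_mult_distrib metric_const(2) by simp
  finally show ?thesis .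
qed

lemma S_orig_metric:
  assumes "(x, y) \<in> quadrant"
  shows "affine_E S_orig x y = metric_const * (3 + 2 * x) * (4 * x + 3) / (12 * x ^ 3 * (1 + x))"
    "affine_F S_orig x y = metric_const * (3 + 2 * x) / (2 * x\<^sup>2 * y)"
    "affine_G S_orig x y = metric_const * (3 + 2 * x) / (x * y\<^sup>2)"
proof -
  have n: "x > 0" "y > 0" "1 + x \<noteq> 0" "profile x \<noteq> 0" "metric_const \<noteq> 0" "3 + 2 * x \<noteq> 0"
    using assms profile_pos[of x] metric_const(1) by auto
  have "coef_L S_orig x y > 0"
    unfolding S_orig_second_form[OF assms] using n(1,2) profile_pos[of x]
    by (intro divide_pos_pos mult_pos_pos zero_less_power) auto
  moreover have "(S_area x y ^ 4) powr (1 / 4) = S_area x y"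
    using S_area_pos[OF assms] by (simp add: powr_powr flip: powr_numeral)
  ultimately have sc: "metric_scale S_orig x y = 1 / S_area x y"
    unfolding metric_scale_def S_orig_discriminant[OF assms] using S_area_pos[OF assms] by simp
  show "affine_E S_orig x y = metric_const * (3 + 2 * x) * (4 * x + 3) / (12 * x ^ 3 * (1 + x))"
    "affine_F S_orig x y = metric_const * (3 + 2 * x) / (2 * x\<^sup>2 * y)"
    "affine_G S_orig x y = metric_const * (3 + 2 * x) / (x * y\<^sup>2)"
    unfolding affine_E_def affine_F_def affine_G_def sc S_orig_second_form[OF assms] S_area_def using n
    by (simp_all add: divide_simps) (simp_all add: algebra_simps eval_nat_numeral)
qed

lemma pd_eqI:
  assumes "open \<Omega>" "(x, y) \<in> \<Omega>" "\<And>x y. (x, y) \<in> \<Omega> \<Longrightarrow> f x y = f' x y"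
  shows "((\<lambda>s. f s y) has_vector_derivative D) (at x) \<Longrightarrow> pdx f' x y = D"
    and "((\<lambda>s. f x s) has_vector_derivative D) (at y) \<Longrightarrow> pdy f' x y = D"
proof -
  assume "((\<lambda>s. f s y) has_vector_derivative D) (at x)"
  hence "((\<lambda>s. f' s y) has_vector_derivative D) (at x)"
    by (rule has_vector_derivative_transform_within_open[OF _ open_sections(1)[OF assms(1), of y]])
       (use assms in auto)
  thus "pdx f' x y = D" by (simp add: pdx_def vector_derivative_at)
next
  assume "((\<lambda>s. f x s) has_vector_derivative D) (at y)"
  hence "((\<lambda>s. f' x s) has_vector_derivative D) (at y)"
    by (rule has_vector_derivative_transform_within_open[OF _ open_sections(2)[OF assms(1), of x]])
       (use assms in auto)
  thus "pdy f' x y = D" by (simp add: pdy_def vector_derivative_at)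
qed

lemma has_vector_derivative_vector3:
  assumes "(f1 has_real_derivative g1) (at x)" "(f2 has_real_derivative g2) (at x)"
    "(f3 has_real_derivative g3) (at x)"
  shows "((\<lambda>s. vector [f1 s, f2 s, f3 s] :: real^3) has_vector_derivative vector [g1, g2, g3]) (at x)"
proof (rule has_vector_derivative_vec)
  have "\<forall>i::3. ((\<lambda>s. vector [f1 s, f2 s, f3 s] $ i) has_vector_derivative vector [g1, g2, g3] $ i) (at x)"
    unfolding forall_3 vector_3
    using assms by (simp add: has_real_derivative_iff_has_vector_derivative)
  thus "((\<lambda>s. vector [f1 s, f2 s, f3 s] $ i) has_vector_derivative vector [g1, g2, g3] $ i) (at x)" for i :: 3
    by blast
qed

text \<open>The two fields under the divergence in the Laplacian simplify to \<open>P'\<close> and \<open>Q'\<close> once \<open>1 / profile x\<close> is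
  replaced by \<open>profile x * x\<^sup>3 / (1 + x)\<close>; their divergence is a multiple of the position vector.\<close>

lemma S_orig_normal:
  assumes xy: "(x, y) \<in> quadrant"
  shows "affine_normal S_orig x y = (1 / metric_const) *\<^sub>R S_orig x y"
proof -
  define W where "W = (\<lambda>x y. sqrt (affine_E S_orig x y * affine_G S_orig x y - (affine_F S_orig x y)\<^sup>2))"
  define P where "P = (\<lambda>x y. (1 / W x y) *\<^sub>R
    (affine_G S_orig x y *\<^sub>R pdx S_orig x y - affine_F S_orig x y *\<^sub>R pdy S_orig x y))"
  define Q where "Q = (\<lambda>x y. (1 / W x y) *\<^sub>R
    (affine_E S_orig x y *\<^sub>R pdy S_orig x y - affine_F S_orig x y *\<^sub>R pdx S_orig x y))"
  define k where "k = metric_const\<^sup>2"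
  \<comment> \<open>closed forms of the two fields on the quadrant, free of quotients by \<open>profile\<close>\<close>
  define P' :: surface where "P' = (\<lambda>x y. vector [k / 3 * (x * profile x * (S_log x y - 2 * x)),
      - (k / 3) / (x\<^sup>2 * y ^ 3), - (k / 3) * (x * profile x)])"
  define Q' :: surface where "Q' = (\<lambda>x y. vector [k / 18 * (profile x * y / (1 + x) * (- (4 * x + 3) * S_log x y + 3 * x + 6 * x\<^sup>2)),
      k / 18 * ((3 - 2 * x) / (x ^ 3 * y\<^sup>2)), k / 18 * ((4 * x + 3) * profile x * y / (1 + x))])"
  have W: "W x y = S_area x y"
    and GW: "affine_G S_orig x y / W x y = 2 * k / 3 * (x\<^sup>2 * profile x / y)"
    and FW: "affine_F S_orig x y / W x y = k / 3 * (x * profile x)"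
    and EW: "affine_E S_orig x y / W x y = k / 18 * ((4 * x + 3) * y * profile x / (1 + x))"
    if xy: "(x, y) \<in> quadrant" for x y
  proof -
    have n: "x \<noteq> 0" "y \<noteq> 0" "1 + x \<noteq> 0" "profile x \<noteq> 0" "metric_const \<noteq> 0" "3 + 2 * x \<noteq> 0"
      using xy profile_pos[of x] metric_const(1) by auto
    have v: "(profile x)\<^sup>2 = (1 + x) / x ^ 3" using profile_squared xy by simp
    have c: "metric_const\<^sup>2 = 27 / metric_const\<^sup>2" using metric_const(2) n(5) by (simp add: eq_divide_eq flip: power_add)
    have "affine_E S_orig x y * affine_G S_orig x y - (affine_F S_orig x y)\<^sup>2
        = metric_const\<^sup>2 * (3 + 2 * x)\<^sup>2 / (12 * x ^ 4 * (1 + x) * y\<^sup>2) * x"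
      unfolding S_orig_metric[OF xy] using n
      by (simp add: divide_simps) (simp add: algebra_simps eval_nat_numeral)
    also have "\<dots> = 27 / metric_const\<^sup>2 * (3 + 2 * x)\<^sup>2 / (12 * x ^ 4 * (1 + x) * y\<^sup>2) * x"
      by (subst c) (rule refl)
    also have "\<dots> = (3 / 2)\<^sup>2 * (profile x)\<^sup>2 * (3 + 2 * x)\<^sup>2 / (metric_const\<^sup>2 * (1 + x)\<^sup>2 * y\<^sup>2)"
      unfolding v using n
      by (simp add: divide_simps) (simp add: algebra_simps eval_nat_numeral)
    also have "\<dots> = (S_area x y)\<^sup>2"
      unfolding S_area_def by (simp add: power_divide power_mult_distrib)
    finally show W: "W x y = S_area x y" using S_area_pos[OF xy] by (simp add: W_def)
    have inv: "1 / profile x = profile x * x ^ 3 / (1 + x)"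
      using v n by (simp add: field_simps power2_eq_square)
    have Winv: "1 / W x y = 2 * metric_const * (1 + x) * y / (3 * (3 + 2 * x)) * (1 / profile x)"
      unfolding W S_area_def by simp
    have d: "a / W x y = a * (1 / W x y)" for a by simp
    show "affine_G S_orig x y / W x y = 2 * k / 3 * (x\<^sup>2 * profile x / y)"
      "affine_F S_orig x y / W x y = k / 3 * (x * profile x)"
      "affine_E S_orig x y / W x y = k / 18 * ((4 * x + 3) * y * profile x / (1 + x))"
      unfolding d[of "affine_E S_orig x y"] d[of "affine_F S_orig x y"] d[of "affine_G S_orig x y"]
      unfolding Winv inv S_orig_metric[OF xy] k_def using n
      by (simp_all add: divide_simps) (simp_all add: algebra_simps eval_nat_numeral)
  qed
  have PQ: "P' x y = P x y" "Q' x y = Q x y" if xy: "(x, y) \<in> quadrant" for x y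
  proof -
    have n: "x \<noteq> 0" "y \<noteq> 0" "1 + x \<noteq> 0" using xy by auto
    have v: "(profile x)\<^sup>2 = (1 + x) / x ^ 3" using profile_squared xy by simp
    have "2 * k / 3 * (x\<^sup>2 * profile x / y) * (- (3 + 2 * x) / (2 * x * (1 + x)) * profile x / y\<^sup>2)
        - k / 3 * (x * profile x) * (- 2 * profile x / y ^ 3) = (profile x)\<^sup>2 * (- (k / 3) * x / (y ^ 3 * (1 + x)))"
      using n by (simp add: divide_simps) (simp add: algebra_simps eval_nat_numeral)
    also have "\<dots> = - (k / 3) / (x\<^sup>2 * y ^ 3)"
      unfolding v using n by (simp add: divide_simps) (simp add: algebra_simps eval_nat_numeral)
    finally have P2: "2 * k / 3 * (x\<^sup>2 * profile x / y) * (- (3 + 2 * x) / (2 * x * (1 + x)) * profile x / y\<^sup>2)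
        - k / 3 * (x * profile x) * (- 2 * profile x / y ^ 3) = - (k / 3) / (x\<^sup>2 * y ^ 3)" .
    have "k / 18 * ((4 * x + 3) * y * profile x / (1 + x)) * (- 2 * profile x / y ^ 3)
        - k / 3 * (x * profile x) * (- (3 + 2 * x) / (2 * x * (1 + x)) * profile x / y\<^sup>2)
        = (profile x)\<^sup>2 * (k / 18 * (3 - 2 * x) / (y\<^sup>2 * (1 + x)))"
      using n by (simp add: divide_simps) (simp add: algebra_simps eval_nat_numeral)
    also have "\<dots> = k / 18 * ((3 - 2 * x) / (x ^ 3 * y\<^sup>2))"
      unfolding v using n by (simp add: divide_simps)
    finally have Q2: "k / 18 * ((4 * x + 3) * y * profile x / (1 + x)) * (- 2 * profile x / y ^ 3)
        - k / 3 * (x * profile x) * (- (3 + 2 * x) / (2 * x * (1 + x)) * profile x / y\<^sup>2)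
        = k / 18 * ((3 - 2 * x) / (x ^ 3 * y\<^sup>2))" .
    have "P x y = (2 * k / 3 * (x\<^sup>2 * profile x / y)) *\<^sub>R S_x x y - (k / 3 * (x * profile x)) *\<^sub>R S_y x y"
      unfolding GW[OF xy, symmetric] FW[OF xy, symmetric] P_def S_orig_pd[OF xy]
      by (simp add: scaleR_diff_right)
    also have "\<dots> = P' x y"
      unfolding vec_eq_iff forall_3 P'_def S_x_def S_y_def vector_3 vector_minus_component vector_scaleR_component
      using n by (intro conjI; (simp only: real_scaleR_def P2)?; (simp add: divide_simps)?; (simp add: algebra_simps eval_nat_numeral)?)
    finally show "P' x y = P x y" ..
    have "Q x y = (k / 18 * ((4 * x + 3) * y * profile x / (1 + x))) *\<^sub>R S_y x y - (k / 3 * (x * profile x)) *\<^sub>R S_x x y"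
      unfolding EW[OF xy, symmetric] FW[OF xy, symmetric] Q_def S_orig_pd[OF xy]
      by (simp add: scaleR_diff_right)
    also have "\<dots> = Q' x y"
      unfolding vec_eq_iff forall_3 Q'_def S_x_def S_y_def vector_3 vector_minus_component vector_scaleR_component
      using n by (intro conjI; (simp only: real_scaleR_def Q2)?; (simp add: divide_simps)?; (simp add: algebra_simps eval_nat_numeral)?)
    finally show "Q' x y = Q x y" ..
  qed
  have n: "x > 0" "y > 0" "x \<noteq> 0" "y \<noteq> 0" "1 + x \<noteq> 0" using xy by auto
  have "pdx P x y = vector [k / 3 * (profile x * ((S_log x y - 2 * x) - (3 + 2 * x) / (2 * (1 + x)) * (S_log x y - 2 * x)
        + (3 - 2 * x) / 2)), 2 * k / 3 / (x ^ 3 * y ^ 3), k / 6 * (profile x / (1 + x))]"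
    by (rule pd_eqI(1)[OF open_quadrant xy PQ(1)], assumption, unfold P'_def, rule has_vector_derivative_vector3)
       (auto intro!: derivative_eq_intros profile_has_derivative S_log_has_derivative n,
         (use n in \<open>simp add: divide_simps\<close>; simp add: algebra_simps eval_nat_numeral)+)
  moreover have "pdy Q x y = vector [k / 18 * (profile x / (1 + x) * (- (4 * x + 3) * S_log x y - 3 * (4 * x + 3) + 3 * x + 6 * x\<^sup>2)),
        - (k / 9) * ((3 - 2 * x) / (x ^ 3 * y ^ 3)), k / 18 * ((4 * x + 3) * profile x / (1 + x))]"
    by (rule pd_eqI(2)[OF open_quadrant xy PQ(2)], assumption, unfold Q'_def, rule has_vector_derivative_vector3)
       (auto intro!: derivative_eq_intros profile_has_derivative S_log_has_derivative n,
         (use n in \<open>simp add: divide_simps\<close>; simp add: algebra_simps eval_nat_numeral)+)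
  ultimately have "pdx P x y + pdy Q x y = (k / 9 * profile x * (3 + 2 * x) / ((1 + x) * y)) *\<^sub>R S_orig x y"
  proof -
    assume P: "pdx P x y = vector [k / 3 * (profile x * ((S_log x y - 2 * x) - (3 + 2 * x) / (2 * (1 + x)) * (S_log x y - 2 * x)
        + (3 - 2 * x) / 2)), 2 * k / 3 / (x ^ 3 * y ^ 3), k / 6 * (profile x / (1 + x))]"
      and Q: "pdy Q x y = vector [k / 18 * (profile x / (1 + x) * (- (4 * x + 3) * S_log x y - 3 * (4 * x + 3) + 3 * x + 6 * x\<^sup>2)),
        - (k / 9) * ((3 - 2 * x) / (x ^ 3 * y ^ 3)), k / 18 * ((4 * x + 3) * profile x / (1 + x))]"
    have v: "(profile x)\<^sup>2 = (1 + x) / x ^ 3" using profile_squared n by simp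
    have "2 * k / 3 / (x ^ 3 * y ^ 3) + - (k / 9) * ((3 - 2 * x) / (x ^ 3 * y ^ 3))
        = k / 9 * ((1 + x) / x ^ 3) * (3 + 2 * x) / ((1 + x) * y ^ 3)"
      using n by (simp add: divide_simps) (simp add: algebra_simps eval_nat_numeral)
    also have "\<dots> = k / 9 * profile x * (3 + 2 * x) / ((1 + x) * y) * (profile x / y\<^sup>2)"
      unfolding v[symmetric] using n by (simp add: power2_eq_square power3_eq_cube ac_simps)
    finally have 2: "2 * k / 3 / (x ^ 3 * y ^ 3) + - (k / 9) * ((3 - 2 * x) / (x ^ 3 * y ^ 3))
        = k / 9 * profile x * (3 + 2 * x) / ((1 + x) * y) * (profile x / y\<^sup>2)" .
    show ?thesis
      unfolding P Q S_orig_eq[OF n(1,2)] vec_eq_iff forall_3 vector_3 vector_add_component vector_scaleR_component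
      using n by (intro conjI; (simp only: real_scaleR_def 2)?; (simp add: divide_simps)?; (simp add: algebra_simps eval_nat_numeral)?)
  qed
  moreover have "affine_normal S_orig x y = (1 / 2) *\<^sub>R ((1 / W x y) *\<^sub>R (pdx P x y + pdy Q x y))"
    unfolding affine_normal_def laplace_beltrami_def Let_def P_def Q_def W_def ..
  moreover have "1 / 2 * (1 / W x y * (k / 9 * profile x * (3 + 2 * x) / ((1 + x) * y))) = 1 / metric_const"
  proof -
    have "1 / 2 * (1 / W x y * (k / 9 * profile x * (3 + 2 * x) / ((1 + x) * y))) = metric_const * k / 27"
      unfolding W[OF xy] S_area_def using n profile_pos[OF n(1)] metric_const(1)
      by (simp add: divide_simps)
    also have "\<dots> = metric_const ^ 4 / (27 * metric_const)" unfolding k_def using metric_const(1) by (simp add: eval_nat_numeral)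
    finally show ?thesis unfolding metric_const(2) by simp
  qed
  ultimately show ?thesis by simp
qed

lemma S_orig_proper_affine_sphere: "proper_affine_sphere quadrant S_orig (- (1 / metric_const))"
proof -
  have "0 < coef_L S_orig x y * coef_N S_orig x y - (coef_M S_orig x y)\<^sup>2"
    if "(x, y) \<in> quadrant" for x y
    unfolding S_orig_discriminant[OF that] by (rule zero_less_power[OF S_area_pos[OF that]])
  hence "locally_strictly_convex quadrant S_orig"
    unfolding locally_strictly_convex_def by blast
  moreover have "\<forall>(x, y)\<in>quadrant. affine_normal S_orig x y = - (- (1 / metric_const)) *\<^sub>R S_orig x y"
    using S_orig_normal by auto
  moreover have "- (1 / metric_const) \<noteq> 0" using metric_const(1) by simp
  ultimately show ?thesis unfolding proper_affine_sphere_def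
    using open_quadrant smooth_S_orig by blast
qed

section \<open>Completeness of the metric of the initial sphere\<close>

definition metric_norm ::
  "(real \<Rightarrow> real \<Rightarrow> real) \<Rightarrow> (real \<Rightarrow> real \<Rightarrow> real) \<Rightarrow> (real \<Rightarrow> real \<Rightarrow> real) \<Rightarrow>
   real \<times> real \<Rightarrow> real \<times> real \<Rightarrow> real" where
  "metric_norm E F G p v = sqrt (E (fst p) (snd p) * (fst v)\<^sup>2
     + 2 * F (fst p) (snd p) * fst v * snd v + G (fst p) (snd p) * (snd v)\<^sup>2)"

lemma curve_length_metric_norm:
  "curve_length E F G \<gamma> = integral {0..1} (\<lambda>s. metric_norm E F G (\<gamma> s) (vector_derivative \<gamma> (at s)))"
  by (simp add: curve_length_def metric_norm_def case_prod_unfold Let_def)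

locale plane_metric =
  fixes \<Omega> :: "(real \<times> real) set" and E F G :: "real \<Rightarrow> real \<Rightarrow> real"
  assumes op: "open \<Omega>" and conv: "convex \<Omega>"
    and cont: "continuous_on \<Omega> (\<lambda>(x, y). E x y)" "continuous_on \<Omega> (\<lambda>(x, y). F x y)"
      "continuous_on \<Omega> (\<lambda>(x, y). G x y)"
begin

abbreviation "mnorm \<equiv> metric_norm E F G"

abbreviation "paths p q \<equiv>
  {\<gamma>. \<gamma> C1_differentiable_on {0..1} \<and> \<gamma> ` {0..1} \<subseteq> \<Omega> \<and> \<gamma> 0 = p \<and> \<gamma> 1 = q}"

lemma integrable_speed:
  assumes "\<gamma> C1_differentiable_on {0..1}" "\<gamma> ` {0..1} \<subseteq> \<Omega>"
  shows "(\<lambda>s. mnorm (\<gamma> s) (vector_derivative \<gamma> (at s))) integrable_on {0..1}"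
proof (rule integrable_continuous_real)
  have c: "continuous_on {0..1} \<gamma>" by (rule C1_differentiable_imp_continuous_on[OF assms(1)])
  have d: "continuous_on {0..1} (\<lambda>s. vector_derivative \<gamma> (at s))"
    using assms(1) by (simp add: C1_differentiable_on_eq)
  have "continuous_on {0..1} (\<lambda>s. f (fst (\<gamma> s)) (snd (\<gamma> s)))"
    if "continuous_on \<Omega> (\<lambda>(x, y). f x y)" for f :: "real \<Rightarrow> real \<Rightarrow> real"
    using continuous_on_compose2[OF that c assms(2)] by (simp add: case_prod_unfold)
  note this[OF cont(1)] this[OF cont(2)] this[OF cont(3)]
  thus "continuous_on {0..1} (\<lambda>s. mnorm (\<gamma> s) (vector_derivative \<gamma> (at s)))"
    unfolding metric_norm_def by (intro continuous_intros d)
qed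

text \<open>A function whose differential is bounded by the metric norm varies along a curve by at most
  the length of the curve.\<close>

lemma variation_le_length:
  fixes h :: "real \<times> real \<Rightarrow> real"
  assumes \<gamma>: "\<gamma> C1_differentiable_on {0..1}" "\<gamma> ` {0..1} \<subseteq> \<Omega>"
    and h: "\<And>p. p \<in> \<Omega> \<Longrightarrow> (h has_derivative h' p) (at p)"
    and bound: "\<And>p v. p \<in> \<Omega> \<Longrightarrow> \<bar>h' p v\<bar> \<le> mnorm p v"
  shows "\<bar>h (\<gamma> 1) - h (\<gamma> 0)\<bar> \<le> curve_length E F G \<gamma>"
proof -
  let ?d = "\<lambda>s. vector_derivative \<gamma> (at s)"
  have "((h \<circ> \<gamma>) has_vector_derivative h' (\<gamma> s) (?d s)) (at s within {0..1})" if "s \<in> {0..1}" for s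
  proof (rule vector_derivative_diff_chain_within)
    have "(\<gamma> has_vector_derivative ?d s) (at s)"
      using \<gamma>(1) that by (simp add: C1_differentiable_on_eq vector_derivative_works)
    thus "(\<gamma> has_vector_derivative ?d s) (at s within {0..1})"
      by (rule has_vector_derivative_at_within)
    show "(h has_derivative h' (\<gamma> s)) (at (\<gamma> s) within \<gamma> ` {0..1})"
      using h \<gamma>(2) that has_derivative_at_withinI by blast
  qed
  hence I: "((\<lambda>s. h' (\<gamma> s) (?d s)) has_integral (h \<circ> \<gamma>) 1 - (h \<circ> \<gamma>) 0) {0..1}"
    by (rule fundamental_theorem_of_calculus[OF zero_le_one])
  have "norm (integral {0..1} (\<lambda>s. h' (\<gamma> s) (?d s))) \<le> integral {0..1} (\<lambda>s. mnorm (\<gamma> s) (?d s))"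
  proof (rule integral_norm_bound_integral)
    show "norm (h' (\<gamma> s) (?d s)) \<le> mnorm (\<gamma> s) (?d s)" if "s \<in> {0..1}" for s
      using bound[of "\<gamma> s" "?d s"] \<gamma>(2) that by (simp add: image_subset_iff)
  qed (rule has_integral_integrable[OF I], rule integrable_speed[OF \<gamma>])
  thus ?thesis using integral_unique[OF I] by (simp add: curve_length_metric_norm)
qed

lemma variation_le_length_zero:
  assumes \<gamma>: "\<gamma> C1_differentiable_on {0..1}" "\<gamma> ` {0..1} \<subseteq> \<Omega>"
    and h: "\<And>p v. p \<in> \<Omega> \<Longrightarrow> 0 \<le> mnorm p v"
  shows "0 \<le> curve_length E F G \<gamma>"
  using variation_le_length[OF \<gamma>, of "\<lambda>_. 0" "\<lambda>_ _. 0"] h by simp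

definition seg :: "real \<times> real \<Rightarrow> real \<times> real \<Rightarrow> real \<Rightarrow> real \<times> real" where
  "seg p q s = p + s *\<^sub>R (q - p)"

lemma seg_derivative: "(seg p q has_vector_derivative q - p) (at s)"
  unfolding seg_def[abs_def] by (auto intro!: derivative_eq_intros)

lemma seg_path:
  assumes "convex S" "p \<in> S" "q \<in> S"
  shows "seg p q C1_differentiable_on {0..1}" "seg p q ` {0..1} \<subseteq> S" "seg p q 0 = p" "seg p q 1 = q"
proof -
  show "seg p q C1_differentiable_on {0..1}"
    unfolding C1_differentiable_on_def
    by (rule exI[of _ "\<lambda>_. q - p"]) (simp add: seg_derivative)
  have "seg p q s \<in> S" if "s \<in> {0..1}" for s
  proof -
    have "seg p q s = (1 - s) *\<^sub>R p + s *\<^sub>R q" by (simp add: seg_def algebra_simps)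
    thus ?thesis using assms that by (simp add: convexD_alt)
  qed
  thus "seg p q ` {0..1} \<subseteq> S" by blast
  show "seg p q 0 = p" "seg p q 1 = q" by (simp_all add: seg_def)
qed

lemma riem_dist_INF: "riem_dist \<Omega> E F G p q = (INF \<gamma>\<in>paths p q. curve_length E F G \<gamma>)"
  unfolding riem_dist_def by (rule arg_cong[of _ _ Inf]) blast

lemma riem_dist_ge:
  fixes h :: "real \<times> real \<Rightarrow> real"
  assumes "p \<in> \<Omega>" "q \<in> \<Omega>"
    and h: "\<And>p. p \<in> \<Omega> \<Longrightarrow> (h has_derivative h' p) (at p)"
    and bound: "\<And>p v. p \<in> \<Omega> \<Longrightarrow> \<bar>h' p v\<bar> \<le> mnorm p v"
  shows "\<bar>h q - h p\<bar> \<le> riem_dist \<Omega> E F G p q"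
  unfolding riem_dist_INF
proof (rule cINF_greatest)
  show "paths p q \<noteq> {}" using seg_path[OF conv assms(1,2)] by blast
  fix \<gamma> assume "\<gamma> \<in> paths p q"
  thus "\<bar>h q - h p\<bar> \<le> curve_length E F G \<gamma>"
    using variation_le_length[OF _ _ h bound, of \<gamma>] by auto
qed

text \<open>The distance is at most the length of the straight segment, which stays in the convex set \<open>S\<close>.\<close>

lemma riem_dist_le:
  assumes nonneg: "\<And>p v. p \<in> \<Omega> \<Longrightarrow> 0 \<le> mnorm p v"
    and S: "convex S" "S \<subseteq> \<Omega>" "p \<in> S" "q \<in> S" and C: "\<And>z v. z \<in> S \<Longrightarrow> mnorm z v \<le> C * norm v"
  shows "riem_dist \<Omega> E F G p q \<le> C * norm (q - p)"
proof -
  note seg = seg_path[OF S(1,3,4)]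
  have *: "seg p q ` {0..1} \<subseteq> \<Omega>" using seg(2) S(2) by blast
  have "riem_dist \<Omega> E F G p q \<le> curve_length E F G (seg p q)"
    unfolding riem_dist_INF
    by (rule cINF_lower)
       (use variation_le_length_zero nonneg seg * in \<open>auto intro!: bdd_belowI2[of _ 0]\<close>)
  also have "\<dots> \<le> integral {0..1} (\<lambda>s::real. C * norm (q - p))"
    unfolding curve_length_metric_norm
  proof (rule integral_le[OF integrable_speed[OF seg(1) *]])
    show "mnorm (seg p q s) (vector_derivative (seg p q) (at s)) \<le> C * norm (q - p)"
      if "s \<in> {0..1}" for s
      unfolding vector_derivative_at[OF seg_derivative]
      by (rule C) (use seg(2) that in blast)
  qed (rule integrable_const_ivl)
  also have "\<dots> = C * norm (q - p)" by simp
  finally show ?thesis .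
qed

text \<open>A crude comparison with the Euclidean norm. It bounds lengths of short segments from above, which turns
  Euclidean convergence into convergence for the Riemannian distance.\<close>

lemma mnorm_le:
  assumes "\<bar>E (fst z) (snd z)\<bar> + 2 * \<bar>F (fst z) (snd z)\<bar> + \<bar>G (fst z) (snd z)\<bar> \<le> K"
  shows "mnorm z v \<le> sqrt K * norm v"
proof -
  obtain a b where v: "v = (a, b)" by (cases v)
  let ?e = "E (fst z) (snd z)" and ?f = "F (fst z) (snd z)" and ?g = "G (fst z) (snd z)"
  have n: "(norm v)\<^sup>2 = a\<^sup>2 + b\<^sup>2" by (simp add: v norm_Pair)
  have ab: "2 * \<bar>a * b\<bar> \<le> a\<^sup>2 + b\<^sup>2"
    using sum_squares_bound[of "\<bar>a\<bar>" "\<bar>b\<bar>"] by (simp add: abs_mult)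
  have "?e * a\<^sup>2 \<le> \<bar>?e\<bar> * (norm v)\<^sup>2" "?g * b\<^sup>2 \<le> \<bar>?g\<bar> * (norm v)\<^sup>2"
    unfolding n by (intro mult_mono, auto)+
  moreover have "2 * ?f * a * b \<le> 2 * \<bar>?f\<bar> * (norm v)\<^sup>2"
  proof -
    have "2 * ?f * a * b \<le> \<bar>2 * ?f * a * b\<bar>" by simp
    also have "\<dots> = \<bar>?f\<bar> * (2 * \<bar>a * b\<bar>)" by (simp add: abs_mult)
    also have "\<dots> \<le> \<bar>?f\<bar> * (norm v)\<^sup>2" unfolding n using ab by (intro mult_left_mono) auto
    also have "\<dots> \<le> 2 * \<bar>?f\<bar> * (norm v)\<^sup>2" by (simp add: mult_right_mono)
    finally show ?thesis .
  qed
  ultimately have "?e * a\<^sup>2 + 2 * ?f * a * b + ?g * b\<^sup>2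
      \<le> (\<bar>?e\<bar> + 2 * \<bar>?f\<bar> + \<bar>?g\<bar>) * (norm v)\<^sup>2"
    by (simp add: algebra_simps)
  also have "\<dots> \<le> K * (norm v)\<^sup>2" using assms by (intro mult_right_mono) auto
  finally have "mnorm z v \<le> sqrt (K * (norm v)\<^sup>2)"
    unfolding metric_norm_def v by (intro real_sqrt_le_mono) simp
  thus ?thesis by (simp add: real_sqrt_mult)
qed

lemma riem_dist_tendsto_zero:
  assumes nonneg: "\<And>p v. p \<in> \<Omega> \<Longrightarrow> 0 \<le> mnorm p v" and \<sigma>: "\<sigma> \<longlonglongrightarrow> p" and p: "p \<in> \<Omega>"
  shows "(\<lambda>n. riem_dist \<Omega> E F G (\<sigma> n) p) \<longlonglongrightarrow> 0"
proof -
  let ?k = "\<lambda>z. \<bar>E (fst z) (snd z)\<bar> + 2 * \<bar>F (fst z) (snd z)\<bar> + \<bar>G (fst z) (snd z)\<bar>"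
  have "continuous_on \<Omega> ?k"
    using cont by (intro continuous_intros) (simp_all add: case_prod_unfold)
  hence "isCont ?k p" using continuous_on_eq_continuous_at[OF op] p by blast
  hence "(?k \<longlongrightarrow> ?k p) (nhds p)" by (simp add: isCont_def tendsto_nhds_iff)
  hence "\<forall>\<^sub>F z in nhds p. ?k z < ?k p + 1" by (rule order_tendstoD) simp
  hence "\<forall>\<^sub>F z in nhds p. z \<in> \<Omega> \<and> ?k z < ?k p + 1"
    using eventually_nhds_in_open[OF op p] by eventually_elim simp
  then obtain \<delta> where \<delta>: "\<delta> > 0" "\<And>z. dist z p < \<delta> \<Longrightarrow> z \<in> \<Omega> \<and> ?k z < ?k p + 1"
    unfolding eventually_nhds_metric by blast
  let ?C = "sqrt (?k p + 1)"
  have le: "riem_dist \<Omega> E F G (\<sigma> n) p \<le> ?C * norm (p - \<sigma> n)"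
    and ge: "0 \<le> riem_dist \<Omega> E F G (\<sigma> n) p" if n: "dist (\<sigma> n) p < \<delta>" for n
  proof -
    show "riem_dist \<Omega> E F G (\<sigma> n) p \<le> ?C * norm (p - \<sigma> n)"
    proof (rule riem_dist_le[OF nonneg, of "ball p \<delta>"])
      fix z v assume "z \<in> ball p \<delta>"
      hence "?k z \<le> ?k p + 1" using \<delta>(2)[of z] by (simp add: dist_commute)
      thus "mnorm z v \<le> ?C * norm v" by (rule mnorm_le)
    qed (use \<delta> n in \<open>auto simp: dist_commute\<close>)
    have "\<sigma> n \<in> \<Omega>" using \<delta>(2)[OF n] by simp
    from riem_dist_ge[OF this p, of "\<lambda>_. 0" "\<lambda>_ _. 0"] nonneg
    show "0 \<le> riem_dist \<Omega> E F G (\<sigma> n) p" by simp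
  qed
  have ev: "\<forall>\<^sub>F n in sequentially. dist (\<sigma> n) p < \<delta>" using \<sigma> \<delta>(1) by (rule tendstoD)
  have "(\<lambda>n. ?C * norm (p - \<sigma> n)) \<longlonglongrightarrow> ?C * norm (p - p)"
    by (intro tendsto_intros \<sigma>)
  hence lim: "(\<lambda>n. ?C * norm (p - \<sigma> n)) \<longlonglongrightarrow> 0" by simp
  show ?thesis
    by (rule tendsto_sandwich[OF _ _ tendsto_const lim]) (use ev le ge in \<open>auto elim: eventually_mono\<close>)
qed

text \<open>Distance-nonincreasing functions map Cauchy sequences to Cauchy sequences; so the metric
  is complete as soon as two such functions together control the convergence of sequences.\<close>

lemma complete_metricI:
  fixes h1 h2 :: "real \<times> real \<Rightarrow> real"
  assumes h1: "\<And>p. p \<in> \<Omega> \<Longrightarrow> (h1 has_derivative h1' p) (at p)" "\<And>p v. p \<in> \<Omega> \<Longrightarrow> \<bar>h1' p v\<bar> \<le> mnorm p v"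
    and h2: "\<And>p. p \<in> \<Omega> \<Longrightarrow> (h2 has_derivative h2' p) (at p)" "\<And>p v. p \<in> \<Omega> \<Longrightarrow> \<bar>h2' p v\<bar> \<le> mnorm p v"
    and lim: "\<And>\<sigma>::nat \<Rightarrow> real \<times> real. range \<sigma> \<subseteq> \<Omega> \<Longrightarrow> convergent (\<lambda>n. h1 (\<sigma> n)) \<Longrightarrow> convergent (\<lambda>n. h2 (\<sigma> n)) \<Longrightarrow>
        \<exists>p\<in>\<Omega>. \<sigma> \<longlonglongrightarrow> p"
  shows "complete_metric \<Omega> E F G"
  unfolding complete_metric_def
proof (intro allI impI, elim conjE)
  fix \<sigma> :: "nat \<Rightarrow> real \<times> real"
  assume \<sigma>: "range \<sigma> \<subseteq> \<Omega>" and Cauchy: "\<forall>e>0. \<exists>N. \<forall>m\<ge>N. \<forall>n\<ge>N. riem_dist \<Omega> E F G (\<sigma> m) (\<sigma> n) < e"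
  have conv: "convergent (\<lambda>n. h (\<sigma> n))"
    if h: "\<And>p. p \<in> \<Omega> \<Longrightarrow> (h has_derivative h' p) (at p)" "\<And>p v. p \<in> \<Omega> \<Longrightarrow> \<bar>h' p v\<bar> \<le> mnorm p v"
    for h h'
  proof -
    have "Cauchy (\<lambda>n. h (\<sigma> n))"
    proof (rule metric_CauchyI)
      fix e :: real assume "e > 0"
      then obtain N where N: "\<And>m n. m \<ge> N \<Longrightarrow> n \<ge> N \<Longrightarrow> riem_dist \<Omega> E F G (\<sigma> m) (\<sigma> n) < e"
        using Cauchy by blast
      have "dist (h (\<sigma> m)) (h (\<sigma> n)) < e" if "m \<ge> N" "n \<ge> N" for m n
        using riem_dist_ge[OF _ _ h, of "\<sigma> m" "\<sigma> n"] N[OF that] \<sigma>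
        by (force simp: dist_real_def abs_minus_commute)
      thus "\<exists>M. \<forall>m\<ge>M. \<forall>n\<ge>M. dist (h (\<sigma> m)) (h (\<sigma> n)) < e" by blast
    qed
    thus ?thesis by (rule Cauchy_convergent)
  qed
  obtain p where p: "p \<in> \<Omega>" "\<sigma> \<longlonglongrightarrow> p"
    using lim[OF \<sigma> conv[OF h1] conv[OF h2]] by blast
  have "0 \<le> mnorm p v" if "p \<in> \<Omega>" for p v using h1(2)[OF that, of v] by linarith
  thus "\<exists>p\<in>\<Omega>. (\<lambda>n. riem_dist \<Omega> E F G (\<sigma> n) p) \<longlonglongrightarrow> 0"
    using riem_dist_tendsto_zero p by blast
qed

end

lemma S_orig_plane_metric:
  "plane_metric quadrant (affine_E S_orig) (affine_F S_orig) (affine_G S_orig)"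
proof
  show "convex quadrant" unfolding quadrant_def by (intro convex_Times) auto
  have c: "continuous_on quadrant (\<lambda>z. metric_const * (3 + 2 * fst z) * (4 * fst z + 3) / (12 * fst z ^ 3 * (1 + fst z)))"
    "continuous_on quadrant (\<lambda>z. metric_const * (3 + 2 * fst z) / (2 * (fst z)\<^sup>2 * snd z))"
    "continuous_on quadrant (\<lambda>z. metric_const * (3 + 2 * fst z) / (fst z * (snd z)\<^sup>2))"
    unfolding quadrant_def by (auto intro!: continuous_intros)
  show "continuous_on quadrant (\<lambda>(x, y). affine_E S_orig x y)"
    "continuous_on quadrant (\<lambda>(x, y). affine_F S_orig x y)"
    "continuous_on quadrant (\<lambda>(x, y). affine_G S_orig x y)"
    by (rule continuous_on_eq[OF c(1)], auto simp: S_orig_metric simp del: quadrant_iff)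
       (rule continuous_on_eq[OF c(2)], auto simp: S_orig_metric simp del: quadrant_iff,
        rule continuous_on_eq[OF c(3)], auto simp: S_orig_metric simp del: quadrant_iff)
qed (rule open_quadrant)

text \<open>In the isothermal coordinates \<open>(x', y')\<close>, with \<open>x = sinh\<^sup>2(\<surd>3 x')\<close> and \<open>y = exp(y') / sinh(\<surd>3 x')\<close>, the two
  squares are those of \<open>dx'\<close> and \<open>dy'\<close>.\<close>

lemma S_orig_form:
  assumes "(x, y) \<in> quadrant"
  shows "affine_E S_orig x y * a\<^sup>2 + 2 * affine_F S_orig x y * a * b + affine_G S_orig x y * b\<^sup>2
     = metric_const * (3 + 2 * x) / x * (a\<^sup>2 / (12 * x * (1 + x)) + (b / y + a / (2 * x))\<^sup>2)"
proof -
  have n: "x \<noteq> 0" "y \<noteq> 0" "1 + x \<noteq> 0" using assms by auto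
  show ?thesis unfolding S_orig_metric[OF assms]
    using n by (simp add: divide_simps) (simp add: algebra_simps eval_nat_numeral)
qed

text \<open>The conformal factor exceeds \<open>1\<close> everywhere, which bounds \<open>dy'\<close>, and it grows like \<open>3 / x\<close> near
  \<open>x = 0\<close>, just fast enough to bound \<open>d(ln x) / 3\<close>.\<close>

lemma S_orig_form_ge:
  assumes "(x, y) \<in> quadrant"
  shows "\<bar>a / (3 * x)\<bar> \<le> metric_norm (affine_E S_orig) (affine_F S_orig) (affine_G S_orig) (x, y) (a, b)"
    and "\<bar>b / y + a / (2 * x)\<bar> \<le> metric_norm (affine_E S_orig) (affine_F S_orig) (affine_G S_orig) (x, y) (a, b)"
proof -
  have n: "x > 0" "y > 0" using assms by auto
  let ?q = "a\<^sup>2 / (12 * x * (1 + x)) + (b / y + a / (2 * x))\<^sup>2"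
  have r: "(3 + 2 * x) / x \<ge> 1" using n by (simp add: field_simps)
  have c: "metric_const * ((3 + 2 * x) / x) * z \<ge> (3 + 2 * x) / x * z" if "z \<ge> 0" for z
    using mult_right_mono[of 1 metric_const "(3 + 2 * x) / x"] metric_const(1) r that by (intro mult_right_mono) simp_all
  have Q: "metric_const * (3 + 2 * x) / x * ?q = metric_const * ((3 + 2 * x) / x) * ?q" by simp
  have z: "a\<^sup>2 / (12 * x * (1 + x)) \<ge> 0" using n by simp
  have "(a / (3 * x))\<^sup>2 \<le> (3 + 2 * x) / x * (a\<^sup>2 / (12 * x * (1 + x)))"
  proof -
    have "(3 + 2 * x) / x * (a\<^sup>2 / (12 * x * (1 + x))) - (a / (3 * x))\<^sup>2
        = a\<^sup>2 * (5 + 2 * x) / (36 * x\<^sup>2 * (1 + x))"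
    proof -
      have "x \<noteq> 0" "1 + x \<noteq> 0" using n by auto
      thus ?thesis by (simp add: divide_simps) (simp add: algebra_simps eval_nat_numeral)
    qed
    also have "\<dots> \<ge> 0" using n by simp
    finally show ?thesis by simp
  qed
  also have "\<dots> \<le> (3 + 2 * x) / x * ?q" using n by (intro mult_left_mono) auto
  also have "\<dots> \<le> metric_const * (3 + 2 * x) / x * ?q" unfolding Q by (rule c) (use z in simp)
  finally have 1: "(a / (3 * x))\<^sup>2 \<le> metric_const * (3 + 2 * x) / x * ?q" .
  have "(b / y + a / (2 * x))\<^sup>2 \<le> ?q" using z by simp
  also have "\<dots> \<le> (3 + 2 * x) / x * ?q" using mult_right_mono[OF r, of ?q] z by simp
  also have "\<dots> \<le> metric_const * (3 + 2 * x) / x * ?q" unfolding Q by (rule c) (use z in simp)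
  finally have 2: "(b / y + a / (2 * x))\<^sup>2 \<le> metric_const * (3 + 2 * x) / x * ?q" .
  show "\<bar>a / (3 * x)\<bar> \<le> metric_norm (affine_E S_orig) (affine_F S_orig) (affine_G S_orig) (x, y) (a, b)"
    "\<bar>b / y + a / (2 * x)\<bar> \<le> metric_norm (affine_E S_orig) (affine_F S_orig) (affine_G S_orig) (x, y) (a, b)"
    using real_sqrt_le_mono[OF 1] real_sqrt_le_mono[OF 2]
    unfolding metric_norm_def fst_conv snd_conv S_orig_form[OF assms] real_sqrt_abs by simp_all
qed

lemma complete_metric_S_orig:
  "complete_metric quadrant (affine_E S_orig) (affine_F S_orig) (affine_G S_orig)"
proof (rule plane_metric.complete_metricI[OF S_orig_plane_metric,
      where ?h1.0 = "\<lambda>z. ln (fst z) / 3" and ?h1' = "\<lambda>z v. fst v / (3 * fst z)"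
      and ?h2.0 = "\<lambda>z. ln (snd z) + ln (fst z) / 2" and ?h2' = "\<lambda>z v. snd v / snd z + fst v / (2 * fst z)"])
  fix p :: "real \<times> real" and v :: "real \<times> real" assume p: "p \<in> quadrant"
  obtain x y a b where eq: "p = (x, y)" "v = (a, b)" "x > 0" "y > 0" using p by (cases p, cases v) auto
  show "((\<lambda>z. ln (fst z) / 3) has_derivative (\<lambda>v. fst v / (3 * fst p))) (at p)"
    "((\<lambda>z. ln (snd z) + ln (fst z) / 2) has_derivative (\<lambda>v. snd v / snd p + fst v / (2 * fst p))) (at p)"
    using eq by (auto intro!: derivative_eq_intros simp: field_simps)
  show "\<bar>fst v / (3 * fst p)\<bar> \<le> metric_norm (affine_E S_orig) (affine_F S_orig) (affine_G S_orig) p v"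
    "\<bar>snd v / snd p + fst v / (2 * fst p)\<bar> \<le> metric_norm (affine_E S_orig) (affine_F S_orig) (affine_G S_orig) p v"
    using S_orig_form_ge[of x y] p unfolding eq by auto
next
  fix \<sigma> :: "nat \<Rightarrow> real \<times> real"
  assume \<sigma>: "range \<sigma> \<subseteq> quadrant" and "convergent (\<lambda>n. ln (fst (\<sigma> n)) / 3)"
    and "convergent (\<lambda>n. ln (snd (\<sigma> n)) + ln (fst (\<sigma> n)) / 2)"
  then obtain l m where l: "(\<lambda>n. ln (fst (\<sigma> n)) / 3) \<longlonglongrightarrow> l"
    and m: "(\<lambda>n. ln (snd (\<sigma> n)) + ln (fst (\<sigma> n)) / 2) \<longlonglongrightarrow> m"
    unfolding convergent_def by blast
  have pos: "fst (\<sigma> n) > 0" "snd (\<sigma> n) > 0" for n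
    using subsetD[OF \<sigma> rangeI[of \<sigma> n]] by (simp_all add: quadrant_def mem_Times_iff)
  have "(\<lambda>n. exp (3 * (ln (fst (\<sigma> n)) / 3))) \<longlonglongrightarrow> exp (3 * l)"
    by (intro tendsto_intros l)
  hence 1: "(\<lambda>n. fst (\<sigma> n)) \<longlonglongrightarrow> exp (3 * l)" using pos by simp
  have "(\<lambda>n. exp (ln (snd (\<sigma> n)) + ln (fst (\<sigma> n)) / 2 - 3 / 2 * (ln (fst (\<sigma> n)) / 3)))
      \<longlonglongrightarrow> exp (m - 3 / 2 * l)"
    by (intro tendsto_intros l m)
  hence 2: "(\<lambda>n. snd (\<sigma> n)) \<longlonglongrightarrow> exp (m - 3 / 2 * l)" using pos by simp
  from tendsto_Pair[OF 1 2] have "\<sigma> \<longlonglongrightarrow> (exp (3 * l), exp (m - 3 / 2 * l))" by simp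
  thus "\<exists>p\<in>quadrant. \<sigma> \<longlonglongrightarrow> p" by (rule bexI) simp
qed

lemma S_orig_complete_sphere: "complete_hyperbolic_affine_sphere ({0<..} \<times> {0<..}) S_orig"
  using S_orig_proper_affine_sphere complete_metric_S_orig metric_const(1)
  unfolding complete_hyperbolic_affine_sphere_def quadrant_def
  by (intro conjI exI[of _ "- (1 / metric_const)"]) simp_all

theorem theorem3p1:
  shows "complete_hyperbolic_affine_sphere ({0<..} \<times> {0<..}) S_orig
    \<and> (\<forall>t\<in>{0..2 * pi / 3} - regular_params. \<forall>(x, y)\<in>half_plane.
         at t within regular_params \<noteq> bot \<and>
         (\<exists>l. ((\<lambda>s. r_formula s x y) \<longlongrightarrow> l) (at t within regular_params)))
    \<and> is_associated_family half_plane S_iso (r_fam ` {0..2 * pi / 3})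
    \<and> (\<forall>t\<in>{0..2 * pi / 3}.
         affine_invariants half_plane (r_fam t)
           (\<lambda>x y. 3 * ((csch (sqrt 3 * x))\<^sup>2 + 2 / 3)) (-1)
           (\<lambda>x y. exp (3 * \<i> * complex_of_real t)))"
proof (intro conjI ballI)
  show "complete_hyperbolic_affine_sphere ({0<..} \<times> {0<..}) S_orig"
    by (rule S_orig_complete_sphere)
next
  fix t z assume t: "t \<in> {0..2 * pi / 3} - regular_params" and "z \<in> half_plane"
  then obtain x y where z: "z = (x, y)" "x > 0" by (auto simp: half_plane_def)
  obtain l where "((\<lambda>s. r_formula s x y) \<longlongrightarrow> l) (at t within regular_params)"
    using r_formula_limit_singular[OF t] z(2) by metis
  thus "case z of (x, y) \<Rightarrow> at t within regular_params \<noteq> bot \<and>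
         (\<exists>l. ((\<lambda>s. r_formula s x y) \<longlongrightarrow> l) (at t within regular_params))"
    using singular_param_nontrivial[OF t] z(1) by auto
next
  show "is_associated_family half_plane S_iso (r_fam ` {0..2 * pi / 3})"
    by (rule S_iso_associated_family)
next
  fix t :: real assume "t \<in> {0..2 * pi / 3}"
  thus "affine_invariants half_plane (r_fam t) (\<lambda>x y. 3 * ((csch (sqrt 3 * x))\<^sup>2 + 2 / 3)) (-1)
           (\<lambda>x y. exp (3 * \<i> * complex_of_real t))"
    unfolding exp_eq_Complex rho_def[symmetric] by (rule r_fam_invariants)
qed

end
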